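(* Let $K$ be an infinite field and $S=K[x_1,\dots,x_n]$ with the standard grading. Let $d\in\mathbb{N}$ and $0\leq k\leq\binom{n+d-1}{d}$. Then $\{\beta_{i,j}(I(d,k))\}$ is the unique minimal element and $\{\beta_{i,j}(J(d,k))\}$ is the unique maximal element of the partially ordered set $\mathcal{B}(d,k)$.
   Context: $\mathbb{N}=\{0,1,2,\dots\}$. $\beta_{i,j}(I)=\dim_K\operatorname{Tor}^S_i(I,K)_{j}$. A graded ideal $I$ has a $d$-linear resolution if $\beta_{i,i+j}(I)=0$ for all $i$ and all $j\neq d$. $\mathcal{B}(d,k)$ is the set of Betti sequences $\{\beta_{i,j}(I)\}_{i,j}$ where $I\subset S$ is a graded ideal with $d$-linear resolution and $\beta_{0,d}(I)=k$. It is partially ordered by: $\{\beta_{i,j}(I)\}\geq\{\beta_{i,j}(J)\}$ if $\beta_{i,j}(I)\geq\beta_{i,j}(J)$ for all $i,j\in\mathbb{N}$. For monomials, with $|a|=a_1+\dots+a_n$: $x^a>_{rlex}x^b$ if either $|a|>|b|$, or $|a|=|b|$ and there is an $r$ with $a_r<b_r$ and $a_s=b_s$ for $s>r$; $x^a>_{lex}x^b$ if either $|a|>|b|$, or $|a|=|b|$ and there is an $r$ with $a_r>b_r$ and $a_s=b_s$ for $s<r$. $I(d,k)$ (resp. $J(d,k)$) is the ideal of $S$ generated by the $k$ largest monomials of degree $d$ with respect to $>_{rlex}$ (resp. $>_{lex}$); for $k=0$ both are the zero ideal (which counts as having a $d$-linear resolution). *)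

theory Defs
  imports Complex_Main "HOL-Library.Poly_Mapping" "HOL-Algebra.Ideal"
begin

text \<open>
  A monomial \<open>x\<^sup>a\<close> is its exponent vector \<open>a :: nat \<Rightarrow>\<^sub>0 nat\<close>, a polynomial its finitely supported
  coefficient function. The variables of \<open>K[x\<^sub>1,\<dots>,x\<^sub>n]\<close> are those with index in \<open>{1..n}\<close>.
\<close>

type_synonym 'k mpoly = "(nat \<Rightarrow>\<^sub>0 nat) \<Rightarrow>\<^sub>0 'k"

abbreviation keys :: "('a \<Rightarrow>\<^sub>0 'b::zero) \<Rightarrow> 'a set" where
  "keys \<equiv> Poly_Mapping.keys"

abbreviation lookup :: "('a \<Rightarrow>\<^sub>0 'b::zero) \<Rightarrow> 'a \<Rightarrow> 'b" where
  "lookup \<equiv> Poly_Mapping.lookup"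

definition mdeg :: "(nat \<Rightarrow>\<^sub>0 nat) \<Rightarrow> nat" where
  "mdeg a = (\<Sum>i\<in>keys a. lookup a i)"

definition poly_ring :: "nat \<Rightarrow> 'k::field mpoly ring" where
  "poly_ring n =
    \<lparr>carrier = {p. \<forall>a\<in>keys p. keys a \<subseteq> {1..n}},
     monoid.mult = (*), one = 1, zero = 0, add = (+)\<rparr>"

lemma keys_add_nat:
  fixes a b :: "nat \<Rightarrow>\<^sub>0 nat"
  shows "keys (a + b) = keys a \<union> keys b"
  by (auto simp: in_keys_iff lookup_add)

lemma cring_poly_ring: "cring (poly_ring n :: 'k::field mpoly ring)"
proof -
  let ?S = "{p :: 'k mpoly. \<forall>a\<in>keys p. keys a \<subseteq> {1..n}}"
  have add: "p + q \<in> ?S" if "p \<in> ?S" "q \<in> ?S" for p q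
    using that Poly_Mapping.keys_add[of p q] by blast
  have neg: "- p \<in> ?S" if "p \<in> ?S" for p
    using that by simp
  have mult: "p * q \<in> ?S" if pq: "p \<in> ?S" "q \<in> ?S" for p q
  proof (rule CollectI, rule ballI)
    fix c assume "c \<in> keys (p * q)"
    then obtain a b where "c = a + b" "a \<in> keys p" "b \<in> keys q"
      using keys_mult[of p q] by blast
    then show "keys c \<subseteq> {1..n}"
      using pq by (simp add: keys_add_nat)
  qed
  let ?R = "poly_ring n :: 'k mpoly ring"
  have R: "carrier ?R = ?S" "\<And>p q. p \<oplus>\<^bsub>?R\<^esub> q = p + q" "\<And>p q. p \<otimes>\<^bsub>?R\<^esub> q = p * q"
    "\<zero>\<^bsub>?R\<^esub> = 0" "\<one>\<^bsub>?R\<^esub> = 1"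
    by (simp_all add: poly_ring_def)
  have zero: "0 \<in> ?S" and one: "1 \<in> ?S"
    by simp_all
  have inv: "\<exists>q\<in>?S. q + p = 0" if "p \<in> ?S" for p
    using neg[OF that] by (intro bexI[of _ "- p"]) simp_all
  show ?thesis
    by (intro cringI abelian_groupI comm_monoidI; unfold R;
        (rule add mult zero one inv add.assoc add.commute add_0 mult.assoc mult.commute
          mult_1_left distrib_right)?; assumption?)
qed

definition hom_component :: "nat \<Rightarrow> 'k::field mpoly \<Rightarrow> 'k mpoly" where
  "hom_component j p =
    (\<Sum>a\<in>{a \<in> keys p. mdeg a = j}. Poly_Mapping.single a (lookup p a))"

definition graded_ideal :: "nat \<Rightarrow> 'k::field mpoly set \<Rightarrow> bool" where
  "graded_ideal n I \<longleftrightarrow> ideal I (poly_ring n) \<and> (\<forall>p\<in>I. \<forall>j. hom_component j p \<in> I)"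

subsection \<open>Graded free resolutions\<close>

text \<open>
  A graded free module \<open>\<Oplus>\<^sub>g S(-a\<^sub>g)\<close> with basis \<open>(e\<^sub>g)\<close>, \<open>g \<in> G \<subseteq> \<nat>\<close>, consists of the
  finitely supported \<open>S\<close>-valued functions on \<open>G\<close>; \<open>e\<^sub>g\<close> has degree \<open>a\<^sub>g\<close>.
\<close>

definition scale :: "'a::comm_ring_1 \<Rightarrow> ('b \<Rightarrow>\<^sub>0 'a) \<Rightarrow> ('b \<Rightarrow>\<^sub>0 'a)" where
  "scale c v = Poly_Mapping.map ((*) c) v"

lemma lookup_scale: "lookup (scale c v) g = c * lookup v g"
  by (simp add: scale_def Poly_Mapping.map.rep_eq when_def)

interpretation kspace: vector_space "scale :: 'k::field \<Rightarrow> (nat \<Rightarrow>\<^sub>0 'k) \<Rightarrow> (nat \<Rightarrow>\<^sub>0 'k)"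
  by unfold_locales
    (rule poly_mapping_eqI, simp add: lookup_scale lookup_add distrib_left distrib_right mult.assoc)+

text \<open>The linear extension of \<open>e\<^sub>g \<mapsto> f g\<close>.\<close>

definition lin_ext :: "(nat \<Rightarrow> (nat \<Rightarrow>\<^sub>0 'a)) \<Rightarrow> (nat \<Rightarrow>\<^sub>0 'a) \<Rightarrow> (nat \<Rightarrow>\<^sub>0 'a::comm_ring_1)" where
  "lin_ext f v = (\<Sum>g\<in>keys v. scale (lookup v g) (f g))"

definition free_module :: "nat \<Rightarrow> nat set \<Rightarrow> (nat \<Rightarrow>\<^sub>0 'k::field mpoly) set" where
  "free_module n G =
    {v. keys v \<subseteq> G \<and> (\<forall>g. lookup v g \<in> carrier (poly_ring n))}"

text \<open>
  The data of a complex \<open>\<dots> \<rightarrow> F\<^sub>1 \<rightarrow> F\<^sub>0 \<rightarrow> I\<close>: \<open>gens F i\<close> indexes the basis of \<open>F\<^sub>i\<close>, \<open>shift F i g\<close> is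
  the degree of the basis element \<open>e\<^sub>g\<close> of \<open>F\<^sub>i\<close>, \<open>aug F g \<in> I\<close> is the image of \<open>e\<^sub>g \<in> F\<^sub>0\<close>, and
  \<open>bdry F i g \<in> F\<^sub>i\<close> is the image of \<open>e\<^sub>g \<in> F\<^bsub>i+1\<^esub>\<close>.
\<close>

record (overloaded) 'k free_complex =
  gens :: "nat \<Rightarrow> nat set"
  shift :: "nat \<Rightarrow> nat \<Rightarrow> nat"
  aug :: "nat \<Rightarrow> 'k mpoly"
  bdry :: "nat \<Rightarrow> nat \<Rightarrow> (nat \<Rightarrow>\<^sub>0 'k mpoly)"

definition aug_map :: "'k::field free_complex \<Rightarrow> (nat \<Rightarrow>\<^sub>0 'k mpoly) \<Rightarrow> 'k mpoly" where
  "aug_map F v = (\<Sum>g\<in>keys v. lookup v g * aug F g)"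

text \<open>
  Finitely many basis elements in each degree are required instead of finite rank; every graded
  ideal has such a resolution. Basis elements have degree \<open>\<ge> 0\<close> since \<open>I \<subseteq> S\<close>.
\<close>

definition graded_free_resolution ::
  "nat \<Rightarrow> 'k::field mpoly set \<Rightarrow> 'k free_complex \<Rightarrow> bool" where
  "graded_free_resolution n I F \<longleftrightarrow>
    (\<forall>i j. finite {g \<in> gens F i. shift F i g = j}) \<and>
    (\<forall>g\<in>gens F 0. \<forall>a\<in>keys (aug F g). mdeg a = shift F 0 g) \<and>
    (\<forall>i. \<forall>g\<in>gens F (Suc i). bdry F i g \<in> free_module n (gens F i) \<and>
      (\<forall>h. \<forall>a\<in>keys (lookup (bdry F i g) h).
        mdeg a + shift F i h = shift F (Suc i) g)) \<and>
    aug_map F ` free_module n (gens F 0) = I \<and>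
    {v \<in> free_module n (gens F 0). aug_map F v = 0} =
      lin_ext (bdry F 0) ` free_module n (gens F 1) \<and>
    (\<forall>i. {v \<in> free_module n (gens F (Suc i)). lin_ext (bdry F i) v = 0} =
      lin_ext (bdry F (Suc i)) ` free_module n (gens F (Suc (Suc i))))"

subsection \<open>Tor and graded Betti numbers\<close>

text \<open>
  With \<open>K = S/(x\<^sub>1,\<dots>,x\<^sub>n)\<close> (in degree 0), \<open>F\<^sub>i \<otimes>\<^sub>S K\<close> is the \<open>K\<close>-vector space on the same basis as \<open>F\<^sub>i\<close>, and
  the matrix of the induced differential consists of the constant terms of the matrix of the
  original one. \<open>Tor\<^sub>i\<^sup>S(I,K)\<^sub>j\<close> is the degree \<open>j\<close> part of the homology of this complex at \<open>F\<^sub>i \<otimes>\<^sub>S K\<close>.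
\<close>

definition tensorK_part :: "'k::field free_complex \<Rightarrow> nat \<Rightarrow> nat \<Rightarrow> (nat \<Rightarrow>\<^sub>0 'k) set" where
  "tensorK_part F i j = {v. keys v \<subseteq> {g \<in> gens F i. shift F i g = j}}"

definition tensorK_bdry ::
  "'k::field free_complex \<Rightarrow> nat \<Rightarrow> (nat \<Rightarrow>\<^sub>0 'k) \<Rightarrow> (nat \<Rightarrow>\<^sub>0 'k)" where
  "tensorK_bdry F i = lin_ext (\<lambda>g. Poly_Mapping.map (\<lambda>p. lookup p 0) (bdry F i g))"

definition tor_cycles :: "'k::field free_complex \<Rightarrow> nat \<Rightarrow> nat \<Rightarrow> (nat \<Rightarrow>\<^sub>0 'k) set" where
  "tor_cycles F i j = (case i of
      0 \<Rightarrow> tensorK_part F 0 j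
    | Suc l \<Rightarrow> {v \<in> tensorK_part F (Suc l) j. tensorK_bdry F l v = 0})"

definition tor_boundaries :: "'k::field free_complex \<Rightarrow> nat \<Rightarrow> nat \<Rightarrow> (nat \<Rightarrow>\<^sub>0 'k) set" where
  "tor_boundaries F i j = tensorK_bdry F i ` tensorK_part F (Suc i) j"

text \<open>
  Cycles and boundaries are finite-dimensional, so the dimension of the quotient is the difference
  of the dimensions. It does not depend on the resolution chosen.
\<close>

definition betti :: "nat \<Rightarrow> 'k::field mpoly set \<Rightarrow> nat \<Rightarrow> nat \<Rightarrow> nat" where
  "betti n I i j = (let F = (SOME F. graded_free_resolution n I F) in
     kspace.dim (tor_cycles F i j) - kspace.dim (tor_boundaries F i j))"

definition has_linear_resolution :: "nat \<Rightarrow> nat \<Rightarrow> 'k::field mpoly set \<Rightarrow> bool" where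
  "has_linear_resolution n d I \<longleftrightarrow> (\<forall>i j. j \<noteq> d \<longrightarrow> betti n I i (i + j) = 0)"

text \<open>
  The order on Betti sequences is the pointwise order \<open>\<le>\<close> of functions. The \<open>itself\<close> argument
  records the field, which the type of Betti sequences does not mention.
\<close>

definition betti_sequences ::
  "'k::field itself \<Rightarrow> nat \<Rightarrow> nat \<Rightarrow> nat \<Rightarrow> (nat \<Rightarrow> nat \<Rightarrow> nat) set" where
  "betti_sequences _ n d k =
    {betti n I | I :: 'k mpoly set.
      graded_ideal n I \<and> has_linear_resolution n d I \<and> betti n I 0 d = k}"

definition minimal_in :: "'a::order set \<Rightarrow> 'a \<Rightarrow> bool" where
  "minimal_in A b \<longleftrightarrow> b \<in> A \<and> (\<forall>c\<in>A. c \<le> b \<longrightarrow> c = b)"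

definition maximal_in :: "'a::order set \<Rightarrow> 'a \<Rightarrow> bool" where
  "maximal_in A b \<longleftrightarrow> b \<in> A \<and> (\<forall>c\<in>A. b \<le> c \<longrightarrow> c = b)"

subsection \<open>Segment ideals\<close>

definition rlex_greater :: "(nat \<Rightarrow>\<^sub>0 nat) \<Rightarrow> (nat \<Rightarrow>\<^sub>0 nat) \<Rightarrow> bool" where
  "rlex_greater a b \<longleftrightarrow> mdeg a > mdeg b \<or>
    mdeg a = mdeg b \<and> (\<exists>r. lookup a r < lookup b r \<and> (\<forall>s>r. lookup a s = lookup b s))"

definition lex_greater :: "(nat \<Rightarrow>\<^sub>0 nat) \<Rightarrow> (nat \<Rightarrow>\<^sub>0 nat) \<Rightarrow> bool" where
  "lex_greater a b \<longleftrightarrow> mdeg a > mdeg b \<or>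
    mdeg a = mdeg b \<and> (\<exists>r. lookup a r > lookup b r \<and> (\<forall>s<r. lookup a s = lookup b s))"

definition monomials :: "nat \<Rightarrow> nat \<Rightarrow> (nat \<Rightarrow>\<^sub>0 nat) set" where
  "monomials n d = {a. keys a \<subseteq> {1..n} \<and> mdeg a = d}"

text \<open>A monomial is among the \<open>k\<close> largest iff fewer than \<open>k\<close> are larger.\<close>

definition largest_monomials ::
  "((nat \<Rightarrow>\<^sub>0 nat) \<Rightarrow> (nat \<Rightarrow>\<^sub>0 nat) \<Rightarrow> bool) \<Rightarrow> nat \<Rightarrow> nat \<Rightarrow> nat \<Rightarrow> (nat \<Rightarrow>\<^sub>0 nat) set" where
  "largest_monomials gt n d k =
    {a \<in> monomials n d. card {b \<in> monomials n d. gt b a} < k}"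

definition rlex_ideal :: "nat \<Rightarrow> nat \<Rightarrow> nat \<Rightarrow> 'k::field mpoly set" where
  "rlex_ideal n d k =
    Idl\<^bsub>poly_ring n\<^esub> ((\<lambda>a. Poly_Mapping.single a 1) ` largest_monomials rlex_greater n d k)"

definition lex_ideal :: "nat \<Rightarrow> nat \<Rightarrow> nat \<Rightarrow> 'k::field mpoly set" where
  "lex_ideal n d k =
    Idl\<^bsub>poly_ring n\<^esub> ((\<lambda>a. Poly_Mapping.single a 1) ` largest_monomials lex_greater n d k)"

end

theory Submission
  imports Defs "HOL-Computational_Algebra.Polynomial" "HOL-Library.Nat_Bijection"
begin

text \<open>
  Over an infinite field a graded ideal \<open>I\<close> with \<open>d\<close>-linear resolution admits a basis of linear forms
  \<open>y\<^sub>0, \<dots>, y\<^bsub>n-1\<^esub>\<close> such that in degrees \<open>\<ge> d\<close> each \<open>y\<^sub>p\<close> is a nonzerodivisor modulo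
  \<open>I + (y\<^sub>0, \<dots>, y\<^bsub>p-1\<^esub>)\<close>: a socle element there would lift to an off-strand class in Tor, and without
  socle elements a generic linear form is a nonzerodivisor. Cutting down by one form at a time then gives
  \<open>\<beta>\<^bsub>i,i+d\<^esub>(I) = \<Sum>\<^sub>p (\<mu>\<^sub>p - \<mu>\<^bsub>p+1\<^esub>) \<cdot> binomial (n - 1 - p) i\<close>, where \<open>\<mu>\<^sub>p\<close> is the dimension of the image of
  \<open>I\<^sub>d\<close> in \<open>S/(y\<^sub>0, \<dots>, y\<^bsub>p-1\<^esub>)\<close>. Since \<open>\<mu>\<^sub>0 = k\<close> is fixed, \<open>\<mu>\<^sub>n = 0\<close> and the binomials decrease in \<open>p\<close>, larger \<open>\<mu>\<^sub>p\<close>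
  mean smaller Betti numbers. Both monomial segments are stable, so for them the last variables serve as
  \<open>y\<close>. The reverse lexicographic segment attains the trivial bound \<open>\<mu>\<^sub>p \<le> min k (dim (S/(y\<^sub>0, \<dots>, y\<^bsub>p-1\<^esub>))\<^sub>d)\<close>,
  and the lexicographic one has the smallest \<open>\<mu>\<^sub>p\<close> by Green's hyperplane restriction theorem.
\<close>

section \<open>Dimensions of finite-dimensional subspaces\<close>

text \<open>The field may be countable, so a linear form can avoid finitely many exceptional sets of
  parameters but not one for each degree. Hence regularity is obtained only for degrees
  \<open>d <= j < R\<close>, and the induction on the length of the flag asks the shorter flag for a
  larger range: excluding socle elements costs two degrees, and deducing injectivity of a generic
  form costs as many degrees as a certain polynomial in the parameter \<open>t\<close> can have.
  This is why relations over K[t] are produced with an explicit degree bound. In the end the strand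
  formula uses regularity in degree \<open>d\<close> alone, while vanishing off the strand is part
  of the hypothesis on \<open>I\<close>. Genericity is always tested along the curve
  \<open>ell n t\<close> and means "for all but finitely many \<open>t\<close>", so that finitely
  many generic conditions combine. Degree \<open>d = 0\<close> stands apart: constants survive
  modulo all linear forms, so that mu_n need not vanish.\<close>

locale vspace = vector_space
begin

text \<open>The ambient spaces of finitely supported functions are infinite-dimensional, and
  \<open>dim\<close> is the cardinality of a basis, hence 0 for an infinite one; so finiteness has
  to travel with each subspace.\<close>

definition fdim :: "'b set \<Rightarrow> bool" where
  "fdim U \<longleftrightarrow> (\<exists>B. finite B \<and> U \<subseteq> span B)"

lemma fdimI: "finite B \<Longrightarrow> U \<subseteq> span B \<Longrightarrow> fdim U"
  by (auto simp: fdim_def)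

lemma fdim_subset: "fdim W \<Longrightarrow> U \<subseteq> W \<Longrightarrow> fdim U"
  unfolding fdim_def by blast

lemma fdim_zero: "fdim {0}"
  by (rule fdimI[of "{}"]) auto

lemma fdim_basis:
  assumes "fdim U" "subspace U"
  obtains B where "finite B" "independent B" "span B = U" "card B = dim U" "B \<subseteq> U"
proof -
  obtain B where B: "B \<subseteq> U" "independent B" "U \<subseteq> span B" "card B = dim U"
    using basis_exists[of U] by blast
  obtain C where C: "finite C" "U \<subseteq> span C"
    using assms(1) by (auto simp: fdim_def)
  have "finite B"
    using independent_span_bound[OF C(1) B(2)] B(1) C(2) by blast
  moreover have "span B = U"
    using B(1,3) assms(2) by (rule span_subspace)
  ultimately show ?thesis using that B by blast
qed

lemma dim_mono':
  assumes "fdim W" "subspace W" "U \<subseteq> W"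
  shows "dim U \<le> dim W"
proof -
  obtain B where "finite B" "span B = W" "card B = dim W"
    using fdim_basis[OF assms(1,2)] by metis
  then show ?thesis using dim_le_card[of U B] assms(3) by auto
qed

lemma dim_eq_imp_eq:
  assumes "fdim W" "subspace W" "subspace U" "U \<subseteq> W" "dim W \<le> dim U"
  shows "U = W"
proof (rule ccontr)
  assume "U \<noteq> W"
  then obtain x where x: "x \<in> W" "x \<notin> U" using assms(4) by blast
  obtain B where B: "finite B" "independent B" "span B = U" "card B = dim U" "B \<subseteq> U"
    using fdim_basis[OF fdim_subset[OF assms(1,4)] assms(3)] .
  obtain C where C: "finite C" "span C = W" "card C = dim W"
    using fdim_basis[OF assms(1,2)] by metis
  have ind: "independent (insert x B)"
    using x(2) B by (simp add: independent_insert)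
  have "insert x B \<subseteq> span C"
    using x(1) B(5) assms(4) C(2) by auto
  then have "card (insert x B) \<le> card C"
    using independent_span_bound[OF C(1) ind] by blast
  moreover have "x \<notin> B" using x B by auto
  ultimately show False using B C assms(5) by simp
qed

lemma dim_zero_iff:
  assumes "fdim U" "subspace U"
  shows "dim U = 0 \<longleftrightarrow> U = {0}"
proof
  assume "dim U = 0"
  then show "U = {0}"
    using dim_eq_imp_eq[OF assms subspace_single_0] subspace_0[OF assms(2)] by auto
next
  assume "U = {0}"
  then show "dim U = 0" using dim_le_card[of U "{}"] by auto
qed

lemma fdim_span_image:
  assumes "finite B"
  shows "fdim (span B)"
  using assms by (auto simp: fdim_def)

lemma independent_card_dim:
  assumes "fdim W" "subspace W" "independent B" "B \<subseteq> W"
  shows "finite B" "card B \<le> dim W"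
proof -
  obtain C where C: "finite C" "span C = W" "card C = dim W"
    using fdim_basis[OF assms(1,2)] by metis
  then show "finite B" "card B \<le> dim W"
    using independent_span_bound[OF C(1) assms(3)] assms(4) by auto
qed

end

locale vspace_pair = vs1: vspace s1 + vs2: vspace s2
  for s1 :: "'a::field \<Rightarrow> 'b::ab_group_add \<Rightarrow> 'b" and s2 :: "'a \<Rightarrow> 'c::ab_group_add \<Rightarrow> 'c"

sublocale vspace_pair \<subseteq> vector_space_pair s1 s2 ..

text \<open>Rank-nullity for the composite of \<open>f\<close> with the projection modulo \<open>W\<close>.\<close>

lemma (in vspace_pair) relative_rank_nullity:
  assumes f: "Vector_Spaces.linear s1 s2 f"
    and U: "vs1.fdim U" "vs1.subspace U" and W: "vs2.fdim W" "vs2.subspace W"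
  shows "vs2.dim {w + f u |w u. w \<in> W \<and> u \<in> U} + vs1.dim {u \<in> U. f u \<in> W} = vs2.dim W + vs1.dim U"
proof -
  let ?K = "{u \<in> U. f u \<in> W}"
  have sK: "vs1.subspace ?K"
    using U W vs1.subspace_inter[OF U(2) linear_subspace_linear_preimage[OF f W(2)]]
    by (simp add: Int_def)
  obtain C where C: "finite C" "vs1.independent C" "vs1.span C = ?K" "card C = vs1.dim ?K" "C \<subseteq> ?K"
    using vs1.fdim_basis[OF vs1.fdim_subset[OF U(1), of ?K] sK] by auto
  obtain B where B: "C \<subseteq> B" "B \<subseteq> U" "vs1.independent B" "U \<subseteq> vs1.span B"
    using vs1.maximal_independent_subset_extend[of C U] C by auto
  have sB: "vs1.span B = U" using B U(2) vs1.span_subspace by blast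
  have fB: "finite B" "card B = vs1.dim U"
    using vs1.independent_card_dim[OF U B(3,2)] vs1.basis_card_eq_dim[OF B(2,4,3)] by auto
  \<comment> \<open>\<open>E\<close> completes a basis \<open>C\<close> of the kernel to a basis of
    \<open>U\<close>, so its images are independent modulo \<open>W\<close>; together with a basis
    of \<open>W\<close> they form a basis of the sum.\<close>
  define E where "E = B - C"
  have E: "finite E" "card E = card B - card C" "E \<subseteq> U"
    using fB B C by (auto simp: E_def card_Diff_subset)
  obtain A where A: "finite A" "vs2.independent A" "vs2.span A = W" "card A = vs2.dim W" "A \<subseteq> W"
    using vs2.fdim_basis[OF W] .
  have coef: "\<forall>e\<in>E. c e = 0" if "f (\<Sum>e\<in>E. s1 (c e) e) \<in> W" for c
  proof -
    have "(\<Sum>e\<in>E. s1 (c e) e) \<in> ?K"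
      using that E U by (auto intro!: vs1.subspace_sum vs1.subspace_scale)
    then have "(\<Sum>e\<in>E. s1 (c e) e) \<in> vs1.span C" using C by simp
    then obtain g where g: "(\<Sum>e\<in>E. s1 (c e) e) = (\<Sum>e\<in>C. s1 (g e) e)"
      using vs1.span_finite[OF C(1)] by auto
    define h where "h e = (if e \<in> C then - g e else c e)" for e
    have "(\<Sum>e\<in>B. s1 (h e) e) = (\<Sum>e\<in>E. s1 (h e) e) + (\<Sum>e\<in>C. s1 (h e) e)"
      unfolding E_def using B fB by (simp add: sum.subset_diff)
    also have "(\<Sum>e\<in>E. s1 (h e) e) = (\<Sum>e\<in>E. s1 (c e) e)"
      by (rule sum.cong) (auto simp: h_def E_def)
    also have "(\<Sum>e\<in>C. s1 (h e) e) = - (\<Sum>e\<in>C. s1 (g e) e)"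
      by (simp add: h_def sum_negf)
    finally have "(\<Sum>e\<in>B. s1 (h e) e) = 0" using g by simp
    then have "\<forall>e\<in>B. h e = 0"
      using vs1.independentD[OF B(3) fB(1) subset_refl, of h] by blast
    then show ?thesis by (auto simp: h_def E_def)
  qed
  have inj: "inj_on f E"
  proof (rule inj_onI)
    fix a b assume ab: "a \<in> E" "b \<in> E" "f a = f b"
    show "a = b"
    proof (rule ccontr)
      assume ne: "a \<noteq> b"
      let ?c = "\<lambda>e. if e = a then 1 else if e = b then - 1 else (0::'a)"
      have "(\<Sum>e\<in>E. s1 (?c e) e) = (\<Sum>e\<in>{a,b}. s1 (?c e) e)"
        by (rule sum.mono_neutral_right) (use ab E in auto)
      also have "\<dots> = a - b" using ne by simp
      finally have "f (\<Sum>e\<in>E. s1 (?c e) e) = 0" using ab by (simp add: linear_diff[OF f])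
      then have "\<forall>e\<in>E. ?c e = 0" using coef[of ?c] vs2.subspace_0[OF W(2)] by metis
      then show False using ab by (metis zero_neq_one)
    qed
  qed
  have disj: "A \<inter> f ` E = {}"
  proof (rule ccontr)
    assume "A \<inter> f ` E \<noteq> {}"
    then obtain a where a: "a \<in> E" "f a \<in> W" using A by auto
    let ?c = "\<lambda>e. if e = a then 1 else (0::'a)"
    have "(\<Sum>e\<in>E. s1 (?c e) e) = (\<Sum>e\<in>{a}. s1 (?c e) e)"
      by (rule sum.mono_neutral_right) (use a E in auto)
    then have "f (\<Sum>e\<in>E. s1 (?c e) e) \<in> W" using a by simp
    from coef[OF this] show False using a by auto
  qed
  let ?T = "{w + f u |w u. w \<in> W \<and> u \<in> U}"
  have "vs2.independent (A \<union> f ` E)"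
  proof (rule vs2.independent_if_scalars_zero)
    show fin: "finite (A \<union> f ` E)" using A E by simp
    fix h x assume h: "(\<Sum>x\<in>A \<union> f ` E. s2 (h x) x) = 0" and x: "x \<in> A \<union> f ` E"
    have *: "(\<Sum>x\<in>A \<union> f ` E. s2 (h x) x) = (\<Sum>x\<in>A. s2 (h x) x) + (\<Sum>e\<in>E. s2 (h (f e)) (f e))"
      using disj A E inj by (simp add: sum.union_disjoint sum.reindex)
    have **: "(\<Sum>e\<in>E. s2 (h (f e)) (f e)) = f (\<Sum>e\<in>E. s1 (h (f e)) e)"
      by (simp add: linear_sum[OF f] linear_scale[OF f])
    have "(\<Sum>e\<in>E. s2 (h (f e)) (f e)) = - (\<Sum>x\<in>A. s2 (h x) x)"
      using h * by (simp add: eq_neg_iff_add_eq_0 add.commute)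
    also have "\<dots> \<in> W"
      using A W by (auto intro!: vs2.subspace_neg vs2.subspace_sum vs2.subspace_scale)
    finally have E0: "\<forall>e\<in>E. h (f e) = 0"
      using coef[of "\<lambda>e. h (f e)"] ** by simp
    then have "(\<Sum>x\<in>A. s2 (h x) x) = 0" using h * by simp
    then have "\<forall>x\<in>A. h x = 0"
      using vs2.independentD[OF A(2) A(1) subset_refl, of h] by blast
    then show "h x = 0" using E0 x by auto
  qed
  moreover have "A \<union> f ` E \<subseteq> ?T"
  proof
    fix x assume "x \<in> A \<union> f ` E"
    then show "x \<in> ?T"
    proof
      assume "x \<in> A"
      then have "x = x + f 0 \<and> x \<in> W \<and> 0 \<in> U"
        using A U by (auto simp: linear_0[OF f] vs1.subspace_0)
      then show ?thesis by blast
    next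
      assume "x \<in> f ` E"
      then obtain e where "x = 0 + f e \<and> 0 \<in> W \<and> e \<in> U"
        using E W by (auto simp: vs2.subspace_0)
      then show ?thesis by blast
    qed
  qed
  moreover have "?T \<subseteq> vs2.span (A \<union> f ` E)"
  proof
    fix x assume "x \<in> ?T"
    then obtain w u where x: "x = w + f u" "w \<in> W" "u \<in> U" by blast
    have "B = E \<union> C" using B by (auto simp: E_def)
    then have "u \<in> vs1.span (E \<union> C)" using x sB by simp
    then obtain a b where ab: "u = a + b" "a \<in> vs1.span E" "b \<in> ?K"
      using C(3) by (auto simp: vs1.span_Un)
    have "f a \<in> vs2.span (f ` E)" using ab linear_span_image[OF f, of E] by blast
    moreover have "w + f b \<in> vs2.span A" using ab x A(3) W by (auto simp: vs2.subspace_add)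
    ultimately have "(w + f b) + f a \<in> vs2.span (A \<union> f ` E)"
      by (auto simp: vs2.span_Un)
    then show "x \<in> vs2.span (A \<union> f ` E)"
      using x ab by (simp add: linear_add[OF f] algebra_simps)
  qed
  ultimately have "vs2.dim ?T = card (A \<union> f ` E)"
    by (intro vs2.dim_unique) auto
  also have "\<dots> = card A + card E"
    using disj A E inj by (simp add: card_Un_disjoint card_image)
  finally show ?thesis using A C E fB B card_mono[OF fB(1) B(1)] by simp
qed

lemma (in vspace_pair) rank_nullity:
  assumes f: "Vector_Spaces.linear s1 s2 f" and U: "vs1.fdim U" "vs1.subspace U"
  shows "vs2.dim (f ` U) + vs1.dim {u \<in> U. f u = 0} = vs1.dim U"
proof -
  have "{w + f u |w u. w \<in> {0} \<and> u \<in> U} = f ` U" by auto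
  moreover have "vs2.dim {0} = 0"
    using vs2.dim_zero_iff[of "{0}"] vs2.fdim_zero by simp
  ultimately show ?thesis
    using relative_rank_nullity[OF f U vs2.fdim_zero vs2.subspace_single_0] by simp
qed

lemma (in vspace_pair) dim_injective_image:
  assumes f: "Vector_Spaces.linear s1 s2 f" and U: "vs1.fdim U" "vs1.subspace U"
    and inj: "\<And>u. u \<in> U \<Longrightarrow> f u = 0 \<Longrightarrow> u = 0"
  shows "vs2.dim (f ` U) = vs1.dim U"
proof -
  have "{u \<in> U. f u = 0} = {0}"
    using inj vs1.subspace_0[OF U(2)] linear_0[OF f] by auto
  then show ?thesis
    using rank_nullity[OF f U] vs1.dim_zero_iff[of "{0}"] vs1.fdim_zero by simp
qed

context vspace
begin

lemma dim_sum_inter: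
  assumes U: "fdim U" "subspace U" and W: "fdim W" "subspace W"
  shows "dim {w + u |w u. w \<in> W \<and> u \<in> U} + dim {u \<in> U. u \<in> W} = dim W + dim U"
proof -
  interpret vspace_pair scale scale ..
  show ?thesis
    using relative_rank_nullity[OF module_hom_ident U W] .
qed

lemma dim_disjoint:
  assumes S: "fdim S" "subspace S" and U: "subspace U" "U \<subseteq> S" and W: "subspace W" "W \<subseteq> S"
    and "\<And>u. u \<in> U \<Longrightarrow> u \<in> W \<Longrightarrow> u = 0"
  shows "dim U + dim W \<le> dim S"
proof -
  have fd: "fdim U" "fdim W" using fdim_subset[OF S(1)] U W by auto
  have "{u \<in> U. u \<in> W} = {0}"
    using assms(7) subspace_0[OF U(1)] subspace_0[OF W(1)] by auto
  moreover have "dim {0} = 0" using dim_zero_iff[of "{0}"] fdim_zero by simp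
  moreover have "dim {w + u |w u. w \<in> W \<and> u \<in> U} \<le> dim S"
    by (rule dim_mono'[OF S]) (use U W subspace_add[OF S(2)] in blast)
  ultimately show ?thesis using dim_sum_inter[OF fd(1) U(1) fd(2) W(1)] by simp
qed

text \<open>Stands in for a quotient space: injectivity modulo \<open>A\<close> will be tested on
  \<open>U\<close>. A basis of \<open>A\<close> is extended inside \<open>S\<close>, and the added
  vectors span \<open>U\<close>.\<close>

lemma complement:
  assumes S: "fdim S" "subspace S" and A: "subspace A" "A \<subseteq> S"
  obtains U where "subspace U" "U \<subseteq> S" "dim A + dim U = dim S" "\<And>u. u \<in> U \<Longrightarrow> u \<in> A \<Longrightarrow> u = 0"
    "\<And>v. v \<in> S \<Longrightarrow> \<exists>a\<in>A. \<exists>u\<in>U. v = a + u"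
proof -
  have fdA: "fdim A" by (rule fdim_subset[OF S(1) A(2)])
  obtain C where C: "independent C" "span C = A" "C \<subseteq> A" "finite C" "card C = dim A"
    using fdim_basis[OF fdA A(1)] by metis
  obtain E where E: "C \<subseteq> E" "E \<subseteq> S" "independent E" "S \<subseteq> span E"
    using maximal_independent_subset_extend[of C S] C A(2) by blast
  have sE: "span E = S" using E S(2) span_subspace by blast
  have finE: "finite E" using independent_card_dim[OF S E(3,2)] by blast
  define U where "U = span (E - C)"
  have US: "U \<subseteq> S" unfolding U_def sE[symmetric] by (intro span_mono) auto
  have U: "fdim U" "subspace U" using finE by (auto simp: U_def intro: fdim_span_image)
  have split: "\<exists>a\<in>A. \<exists>u\<in>U. v = a + u" if "v \<in> S" for v
  proof -
    have "v \<in> span (C \<union> (E - C))" using that sE E(1) by (simp add: Un_absorb1)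
    then show ?thesis unfolding span_Un U_def C(2) by blast
  qed
  have "card E = card C + card (E - C)"
    using E(1) finE C(4) card_Diff_subset[of C E] card_mono[OF finE E(1)] by simp
  moreover have "card E = dim S" by (rule basis_card_eq_dim[OF E(2,4,3)])
  moreover have "card (E - C) = dim U"
    unfolding U_def using dim_span_eq_card_independent[OF independent_mono[OF E(3), of "E - C"]] by simp
  ultimately have dims: "dim A + dim U = dim S" using C(5) by simp
  have "{a + u |a u. a \<in> A \<and> u \<in> U} = S"
    using split A US subspace_add[OF S(2)] by blast
  then have "dim {u \<in> U. u \<in> A} = 0" using dim_sum_inter[OF U fdA A(1)] dims by simp
  moreover have "subspace {u \<in> U. u \<in> A}" "fdim {u \<in> U. u \<in> A}"
    using subspace_inter[OF U(2) A(1)] fdim_subset[OF U(1)] by (auto simp: Int_def)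
  ultimately have "{u \<in> U. u \<in> A} = {0}" using dim_zero_iff by blast
  then show ?thesis using that[of U] U US dims split by blast
qed

end

section \<open>Homology of a complex modulo a sequence of linear forms\<close>

text \<open>The degree \<open>j\<close> part of the submodule generated by the first
  \<open>p\<close> forms; it is 0 in degree 0 because forms raise degrees. Operators and pieces are
  parameters, so that one definition serves the polynomial ring, the modules of a resolution and the
  ideal.\<close>

definition Ysum :: "(nat \<Rightarrow> 'v \<Rightarrow> 'v) \<Rightarrow> (nat \<Rightarrow> 'v set) \<Rightarrow> nat \<Rightarrow> nat \<Rightarrow> 'v::ab_group_add set" where
  "Ysum y M p j = (case j of 0 \<Rightarrow> {0} | Suc l \<Rightarrow> {\<Sum>q<p. y q (f q) |f. \<forall>q<p. f q \<in> M l})"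

lemma Ysum_0 [simp]: "Ysum y M p 0 = {0}"
  by (simp add: Ysum_def)

lemma Ysum_Suc: "Ysum y M p (Suc l) = {\<Sum>q<p. y q (f q) |f. \<forall>q<p. f q \<in> M l}"
  by (simp add: Ysum_def)

lemma Ysum_none [simp]: "Ysum y M 0 j = {0}"
  by (cases j) (simp_all add: Ysum_Suc)

lemma Ysum_step: "Ysum y M (Suc p) (Suc l) = {a + y p u |a u. a \<in> Ysum y M p (Suc l) \<and> u \<in> M l}"
proof safe
  fix x assume "x \<in> Ysum y M (Suc p) (Suc l)"
  then obtain f where "x = (\<Sum>q<Suc p. y q (f q))" "\<forall>q<Suc p. f q \<in> M l"
    by (auto simp: Ysum_Suc)
  then show "\<exists>a u. x = a + y p u \<and> a \<in> Ysum y M p (Suc l) \<and> u \<in> M l"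
    by (intro exI[of _ "\<Sum>q<p. y q (f q)"] exI[of _ "f p"]) (auto simp: Ysum_Suc)
next
  fix a u assume "a \<in> Ysum y M p (Suc l)" and u: "u \<in> M l"
  then obtain f where f: "a = (\<Sum>q<p. y q (f q))" "\<forall>q<p. f q \<in> M l"
    by (auto simp: Ysum_Suc)
  let ?f = "f(p := u)"
  have "a + y p u = (\<Sum>q<Suc p. y q (?f q))"
    using f by simp
  moreover have "\<forall>q<Suc p. ?f q \<in> M l"
    using f u by (auto simp: less_Suc_eq)
  ultimately show "a + y p u \<in> Ysum y M (Suc p) (Suc l)"
    unfolding Ysum_Suc by blast
qed

lemma Ysum_cong: "(\<And>q. q < p \<Longrightarrow> y q = y' q) \<Longrightarrow> Ysum y M p j = Ysum y' M p j"
  by (cases j) (auto simp: Ysum_Suc)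

text \<open>
  \<open>M 0\<close> plays the role of \<open>S\<close>, and \<open>M (i + 1)\<close> that of the \<open>i\<close>-th module of a resolution of \<open>I\<close>, so that
  the quotient of \<open>Z p i j\<close> by \<open>B p i j\<close> is the degree \<open>j\<close> part of \<open>Tor\<^sub>i(S/I, S/(y\<^sub>0,\<dots>,y\<^bsub>p-1\<^esub>))\<close>.
\<close>

locale graded_complex = vspace s
  for s :: "'k::field \<Rightarrow> 'v::ab_group_add \<Rightarrow> 'v" +
  fixes n :: nat and M :: "nat \<Rightarrow> nat \<Rightarrow> 'v set" and D :: "nat \<Rightarrow> 'v \<Rightarrow> 'v" and y :: "nat \<Rightarrow> 'v \<Rightarrow> 'v"
  assumes M_subspace: "subspace (M i j)" and M_fdim: "fdim (M i j)"
    and y_lin: "Vector_Spaces.linear s s (y q)"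
    and y_M: "q < n \<Longrightarrow> v \<in> M i j \<Longrightarrow> y q v \<in> M i (Suc j)"
    and y_comm: "y q (y r v) = y r (y q v)"
    and D_lin: "Vector_Spaces.linear s s (D i)"
    and D_M: "v \<in> M (Suc i) j \<Longrightarrow> D i v \<in> M i j"
    and D_y: "D i (y q v) = y q (D i v)"
    and DD: "v \<in> M (Suc (Suc i)) j \<Longrightarrow> D i (D (Suc i) v) = 0"
    and exact: "v \<in> M (Suc i) j \<Longrightarrow> D i v = 0 \<Longrightarrow> \<exists>w\<in>M (Suc (Suc i)) j. v = D (Suc i) w"
    and regular: "p < n \<Longrightarrow> v \<in> M i j \<Longrightarrow> y p v \<in> Ysum y (M i) p (Suc j) \<Longrightarrow> v \<in> Ysum y (M i) p j"
begin

sublocale vspace_pair s s ..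

abbreviation Y where "Y p i j \<equiv> Ysum y (M i) p j"

text \<open>At \<open>i = 0\<close> the cycle condition is void: the quotient there is S/I modulo
  the first \<open>p\<close> forms, the only homology left by exactness when
  \<open>p = 0\<close>.\<close>

definition Z where
  "Z p i j = {v \<in> M i j. \<forall>l. i = Suc l \<longrightarrow> D l v \<in> Y p l j}"

definition B where
  "B p i j = {a + D i w |a w. a \<in> Y p i j \<and> w \<in> M (Suc i) j}"

definition exactT where "exactT p i j \<longleftrightarrow> Z p i j \<subseteq> B p i j"

text \<open>For \<open>i = 0\<close>: \<open>y p\<close> is a nonzerodivisor in degree
  \<open>j\<close> modulo the ideal and the earlier forms. For \<open>i > 0\<close> it is
  injectivity on Tor, since \<open>regular\<close> makes any \<open>u\<close> with
  \<open>y p u\<close> in \<open>B\<close> a cycle.\<close>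

definition colon where
  "colon p i j \<longleftrightarrow> (\<forall>u\<in>M i j. y p u \<in> B p i (Suc j) \<longrightarrow> u \<in> B p i j)"

lemma Z_0: "Z p 0 j = M 0 j"
  by (simp add: Z_def)

lemma Z_Suc: "Z p (Suc i) j = {v \<in> M (Suc i) j. D i v \<in> Y p i j}"
  by (simp add: Z_def)

lemmas lin_simps = linear_add[OF y_lin] linear_0[OF y_lin] linear_diff[OF y_lin] linear_neg[OF y_lin]
  linear_add[OF D_lin] linear_0[OF D_lin] linear_diff[OF D_lin] linear_neg[OF D_lin]

lemma Y_subset: "p \<le> n \<Longrightarrow> Y p i j \<subseteq> M i j"
  by (cases j) (auto simp: Ysum_Suc subspace_0[OF M_subspace] intro!: subspace_sum[OF M_subspace] y_M)

lemma Y_subspace: "subspace (Y p i j)"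
proof (cases j)
  case (Suc l)
  show ?thesis unfolding Suc
  proof (induction p)
    case (Suc p)
    have "Y (Suc p) i (Suc l) = {a + b |a b. a \<in> Y p i (Suc l) \<and> b \<in> y p ` M i l}"
      by (auto simp: Ysum_step)
    then show ?case
      using subspace_sums[OF Suc linear_subspace_image[OF y_lin M_subspace]] by simp
  qed simp
qed simp

lemma Y_fdim: "p \<le> n \<Longrightarrow> fdim (Y p i j)"
  using fdim_subset[OF M_fdim Y_subset] .

lemma y_Y: assumes "r < n" "p \<le> n" "v \<in> Y p i j" shows "y r v \<in> Y p i (Suc j)"
proof (cases j)
  case 0
  then show ?thesis using assms lin_simps(2) subspace_0[OF Y_subspace] by simp
next
  case (Suc l)
  then obtain f where f: "v = (\<Sum>q<p. y q (f q))" "\<forall>q<p. f q \<in> M i l"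
    using assms by (auto simp: Ysum_Suc)
  have "y r v = (\<Sum>q<p. y q (y r (f q)))"
    unfolding f(1) by (simp add: linear_sum[OF y_lin] y_comm[of r])
  moreover have "\<forall>q<p. y r (f q) \<in> M i j" using f assms Suc by (auto intro!: y_M)
  ultimately show ?thesis unfolding Ysum_Suc by (intro CollectI exI[of _ "\<lambda>q. y r (f q)"] conjI)
qed

lemma D_Y: assumes "v \<in> Y p (Suc i) j" "p \<le> n" shows "D i v \<in> Y p i j"
proof (cases j)
  case 0
  then show ?thesis using assms by (simp add: lin_simps)
next
  case (Suc l)
  then obtain f where f: "v = (\<Sum>q<p. y q (f q))" "\<forall>q<p. f q \<in> M (Suc i) l"
    using assms by (auto simp: Ysum_Suc)
  have "D i v = (\<Sum>q<p. y q (D i (f q)))"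
    unfolding f(1) by (simp add: linear_sum[OF D_lin] D_y)
  moreover have "\<forall>q<p. D i (f q) \<in> M i l" using f by (auto intro!: D_M)
  ultimately show ?thesis unfolding Suc Ysum_Suc by (intro CollectI exI[of _ "\<lambda>q. D i (f q)"] conjI)
qed

lemma B_subspace: "subspace (B p i j)"
proof -
  have "B p i j = {a + b |a b. a \<in> Y p i j \<and> b \<in> D i ` M (Suc i) j}"
    by (auto simp: B_def)
  then show ?thesis
    using subspace_sums[OF Y_subspace linear_subspace_image[OF D_lin M_subspace]] by simp
qed

lemma Z_subspace: "subspace (Z p i j)"
proof (cases i)
  case (Suc l)
  have "Z p i j = M i j \<inter> {v. D l v \<in> Y p l j}" by (auto simp: Suc Z_Suc)
  then show ?thesis
    using subspace_inter[OF M_subspace linear_subspace_linear_preimage[OF D_lin Y_subspace]] by simp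
qed (simp add: Z_0 M_subspace)

lemma Z_subset: "Z p i j \<subseteq> M i j"
  by (auto simp: Z_def)

lemma YI_B: "a \<in> Y p i j \<Longrightarrow> a \<in> B p i j"
  using subspace_0[OF M_subspace[of "Suc i" j]] lin_simps(6)[of i] unfolding B_def
  by (metis (mono_tags, lifting) CollectI add.right_neutral)

lemma D_in_B: "w \<in> M (Suc i) j \<Longrightarrow> D i w \<in> B p i j"
  using subspace_0[OF Y_subspace[of i p j]] unfolding B_def
  by (metis (mono_tags, lifting) CollectI add_0)

lemma B_subset_Z: assumes "p \<le> n" shows "B p i j \<subseteq> Z p i j"
proof
  fix v assume "v \<in> B p i j"
  then obtain a w where v: "v = a + D i w" "a \<in> Y p i j" "w \<in> M (Suc i) j" by (auto simp: B_def)
  show "v \<in> Z p i j"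
  proof (cases i)
    case 0
    have "a \<in> M i j" "D i w \<in> M i j" using v Y_subset[OF assms] D_M by blast+
    then show ?thesis using v 0 subspace_add[OF M_subspace] by (simp add: Z_0)
  next
    case (Suc l)
    have "v \<in> M i j" using v Y_subset[OF assms] D_M subspace_add[OF M_subspace] by blast
    moreover have "D l v = D l a" using v DD[of w l j] Suc by (simp add: lin_simps)
    moreover have "D l a \<in> Y p l j" using D_Y v assms Suc by blast
    ultimately show ?thesis by (simp add: Suc Z_Suc)
  qed
qed

lemma B_fdim: "p \<le> n \<Longrightarrow> fdim (B p i j)"
  using fdim_subset[OF M_fdim] B_subset_Z Z_subset by (meson subset_trans)

lemma Z_fdim: "fdim (Z p i j)"
  using fdim_subset[OF M_fdim Z_subset] .

lemma y_B: assumes "r < n" "p \<le> n" "v \<in> B p i j" shows "y r v \<in> B p i (Suc j)"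
proof -
  obtain a w where "v = a + D i w" "a \<in> Y p i j" "w \<in> M (Suc i) j" using assms by (auto simp: B_def)
  then have "y r v = y r a + D i (y r w)" "y r a \<in> Y p i (Suc j)" "y r w \<in> M (Suc i) (Suc j)"
    using y_Y y_M assms by (auto simp: lin_simps D_y)
  then show ?thesis unfolding B_def by blast
qed

lemma B_step: "B (Suc p) i (Suc j) = {a + y p u |a u. a \<in> B p i (Suc j) \<and> u \<in> M i j}"
proof safe
  fix x assume "x \<in> B (Suc p) i (Suc j)"
  then obtain a u w where "x = (a + y p u) + D i w" "a \<in> Y p i (Suc j)" "u \<in> M i j" "w \<in> M (Suc i) (Suc j)"
    unfolding B_def Ysum_step by blast
  then show "\<exists>a u. x = a + y p u \<and> a \<in> B p i (Suc j) \<and> u \<in> M i j"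
    unfolding B_def by (intro exI[of _ "a + D i w"] exI[of _ u]) (auto simp: ac_simps)
next
  fix a u assume "a \<in> B p i (Suc j)" and u: "u \<in> M i j"
  then obtain b w where "a = b + D i w" "b \<in> Y p i (Suc j)" "w \<in> M (Suc i) (Suc j)" by (auto simp: B_def)
  with u show "a + y p u \<in> B (Suc p) i (Suc j)"
    unfolding B_def Ysum_step
    by (intro CollectI exI[of _ "b + y p u"] exI[of _ w]) (auto simp: ac_simps)
qed

lemma cycle_in_B: "v \<in> M (Suc i) j \<Longrightarrow> D i v = 0 \<Longrightarrow> v \<in> B p (Suc i) j"
  using exact[of v i j] D_in_B by blast

lemma exactT_degree_0: "exactT p (Suc i) 0"
  by (auto simp: exactT_def Z_Suc intro: cycle_in_B)

lemma exactT_start: "exactT 0 (Suc i) j"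
  by (auto simp: exactT_def Z_Suc intro: cycle_in_B)

text \<open>Supplies the colon condition for positive index, so that only the one at index 0 remains
  as a hypothesis on the forms: \<open>u\<close> is a cycle by regularity, hence a boundary.\<close>

lemma exactT_colon:
  assumes "exactT p (Suc i) j" "p < n"
  shows "colon p (Suc i) j"
  unfolding colon_def
proof (intro ballI impI)
  fix u assume u: "u \<in> M (Suc i) j" "y p u \<in> B p (Suc i) (Suc j)"
  then have "y p (D i u) \<in> Y p i (Suc j)"
    using B_subset_Z[of p "Suc i" "Suc j"] assms by (auto simp: Z_Suc D_y)
  then have "D i u \<in> Y p i j" using regular assms D_M u by blast
  then show "u \<in> B p (Suc i) j" using assms u by (auto simp: exactT_def Z_Suc)
qed

text \<open>The long exact sequence of multiplication by \<open>y p\<close>, in the case where the outer terms vanish.\<close>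

lemma exactT_step:
  assumes p: "p < n" and ex: "exactT p (Suc i) (Suc j)" and co: "colon p i j"
  shows "exactT (Suc p) (Suc i) (Suc j)"
  unfolding exactT_def
proof
  fix z assume "z \<in> Z (Suc p) (Suc i) (Suc j)"
  then have z: "z \<in> M (Suc i) (Suc j)" "D i z \<in> Y (Suc p) i (Suc j)" by (auto simp: Z_Suc)
  then obtain w u where w: "D i z = w + y p u" "w \<in> Y p i (Suc j)" "u \<in> M i j"
    unfolding Ysum_step by blast
  have "y p u = - w + D i z" using w by simp
  then have "y p u \<in> B p i (Suc j)"
    using w z subspace_neg[OF Y_subspace] unfolding B_def by blast
  then have "u \<in> B p i j" using co w by (auto simp: colon_def)
  then obtain a c where c: "u = a + D i c" "a \<in> Y p i j" "c \<in> M (Suc i) j" by (auto simp: B_def)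
  \<comment> \<open>The coefficient \<open>u\<close> of \<open>y p\<close> in \<open>D i z\<close>
    is the boundary of \<open>c\<close> up to \<open>a\<close>, so subtracting \<open>y p c\<close>
    leaves a cycle modulo one form fewer.\<close>
  have "D i (z - y p c) = w + y p a" using w c by (simp add: lin_simps D_y)
  also have "\<dots> \<in> Y p i (Suc j)" using w c y_Y[OF p _ c(2)] p subspace_add[OF Y_subspace] by simp
  finally have "z - y p c \<in> Z p (Suc i) (Suc j)"
    using z c y_M[OF p] subspace_diff[OF M_subspace] by (simp add: Z_Suc)
  then have "z - y p c \<in> B p (Suc i) (Suc j)" using ex by (auto simp: exactT_def)
  then have "(z - y p c) + y p c \<in> B (Suc p) (Suc i) (Suc j)"
    unfolding B_step using c by blast
  then show "z \<in> B (Suc p) (Suc i) (Suc j)" by simp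
qed

text \<open>Adding a form uses Tor in degree \<open>j\<close> and the colon condition in degree
  \<open>j - 1\<close> one homological step lower. Both keep \<open>j - i\<close>, so the strand is
  never hit and only colons in degrees below \<open>R\<close> enter.\<close>

lemma exactT_off_strand:
  assumes "p \<le> n" and "\<And>q j. q < p \<Longrightarrow> j < R \<Longrightarrow> Suc j \<noteq> d \<Longrightarrow> colon q 0 j"
  shows "j \<le> i + R \<Longrightarrow> j \<noteq> i + d \<Longrightarrow> exactT p (Suc i) j"
  using assms
proof (induction p arbitrary: i j)
  case 0
  then show ?case by (simp add: exactT_start)
next
  case (Suc p)
  note IH = Suc.IH[OF _ _ Suc_leD[OF Suc.prems(3)] Suc.prems(4)[OF less_SucI]]
  show ?case
  proof (cases j)
    case 0
    then show ?thesis using exactT_degree_0 Suc.prems by simp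
  next
    case (Suc l)
    have "colon p i l"
    proof (cases i)
      case 0
      then show ?thesis using Suc.prems Suc by simp
    next
      case (Suc i')
      then show ?thesis
        using exactT_colon[of p i' l] IH[of l i'] Suc.prems \<open>j = Suc l\<close> by simp
    qed
    then show ?thesis
      using exactT_step[of p i l] IH[of j i] Suc.prems Suc by simp
  qed
qed

text \<open>
  A class that is killed by \<open>y\<^sub>p, \<dots>, y\<^bsub>n-1\<^esub>\<close> lifts through the connecting maps to the homology modulo all
  linear forms.
\<close>

lemma socle_lift:
  assumes p: "p < n"
    and ex: "exactT p (Suc i) (Suc (Suc j))"
    and up: "\<And>b. b \<in> M (Suc i) (Suc j) \<Longrightarrow> b \<in> Z (Suc p) (Suc i) (Suc j) \<Longrightarrow>
        (\<And>r. Suc p \<le> r \<Longrightarrow> r < n \<Longrightarrow> y r b \<in> B (Suc p) (Suc i) (Suc (Suc j))) \<Longrightarrow>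
        b \<in> B (Suc p) (Suc i) (Suc j)"
    and z: "z \<in> M i j" and soc: "\<And>r. p \<le> r \<Longrightarrow> r < n \<Longrightarrow> y r z \<in> B p i (Suc j)"
  shows "z \<in> B p i j"
proof -
  \<comment> \<open>\<open>b\<close> is a preimage of the class of \<open>z\<close> under the
    connecting map: its boundary is \<open>y p z\<close> modulo the earlier forms.\<close>
  obtain w b where b: "y p z = w + D i b" "w \<in> Y p i (Suc j)" "b \<in> M (Suc i) (Suc j)"
    using soc[of p] p by (auto simp: B_def)
  have "D i b = - w + y p z" using b by simp
  then have Db: "D i b \<in> Y (Suc p) i (Suc j)"
    unfolding Ysum_step using b z subspace_neg[OF Y_subspace] by blast
  have "b \<in> B (Suc p) (Suc i) (Suc j)"
  proof (rule up)
    show "b \<in> Z (Suc p) (Suc i) (Suc j)" using Db b by (simp add: Z_Suc)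
    fix r assume r: "Suc p \<le> r" "r < n"
    obtain w' b' where b': "y r z = w' + D i b'" "w' \<in> Y p i (Suc j)" "b' \<in> M (Suc i) (Suc j)"
      using soc[of r] r by (auto simp: B_def)
    \<comment> \<open>As the forms commute, the two occurrences of \<open>y r (y p z)\<close>
      cancel; this is what makes \<open>b\<close> a class killed by the later forms again.\<close>
    have "D i (y r b - y p b') = y r (y p z - w) - y p (y r z - w')"
      using b b' by (simp add: lin_simps D_y)
    also have "\<dots> = y p w' - y r w" using y_comm[of r p z] by (simp add: lin_simps)
    also have "\<dots> \<in> Y p i (Suc (Suc j))"
      using y_Y[OF p _ b'(2)] y_Y[OF r(2) _ b(2)] p subspace_diff[OF Y_subspace] by simp
    finally have "y r b - y p b' \<in> Z p (Suc i) (Suc (Suc j))"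
      using b b' y_M p r subspace_diff[OF M_subspace] by (simp add: Z_Suc)
    then have "y r b - y p b' \<in> B p (Suc i) (Suc (Suc j))" using ex by (auto simp: exactT_def)
    then have "(y r b - y p b') + y p b' \<in> B (Suc p) (Suc i) (Suc (Suc j))"
      unfolding B_step using b' by blast
    then show "y r b \<in> B (Suc p) (Suc i) (Suc (Suc j))" by simp
  qed (use b in simp)
  then obtain c u where c: "b = c + y p u" "c \<in> B p (Suc i) (Suc j)" "u \<in> M (Suc i) j"
    unfolding B_step by blast
  have Dc: "D i c \<in> Y p i (Suc j)" using B_subset_Z[of p "Suc i" "Suc j"] p c by (auto simp: Z_Suc)
  have "y p (z - D i u) = w + D i c" using b c by (simp add: lin_simps D_y)
  also have "\<dots> \<in> Y p i (Suc j)" using b Dc subspace_add[OF Y_subspace] by simp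
  finally have "z - D i u \<in> Y p i j"
    using regular[OF p] z c D_M subspace_diff[OF M_subspace] by simp
  then have "(z - D i u) + D i u \<in> B p i j" unfolding B_def using c by blast
  then show ?thesis by simp
qed

text \<open>Iterating \<open>socle_lift\<close> raises \<open>i\<close> and \<open>p\<close>
  together and keeps \<open>j0\<close>, until \<open>p = n\<close>, where the class lies above the
  strand and \<open>top\<close> applies. Exactness is assumed only from index \<open>i\<close>
  upwards: since \<open>i\<close> rises as well, every colon condition met on the way has positive
  index and follows from exactness. The bound \<open>j0 + 2 <= R\<close> reflects that
  \<open>socle_lift\<close> looks at degree \<open>i + j0 + 2\<close>.\<close>

lemma socle_vanishes:
  assumes top: "\<And>i j. i + d < j \<Longrightarrow> exactT n (Suc i) j"
    and "p \<le> n" "p = n \<Longrightarrow> 0 < i" "d \<le> j0" "j0 + 2 \<le> R"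
    and ex: "\<And>i' j. i \<le> i' \<Longrightarrow> i' + d < j \<Longrightarrow> j \<le> i' + R \<Longrightarrow> exactT p (Suc i') j"
    and "z \<in> Z p i (i + j0)"
    and "\<And>r. p \<le> r \<Longrightarrow> r < n \<Longrightarrow> y r z \<in> B p i (Suc (i + j0))"
  shows "z \<in> B p i (i + j0)"
  using assms(2-)
proof (induction "n - p" arbitrary: p i z)
  case 0
  then obtain l where "i = Suc l" "p = n" by (cases i) auto
  then show ?case using top[of l "i + j0"] 0 by (auto simp: exactT_def)
next
  case (Suc m)
  then have p: "p < n" by simp
  show ?case
  proof (rule socle_lift[OF p])
    show "exactT p (Suc i) (Suc (Suc (i + j0)))" using Suc.prems(5)[of i] Suc.prems(3,4) by simp
    show "z \<in> M i (i + j0)" using Suc.prems Z_subset by blast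
    show "y r z \<in> B p i (Suc (i + j0))" if "p \<le> r" "r < n" for r using Suc.prems that by blast
    fix b assume b: "b \<in> M (Suc i) (Suc (i + j0))" "b \<in> Z (Suc p) (Suc i) (Suc (i + j0))"
      "\<And>r. Suc p \<le> r \<Longrightarrow> r < n \<Longrightarrow> y r b \<in> B (Suc p) (Suc i) (Suc (Suc (i + j0)))"
    have "b \<in> B (Suc p) (Suc i) (Suc i + j0)"
    proof (rule Suc.hyps(1))
      show "m = n - Suc p" using Suc by simp
      fix i' j assume ij: "Suc i \<le> i'" "i' + d < j" "j \<le> i' + R"
      then obtain l where l: "j = Suc l" by (cases j) auto
      obtain k where k: "i' = Suc k" using ij by (cases i') auto
      show "exactT (Suc p) (Suc i') j" unfolding l
      proof (rule exactT_step[OF p])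
        show "exactT p (Suc i') (Suc l)" using Suc.prems(5)[of i' j] ij l by simp
        show "colon p i' l" unfolding k
          using exactT_colon[OF _ p] Suc.prems(5)[of k l] ij k l by simp
      qed
    qed (use Suc.prems p b in auto)
    then show "b \<in> B (Suc p) (Suc i) (Suc (i + j0))" by simp
  qed
qed

end

section \<open>Dimension counts along the flag\<close>

context graded_complex
begin

lemma dim_Z:
  assumes "p \<le> n"
  shows "dim (Z p (Suc i) j) + dim (B p i j) = dim (Y p i j) + dim (M (Suc i) j)"
  using relative_rank_nullity[OF D_lin[of i] M_fdim[of "Suc i" j] M_subspace Y_fdim[OF assms, of i j] Y_subspace]
  by (simp add: Z_Suc B_def)

lemma dim_B_step:
  assumes "p \<le> n"
  shows "dim (B (Suc p) i (Suc j)) + dim {u \<in> M i j. y p u \<in> B p i (Suc j)} = dim (B p i (Suc j)) + dim (M i j)"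
  using relative_rank_nullity[OF y_lin[of p] M_fdim[of i j] M_subspace B_fdim[OF assms, of i "Suc j"] B_subspace]
  by (simp add: B_step)

lemma dim_Y_step:
  assumes "p < n"
  shows "dim (Y (Suc p) i (Suc j)) + dim (Y p i j) = dim (Y p i (Suc j)) + dim (M i j)"
proof -
  have "{u \<in> M i j. y p u \<in> Y p i (Suc j)} = Y p i j"
    using regular assms y_Y[OF assms less_imp_le[OF assms]] Y_subset[OF less_imp_le[OF assms]] by blast
  then show ?thesis
    using relative_rank_nullity[OF y_lin[of p] M_fdim[of i j] M_subspace Y_fdim[OF less_imp_le[OF assms], of i "Suc j"] Y_subspace]
    by (simp add: Ysum_step)
qed

text \<open>The dimension of Tor_{i+1} of S/I and S modulo the first \<open>p\<close> forms, in
  degree \<open>j\<close>; the shift by one corresponds to Tor_i of the ideal. Integers keep the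
  differences from being truncated.\<close>

definition hdim :: "nat \<Rightarrow> nat \<Rightarrow> nat \<Rightarrow> int" where
  "hdim p i j = int (dim (Z p (Suc i) j)) - int (dim (B p (Suc i) j))"

definition mu :: "nat \<Rightarrow> nat \<Rightarrow> int" where
  "mu p j = int (dim (B p 0 j)) - int (dim (Y p 0 j))"

text \<open>Vanishing of the target in degree \<open>j + 1\<close> makes \<open>y p\<close> kill
  every class in degree \<open>j\<close>; conversely, regularity shows that whatever it kills is a
  cycle.\<close>

lemma killed_eq_Z:
  assumes "p < n" "exactT p (Suc i) (Suc j)"
  shows "{u \<in> M (Suc i) j. y p u \<in> B p (Suc i) (Suc j)} = Z p (Suc i) j"
proof -
  have "B p (Suc i) (Suc j) = Z p (Suc i) (Suc j)"
    using assms B_subset_Z[of p "Suc i" "Suc j"] by (auto simp: exactT_def)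
  moreover have "y p u \<in> Z p (Suc i) (Suc j) \<longleftrightarrow> u \<in> Z p (Suc i) j" if "u \<in> M (Suc i) j" for u
  proof -
    have "D i u \<in> M i j" "y p u \<in> M (Suc i) (Suc j)"
      using that D_M y_M assms(1) by blast+
    moreover have "y p (D i u) \<in> Y p i (Suc j) \<longleftrightarrow> D i u \<in> Y p i j"
      using regular[OF assms(1) \<open>D i u \<in> M i j\<close>] y_Y[OF assms(1) less_imp_le[OF assms(1)]] by blast
    ultimately show ?thesis using that by (simp add: Z_Suc D_y)
  qed
  ultimately show ?thesis using Z_subset by blast
qed

text \<open>Since Tor_{i+1} vanishes in degree \<open>j\<close>, in degree \<open>j + 1\<close> it
  injects into the one for \<open>p + 1\<close> forms, with cokernel the kernel of
  \<open>y p\<close> on the degree \<open>j\<close> part of Tor_i.\<close>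

lemma hdim_step:
  assumes p: "p < n" and ex: "exactT p (Suc i) j"
  shows "hdim (Suc p) i (Suc j) = hdim p i (Suc j)
    + int (dim {u \<in> M i j. y p u \<in> B p i (Suc j)}) - int (dim (B p i j))"
proof -
  have BZ: "B p (Suc i) j = Z p (Suc i) j"
    using ex B_subset_Z[of p "Suc i" j] p by (auto simp: exactT_def)
  have "{u \<in> M (Suc i) j. y p u \<in> B p (Suc i) (Suc j)} = Z p (Suc i) j"
  proof
    show "{u \<in> M (Suc i) j. y p u \<in> B p (Suc i) (Suc j)} \<subseteq> Z p (Suc i) j"
      using exactT_colon[OF ex p] BZ by (auto simp: colon_def)
    show "Z p (Suc i) j \<subseteq> {u \<in> M (Suc i) j. y p u \<in> B p (Suc i) (Suc j)}"
      using y_B[OF p less_imp_le[OF p]] Z_subset unfolding BZ[symmetric] using BZ by blast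
  qed
  then have "dim {u \<in> M (Suc i) j. y p u \<in> B p (Suc i) (Suc j)} = dim (Z p (Suc i) j)" by simp
  then show ?thesis
    using dim_Z[of "Suc p" i "Suc j"] dim_Z[of p i "Suc j"] dim_B_step[of p i j] dim_B_step[of p "Suc i" j]
      dim_Y_step[OF p, of i j] dim_Z[of p i j] p unfolding hdim_def by linarith
qed

lemma B_eq_Y: "(\<And>v. v \<in> M (Suc 0) j \<Longrightarrow> D 0 v = 0) \<Longrightarrow> B p 0 j = Y p 0 j"
  by (auto simp: YI_B) (auto simp: B_def)

lemma colon_below:
  assumes "\<And>v. v \<in> M (Suc 0) (Suc j) \<Longrightarrow> D 0 v = 0" "p < n"
  shows "colon p 0 j"
proof -
  have "B p 0 (Suc j) = Y p 0 (Suc j)"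
    using assms by (intro B_eq_Y)
  then show ?thesis using regular[OF assms(2)] YI_B by (auto simp: colon_def)
qed

text \<open>Below degree \<open>d\<close> the ideal is 0 and the colon condition reduces to
  regularity. Degree \<open>d - 1\<close> is left out, since there \<open>y p u\<close> may fall
  into the ideal; it affects only the strand.\<close>

lemma exactT_off_strand':
  assumes low: "\<And>j v. j < d \<Longrightarrow> v \<in> M (Suc 0) j \<Longrightarrow> D 0 v = 0"
    and co: "\<And>p j. p < P \<Longrightarrow> d \<le> j \<Longrightarrow> j < R \<Longrightarrow> colon p 0 j"
    and "P \<le> n" "j \<le> i + R" "j \<noteq> i + d"
  shows "exactT P (Suc i) j"
proof (rule exactT_off_strand[OF assms(3) _ assms(4,5)])
  fix q j assume q: "q < P" "j < R" "Suc j \<noteq> d"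
  show "colon q 0 j"
  proof (cases "d \<le> j")
    case False
    then show ?thesis using q low[of "Suc j"] assms(3) by (intro colon_below) auto
  qed (use co q in auto)
qed

text \<open>Pascal's rule. The kernel of \<open>y p\<close> in degree \<open>d - 1\<close> modulo
  ideal and forms has dimension \<open>mu p d - mu (Suc p) d\<close>, which is the new contribution
  at \<open>i = 0\<close>. For \<open>i > 0\<close> the step adds \<open>hdim\<close> of index
  \<open>i - 1\<close>, by \<open>killed_eq_Z\<close>, so the remaining forms spread each
  contribution by binomial coefficients.\<close>

lemma hdim_strand:
  assumes d: "0 < d" and low: "\<And>j v. j < d \<Longrightarrow> v \<in> M (Suc 0) j \<Longrightarrow> D 0 v = 0"
    and co: "\<And>p. p < n \<Longrightarrow> colon p 0 d"
    and "p \<le> n"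
  shows "hdim p i (i + d) = (\<Sum>q<p. (mu q d - mu (Suc q) d) * int ((p - 1 - q) choose i))"
  using \<open>p \<le> n\<close>
proof (induction p arbitrary: i)
  case 0
  have "B 0 (Suc i) (i + d) = Z 0 (Suc i) (i + d)"
    using exactT_start[of i "i + d"] B_subset_Z[of 0] by (auto simp: exactT_def)
  then show ?case by (simp add: hdim_def)
next
  case (Suc p)
  then have p: "p < n" by simp
  obtain e where e: "d = Suc e" using d by (cases d) auto
  have ex: "exactT p (Suc i') j" if "j \<le> i' + Suc d" "j \<noteq> i' + d" for i' j
    using exactT_off_strand'[of d p "Suc d" j i'] low co p that by (auto simp: less_Suc_eq le_antisym)
  have step: "hdim (Suc p) i (Suc (i + e)) = hdim p i (Suc (i + e))
    + int (dim {u \<in> M i (i + e). y p u \<in> B p i (Suc (i + e))}) - int (dim (B p i (i + e)))"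
    using hdim_step[OF p ex] e by simp
  show ?case
  proof (cases i)
    case 0
    have "B p 0 e = Y p 0 e"
      using low[of e] e by (intro B_eq_Y) simp
    then have "dim (B p 0 e) = dim (Y p 0 e)" by simp
    then have "int (dim {u \<in> M 0 e. y p u \<in> B p 0 (Suc e)}) - int (dim (B p 0 e)) = mu p d - mu (Suc p) d"
      using dim_B_step[of p 0 e] dim_Y_step[OF p, of 0 e] p unfolding mu_def e by linarith
    then show ?thesis using step Suc.IH[of 0] p 0 e by simp
  next
    case (Suc k)
    have "{u \<in> M i (i + e). y p u \<in> B p i (Suc (i + e))} = Z p i (i + e)"
      unfolding Suc by (rule killed_eq_Z[OF p ex]) (use e in auto)
    then have "hdim (Suc p) i (i + d) = hdim p i (i + d) + hdim p k (k + d)"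
      using step e Suc by (simp add: hdim_def)
    also have "\<dots> = (\<Sum>q<p. (mu q d - mu (Suc q) d) * int ((p - 1 - q) choose i))
        + (\<Sum>q<p. (mu q d - mu (Suc q) d) * int ((p - 1 - q) choose k))"
      using Suc.IH p by simp
    also have "\<dots> = (\<Sum>q<p. (mu q d - mu (Suc q) d) * int ((p - q) choose i))"
      unfolding sum.distrib[symmetric]
    proof (rule sum.cong, simp)
      fix q assume "q \<in> {..<p}"
      then have "p - q = Suc (p - 1 - q)" by auto
      then show "(mu q d - mu (Suc q) d) * int ((p - 1 - q) choose i) + (mu q d - mu (Suc q) d) * int ((p - 1 - q) choose k)
        = (mu q d - mu (Suc q) d) * int ((p - q) choose i)"
        using Suc by (simp add: algebra_simps)
    qed
    also have "\<dots> = (\<Sum>q<Suc p. (mu q d - mu (Suc q) d) * int ((Suc p - 1 - q) choose i))"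
      using Suc by simp
    finally show ?thesis .
  qed
qed

lemma exactT_hdim:
  assumes "p \<le> n"
  shows "exactT p (Suc i) j \<longleftrightarrow> hdim p i j = 0"
proof
  assume "exactT p (Suc i) j"
  then have "B p (Suc i) j = Z p (Suc i) j" using B_subset_Z[OF assms] by (auto simp: exactT_def)
  then show "hdim p i j = 0" by (simp add: hdim_def)
next
  assume "hdim p i j = 0"
  then have "B p (Suc i) j = Z p (Suc i) j"
    by (intro dim_eq_imp_eq Z_fdim Z_subspace B_subspace B_subset_Z assms) (simp add: hdim_def)
  then show "exactT p (Suc i) j" by (simp add: exactT_def)
qed

end

section \<open>Lexicographic restriction numbers\<close>

text \<open>
  The monomials of degree \<open>d\<close> in \<open>c\<close> variables are listed in decreasing lexicographic order; the entry of a
  monomial tells whether the last variable does not divide the monomial.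
\<close>

fun wd :: "nat \<Rightarrow> nat \<Rightarrow> bool list" where
  "wd c 0 = [True]"
| "wd 0 (Suc d) = []"
| "wd (Suc 0) (Suc d) = [False]"
| "wd (Suc (Suc c)) (Suc d) = wd (Suc (Suc c)) d @ wd (Suc c) (Suc d)"

definition trues :: "bool list \<Rightarrow> nat" where
  "trues w = length (filter id w)"

lemma trues_simps [simp]: "trues [] = 0" "trues (b # w) = (if b then Suc (trues w) else trues w)"
  "trues (v @ w) = trues v + trues w"
  by (simp_all add: trues_def)

lemma trues_le_length: "trues w \<le> length w"
  by (simp add: trues_def)

text \<open>The dimension of the lexicographic segment of length \<open>k\<close> after restriction
  to the hyperplane where the last variable vanishes; in terms of codimensions this is Green's
  function c_{<d>}.\<close>

definition lexr :: "nat \<Rightarrow> nat \<Rightarrow> nat \<Rightarrow> nat" where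
  "lexr c d k = trues (take k (wd c d))"

text \<open>For \<open>wd\<close> this amounts to subadditivity of \<open>lexr\<close>; windows are
  used because the induction moves them across the cut between two blocks.\<close>

definition windows_le :: "bool list \<Rightarrow> bool" where
  "windows_le w \<longleftrightarrow> (\<forall>u v x. w = u @ v @ x \<longrightarrow> trues v \<le> trues (take (length v) w))"

definition windows_ge :: "bool list \<Rightarrow> bool" where
  "windows_ge w \<longleftrightarrow> (\<forall>u v x. w = u @ v @ x \<longrightarrow> trues (drop (length w - length v) w) \<le> trues v)"

text \<open>Turns richest initial windows into poorest final ones, and by \<open>dual_wd\<close>
  exchanges variables and degree.\<close>

definition dual :: "bool list \<Rightarrow> bool list" where
  "dual w = rev (map Not w)"

lemma dual_append [simp]: "dual (v @ w) = dual w @ dual v"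
  by (simp add: dual_def)

lemma length_dual [simp]: "length (dual w) = length w"
  by (simp add: dual_def)

lemma trues_dual: "trues (dual w) = length w - trues w"
proof -
  have "trues (dual w) + trues w = length w"
    unfolding dual_def by (induction w) simp_all
  then show ?thesis by simp
qed

lemma dual_take: "take k (dual w) = dual (drop (length w - k) w)"
  by (simp add: dual_def take_rev drop_map)

text \<open>Reversal swaps the two blocks of the recursion, and the swapped blocks are those of the
  recursion with variables and degree exchanged.\<close>

lemma dual_wd: "dual (wd (Suc c) (Suc d)) = wd (Suc (Suc d)) c"
proof (induction c arbitrary: d)
  case 0
  show ?case by (simp add: dual_def)
next
  case (Suc c)
  show ?case
  proof (induction d)
    case 0
    show ?case using Suc[of 0] by (simp add: dual_def)
  next
    case (Suc d)
    then show ?case using \<open>\<And>d. dual (wd (Suc c) (Suc d)) = wd (Suc (Suc d)) c\<close>[of "Suc d"] by simp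
  qed
qed

lemma windows_ge_dual:
  assumes "windows_le (dual w)"
  shows "windows_ge w"
  unfolding windows_ge_def
proof (intro allI impI)
  fix u v x assume w: "w = u @ v @ x"
  have "trues (dual v) \<le> trues (take (length (dual v)) (dual w))"
    using assms w unfolding windows_le_def by (metis append_assoc dual_append)
  also have "take (length (dual v)) (dual w) = dual (drop (length w - length v) w)"
    by (simp only: dual_take length_dual)
  finally have "length v - trues v \<le> length (drop (length w - length v) w) - trues (drop (length w - length v) w)"
    by (simp only: trues_dual)
  moreover have "length (drop (length w - length v) w) = length v" using w by simp
  ultimately show "trues (drop (length w - length v) w) \<le> trues v"
    using trues_le_length[of "drop (length w - length v) w"] by linarith
qed

definition prefix_le :: "bool list \<Rightarrow> bool list \<Rightarrow> bool" where
  "prefix_le v w \<longleftrightarrow> (\<forall>k. k \<le> length v \<longrightarrow> k \<le> length w \<longrightarrow> trues (take k v) \<le> trues (take k w))"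

lemma windows_le_take:
  assumes "windows_le w" "a + b \<le> length w"
  shows "trues (take (a + b) w) \<le> trues (take a w) + trues (take b w)"
proof -
  have "w = take a w @ take b (drop a w) @ drop (a + b) w"
    by (metis add.commute append_take_drop_id drop_drop)
  then have "trues (take b (drop a w)) \<le> trues (take (length (take b (drop a w))) w)"
    using assms(1) unfolding windows_le_def by blast
  then show ?thesis using assms(2) by (simp add: take_add)
qed

lemma windows_le_window:
  assumes "windows_le w" "a + b \<le> length w"
  shows "trues (take b (drop a w)) \<le> trues (take b w)"
  using windows_le_take[OF assms] by (simp add: take_add)

lemma windows_ge_window:
  assumes "windows_ge w" "a + b \<le> length w"
  shows "trues (drop (length w - b) w) \<le> trues (take b (drop a w))"
proof -
  have "w = take a w @ take b (drop a w) @ drop (a + b) w"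
    by (metis add.commute append_take_drop_id drop_drop)
  then have "trues (drop (length w - length (take b (drop a w))) w) \<le> trues (take b (drop a w))"
    using assms(1) unfolding windows_ge_def by blast
  then show ?thesis using assms(2) by simp
qed

text \<open>Multiplication by the first variable makes the word of one degree a prefix of the next,
  so short initial segments do not depend on the degree.\<close>

lemma take_wd: "k \<le> length (wd (Suc (Suc c)) d) \<Longrightarrow> d \<le> e \<Longrightarrow> take k (wd (Suc (Suc c)) e) = take k (wd (Suc (Suc c)) d)"
proof (induction "e - d" arbitrary: e)
  case (Suc m)
  then obtain e' where e: "e = Suc e'" by (cases e) auto
  have "take k (wd (Suc (Suc c)) e') = take k (wd (Suc (Suc c)) d)"
    using Suc e by (intro Suc.hyps) auto
  moreover have "length (wd (Suc (Suc c)) d) \<le> length (wd (Suc (Suc c)) e')"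
  proof -
    have "d \<le> e'" using Suc e by simp
    then show ?thesis
      by (induction e' rule: dec_induct) (auto simp: le_trans)
  qed
  ultimately show ?case using Suc e by simp
qed simp

lemma take_wd': "k \<le> length (wd (Suc (Suc c)) d) \<Longrightarrow> k \<le> length (wd (Suc (Suc c)) e) \<Longrightarrow>
    take k (wd (Suc (Suc c)) e) = take k (wd (Suc (Suc c)) d)"
  using take_wd[of k c d e] take_wd[of k c e d] by (cases "d \<le> e") auto

text \<open>A prefix longer than the first block of \<open>wd (Suc (Suc c)) (Suc e)\<close> is cut
  at that length by subadditivity: the first piece is settled by induction, and the rest equals a
  prefix of the second block by \<open>take_wd'\<close>.\<close>

lemma prefix_le_wd:
  assumes "windows_le (wd (Suc c) (Suc d))"
  shows "prefix_le (wd (Suc c) (Suc d)) (wd (Suc (Suc c)) e)"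
proof (cases c)
  case 0
  have "trues (take k [False]) = 0" for k by (cases k) simp_all
  then show ?thesis using 0 by (simp add: prefix_le_def)
next
  case (Suc c')
  let ?v = "wd (Suc c) (Suc d)"
  show ?thesis
  proof (induction e)
    case 0
    have "trues (take k ?v) \<le> k" for k
      using trues_le_length[of "take k ?v"] by simp
    from this[of 1] show ?case by (auto simp: prefix_le_def le_Suc_eq)
  next
    case (Suc e)
    let ?w = "wd (Suc (Suc c)) e" and ?x = "wd (Suc c) (Suc e)"
    show ?case unfolding prefix_le_def
    proof (intro allI impI)
      fix k assume k: "k \<le> length ?v" "k \<le> length (wd (Suc (Suc c)) (Suc e))"
      show "trues (take k ?v) \<le> trues (take k (wd (Suc (Suc c)) (Suc e)))"
      proof (cases "k \<le> length ?w")
        case True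
        then show ?thesis using Suc k by (simp add: prefix_le_def)
      next
        case False
        define l where "l = k - length ?w"
        have l: "k = length ?w + l" using False by (simp add: l_def)
        have "trues (take k ?v) \<le> trues (take (length ?w) ?v) + trues (take l ?v)"
          using windows_le_take[OF assms] k l by simp
        also have "take l ?v = take l ?x"
          unfolding \<open>c = Suc c'\<close> by (rule take_wd') (use k l \<open>c = Suc c'\<close> in auto)
        also have "trues (take (length ?w) ?v) \<le> trues ?w"
          using Suc[unfolded prefix_le_def, rule_format, of "length ?w"] k l by simp
        finally show ?thesis using l by simp
      qed
    qed
  qed
qed

lemma windows_leI:
  assumes "\<And>a k. a + k \<le> length w \<Longrightarrow> trues (take k (drop a w)) \<le> trues (take k w)"
  shows "windows_le w"
  unfolding windows_le_def
proof (intro allI impI)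
  fix u v x assume w: "w = u @ v @ x"
  then show "trues v \<le> trues (take (length v) w)"
    using assms[of "length u" "length v"] by simp
qed

text \<open>A window across the cut is compared after swapping its pieces: its part in
  \<open>A\<close> is a suffix, the poorest window of that length in \<open>A\<close>, and its part
  in \<open>B\<close> is a prefix, no richer than that of \<open>A\<close>.\<close>

lemma windows_le_append:
  assumes A: "windows_le A" "windows_ge A" and B: "windows_le B" and BA: "prefix_le B A"
  shows "windows_le (A @ B)"
proof (rule windows_leI)
  fix a k assume ak: "a + k \<le> length (A @ B)"
  have pre: "trues (take l B) \<le> trues (take l A)" if "l \<le> length A" "l \<le> length B" for l
    using BA that by (simp add: prefix_le_def)
  consider "a + k \<le> length A" | "a \<le> length A" "length A < a + k" "k \<le> length A"
    | "a \<le> length A" "length A < k" | "length A < a" "k \<le> length A" | "length A < a" "length A < k"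
    by linarith
  then show "trues (take k (drop a (A @ B))) \<le> trues (take k (A @ B))"
  proof cases
    case 1
    then show ?thesis using windows_le_window[OF A(1) 1] by simp
  next
    case 2
    define l where "l = length A - a"
    have l: "drop a A = drop (length A - l) A" "length (drop a A) = l" "l \<le> k" using 2 by (auto simp: l_def)
    have "trues (drop a A) \<le> trues (take l (drop (k - l) A))"
      unfolding l(1) by (rule windows_ge_window[OF A(2)]) (use 2 l in auto)
    moreover have "trues (take (k - l) B) \<le> trues (take (k - l) A)"
      by (rule pre) (use 2 l ak in \<open>auto simp: l_def\<close>)
    moreover have "trues (take k A) = trues (take (k - l) A) + trues (take l (drop (k - l) A))"
      using take_add[of "k - l" l A] l by simp
    moreover have "trues (take k (drop a (A @ B))) = trues (drop a A) + trues (take (k - l) B)"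
      using 2 by (simp add: l_def)
    moreover have "take k (A @ B) = take k A" using 2 by simp
    ultimately show ?thesis by simp
  next
    case 3
    have "trues (take (k - length A + a) B) \<le> trues (take (k - length A) B) + trues (take a B)"
      by (rule windows_le_take[OF B]) (use 3 ak in auto)
    moreover have "trues (take a B) \<le> trues (take a A)"
      by (rule pre) (use 3 ak in auto)
    moreover have "trues A = trues (take a A) + trues (drop a A)"
      by (metis append_take_drop_id trues_simps(3))
    moreover have "k - (length A - a) = k - length A + a" using 3 by simp
    ultimately show ?thesis using 3 by simp
  next
    case 4
    then have "a - length A + k \<le> length B" using ak by simp
    then show ?thesis
      using windows_le_window[OF B, of "a - length A" k] pre[of k] 4 ak by simp
  next
    case 5
    then have "a - length A + k \<le> length B" using ak by simp
    moreover have "trues (take k B) \<le> trues (take (k - length A) B) + trues (take (length A) B)"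
      using windows_le_take[OF B, of "k - length A" "length A"] 5 ak by simp
    moreover have "trues (take (length A) B) \<le> trues A"
      using pre[of "length A"] 5 ak by simp
    ultimately show ?thesis
      using windows_le_window[OF B, of "a - length A" k] 5 ak by simp
  qed
qed

text \<open>The first block must also have the poorest final windows. By \<open>dual_wd\<close> this
  is the same claim for a word with variables and degree exchanged, whose sum \<open>c + d\<close>
  is smaller.\<close>

lemma windows_le_wd: "windows_le (wd (Suc c) d)"
proof (induction "c + d" arbitrary: c d rule: less_induct)
  case less
  have short: "windows_le [b]" for b
  proof (rule windows_leI)
    fix a k assume "a + k \<le> length [b]"
    then have "a = 0 \<or> k = 0" by (cases a) auto
    then show "trues (take k (drop a [b])) \<le> trues (take k [b])" by auto
  qed
  show ?case
  proof (cases "c = 0 \<or> d = 0")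
    case True
    then show ?thesis using short by (cases d) auto
  next
    case False
    then obtain c' d' where cd: "c = Suc c'" "d = Suc d'" by (metis not0_implies_Suc)
    have ge: "windows_ge (wd (Suc c) d')"
    proof (cases d')
      case 0
      then show ?thesis using short[of False] by (intro windows_ge_dual) (simp add: dual_def)
    next
      case (Suc e)
      then have "dual (wd (Suc c) d') = wd (Suc (Suc e)) c" using dual_wd by simp
      moreover have "windows_le (wd (Suc (Suc e)) c)"
        using less[of "Suc e" c] cd Suc by simp
      ultimately show ?thesis by (intro windows_ge_dual) simp
    qed
    have "windows_le (wd (Suc c) d')" "windows_le (wd (Suc c') (Suc d'))"
      using less[of c d'] less[of c' "Suc d'"] cd by auto
    then show ?thesis
      using windows_le_append[OF _ ge _ prefix_le_wd[of c' d' d', folded cd]] cd by simp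
  qed
qed

section \<open>Recursion and inequalities for the restriction numbers\<close>

lemma length_wd_1 [simp]: "length (wd (Suc 0) d) = 1"
  by (cases d) auto

lemma trues_wd: "trues (wd (Suc (Suc c)) d) = length (wd (Suc c) d)"
proof (induction d arbitrary: c)
  case (Suc d)
  show ?case
  proof (induction c)
    case 0
    show ?case using Suc[of 0] by simp
  next
    case (Suc c)
    then show ?case using \<open>\<And>c. trues (wd (Suc (Suc c)) d) = length (wd (Suc c) d)\<close>[of "Suc c"] by simp
  qed
qed simp

text \<open>A segment within the first block is the first variable times a segment of lower degree;
  a longer one, as in \<open>lexr_large\<close>, consists of the whole block and a segment in one
  variable fewer. The arguments below run on this dichotomy.\<close>

lemma lexr_small:
  "k \<le> length (wd (Suc (Suc c)) d) \<Longrightarrow> lexr (Suc (Suc c)) (Suc d) k = lexr (Suc (Suc c)) d k"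
  by (simp add: lexr_def)

lemma lexr_large:
  "lexr (Suc (Suc c)) (Suc d) (length (wd (Suc (Suc c)) d) + k) = length (wd (Suc c) d) + lexr (Suc c) (Suc d) k"
  by (simp add: lexr_def trues_wd)

lemma lexr_le: "lexr c d k \<le> k"
  unfolding lexr_def using trues_le_length[of "take k (wd c d)"] by simp

lemma lexr_mono: assumes "k \<le> l" shows "lexr c d k \<le> lexr c d l"
proof -
  have "take l (wd c d) = take k (wd c d) @ take (l - k) (drop k (wd c d))"
    using take_add[of k "l - k" "wd c d"] assms by simp
  then show ?thesis by (simp add: lexr_def)
qed

lemma lexr_subadditive: "a + b \<le> length (wd (Suc c) d) \<Longrightarrow> lexr (Suc c) d (a + b) \<le> lexr (Suc c) d a + lexr (Suc c) d b"
  unfolding lexr_def by (rule windows_le_take[OF windows_le_wd])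

lemma lexr_full: "lexr (Suc (Suc c)) d (length (wd (Suc (Suc c)) d)) = length (wd (Suc c) d)"
  by (simp add: lexr_def trues_wd)

lemma lexr_le_full: "lexr (Suc (Suc c)) d k \<le> length (wd (Suc c) d)"
proof (cases "k \<le> length (wd (Suc (Suc c)) d)")
  case True
  then show ?thesis using lexr_mono[OF True, of "Suc (Suc c)" d] lexr_full[of c d] by simp
qed (simp add: lexr_def trues_wd)

lemma lexr_0 [simp]: "lexr c d 0 = 0"
  by (simp add: lexr_def)

lemma lexr_pos: assumes "0 < k" shows "0 < lexr (Suc (Suc c)) d k"
proof -
  have "hd (wd (Suc (Suc c)) d)" "wd (Suc (Suc c)) d \<noteq> []" by (induction d) auto
  then obtain w where "wd (Suc (Suc c)) d = True # w" by (cases "wd (Suc (Suc c)) d") auto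
  then show ?thesis using assms by (cases k) (auto simp: lexr_def)
qed

lemma lexr_degree_1: "lexr (Suc (Suc c)) (Suc 0) k = min k (Suc c)"
proof (induction c arbitrary: k)
  case 0
  have "take k [True, False] = (if k = 0 then [] else if k = 1 then [True] else [True, False])"
    by (cases k) (auto simp: take_Cons split: nat.splits)
  then show ?case by (simp add: lexr_def)
next
  case (Suc c)
  show ?case
  proof (cases k)
    case (Suc l)
    then show ?thesis using lexr_large[of "Suc c" 0 l] \<open>\<And>k. _ k = min k (Suc c)\<close>[of l] by simp
  qed simp
qed

lemma length_wd_degree_1: "length (wd (Suc c) (Suc 0)) = Suc c"
  by (induction c) auto

lemma lexr_2: "lexr (Suc (Suc 0)) d k \<le> 1"
  using lexr_le_full[of 0 d k] by simp

text \<open>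
  In Green's argument \<open>k\<close> is the dimension of a space of forms, \<open>e\<close> that of its restriction to a generic
  hyperplane, and \<open>k - e\<close> that of its colon by the equation of the hyperplane; the first assumption comes from
  restricting the last two to another generic hyperplane.
\<close>

lemma lexr_restriction:
  assumes "lexr (Suc c) (Suc d) e + lexr (Suc (Suc c)) d (k - e) \<le> e"
    and "e \<le> k" "k \<le> length (wd (Suc (Suc c)) (Suc d))" "k - e \<le> length (wd (Suc (Suc c)) d)"
    and "e \<le> length (wd (Suc c) (Suc d))"
  shows "lexr (Suc (Suc c)) (Suc d) k \<le> e"
  using assms
proof (induction "c + d" arbitrary: c d e k rule: less_induct)
  case less
  note prems = less.prems
  show ?case
  proof (cases c)
    case 0
    show ?thesis
    proof (cases "e = 0")
      case True
      then have "k = 0" using prems lexr_pos[of k 0 d] 0 by (cases k) auto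
      then show ?thesis by simp
    next
      case False
      then show ?thesis using lexr_2[of "Suc d" k] 0 by simp
    qed
  next
    case c: (Suc c')
    show ?thesis
    proof (cases d)
      case 0
      then have "k - e = 0 \<or> k - e = 1" "lexr (Suc c) (Suc d) e = min e c"
        using prems lexr_degree_1[of c' e] c by auto
      moreover have "lexr (Suc (Suc c)) d 1 = 1" using 0 by (simp add: lexr_def)
      moreover have "e \<le> Suc c" using prems 0 length_wd_degree_1[of c] by simp
      ultimately have "k = e \<or> (k = e + 1 \<and> Suc c \<le> e)"
        using prems by (auto simp: min_def split: if_splits)
      then show ?thesis using lexr_degree_1[of c k] 0 lexr_le[of "Suc (Suc c)" "Suc d" k] by auto
    next
      case d: (Suc d')
      \<comment> \<open>\<open>?P\<close>, \<open>?N\<close> and \<open>?Q\<close> are the lengths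
        of the first blocks for \<open>k\<close>, \<open>e\<close> and \<open>k - e\<close>. If all
        three numbers stay within, the degree drops; if all go beyond, a variable drops; the mixed
        cases are settled directly.\<close>
      let ?P = "length (wd (Suc (Suc c)) d)" and ?N = "length (wd (Suc c) d)" and ?Q = "length (wd (Suc (Suc c)) d')"
      have PQ: "?P = ?Q + ?N" using d by simp
      have N: "?N = length (wd (Suc c) d') + length (wd c d)" using c d by simp
      show ?thesis
      proof (cases "k \<le> ?P")
        case kP: True
        then have r: "lexr (Suc (Suc c)) (Suc d) k = lexr (Suc (Suc c)) d k" by (rule lexr_small)
        show ?thesis
        proof (cases "e \<le> ?N")
          case False
          then show ?thesis using r lexr_le_full[of c d k] by simp
        next
          case eN: True
          then have re: "lexr (Suc c) (Suc d) e = lexr (Suc c) d e" using c by (simp add: lexr_small)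
          show ?thesis
          proof (cases "k - e \<le> ?Q")
            case True
            then have "lexr (Suc (Suc c)) d (k - e) = lexr (Suc (Suc c)) d' (k - e)"
              unfolding d by (rule lexr_small)
            then have "lexr (Suc (Suc c)) (Suc d') k \<le> e"
              using less.hyps[of c d' e k] prems re kP eN True d by simp
            then show ?thesis using r d by simp
          next
            case False
            define l where "l = k - e - ?Q"
            have l: "k - e = ?Q + l" "k = ?Q + (e + l)" using False prems by (auto simp: l_def)
            have "lexr (Suc (Suc c)) d (k - e) = length (wd (Suc c) d') + lexr (Suc c) d l"
              unfolding l(1) d by (rule lexr_large)
            moreover have "lexr (Suc (Suc c)) d k = length (wd (Suc c) d') + lexr (Suc c) d (e + l)"
              unfolding l(2) d by (rule lexr_large)
            moreover have "lexr (Suc c) d (e + l) \<le> lexr (Suc c) d e + lexr (Suc c) d l"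
              by (rule lexr_subadditive) (use kP l PQ in simp)
            ultimately show ?thesis using prems re r by simp
          qed
        qed
      next
        case False
        define l where "l = k - ?P"
        have l: "k = ?P + l" "0 < l" using False by (auto simp: l_def)
        have le: "l \<le> e" using l prems by simp
        have r: "lexr (Suc (Suc c)) (Suc d) k = ?N + lexr (Suc c) (Suc d) l"
          unfolding l(1) by (rule lexr_large)
        show ?thesis
        proof (cases "e \<le> ?N")
          case eN: True
          then have re: "lexr (Suc c) (Suc d) e = lexr (Suc c) d e" using c by (simp add: lexr_small)
          have "k - e = ?Q + (?N - e + l)" using l le eN PQ by simp
          then have rk: "lexr (Suc (Suc c)) d (k - e) = length (wd (Suc c) d') + lexr (Suc c) d (?N - e + l)"
            unfolding d by (simp only: lexr_large)
          have full: "lexr (Suc c) d ?N = length (wd c d)" using lexr_full[of c' d] c by simp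
          \<comment> \<open>The hypothesis now forces \<open>e = ?N\<close> and then
            \<open>lexr (Suc c) d l = 0\<close>, impossible for \<open>l > 0\<close>.\<close>
          have "lexr (Suc c) d ?N \<le> lexr (Suc c) d e + lexr (Suc c) d (?N - e)"
            using lexr_subadditive[of e "?N - e" c d] eN by simp
          also have "lexr (Suc c) d (?N - e) \<le> lexr (Suc c) d (?N - e + l)"
            by (rule lexr_mono) simp
          finally have "?N \<le> e" using prems(1) re rk full N by simp
          then have "e = ?N" using eN by simp
          then have "lexr (Suc c) d l = 0" using prems(1) re rk full N by simp
          then show ?thesis using lexr_pos[OF l(2), of c' d] c by simp
        next
          case False
          define f where "f = e - ?N"
          have f: "e = ?N + f" using False by (simp add: f_def)
          show ?thesis
          proof (cases "l \<le> f")
            case True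
            then show ?thesis using r f lexr_le[of "Suc c" "Suc d" l] by simp
          next
            case lf: False
            have "lexr (Suc c) (Suc d) e = length (wd c d) + lexr c (Suc d) f"
              unfolding f c by (rule lexr_large)
            moreover have "k - e = ?Q + (l - f)" using l f lf PQ by simp
            then have "lexr (Suc (Suc c)) d (k - e) = length (wd (Suc c) d') + lexr (Suc c) d (l - f)"
              unfolding d by (simp only: lexr_large)
            \<comment> \<open>The full blocks cancel, because \<open>?N\<close> is the sum of the
              numbers that they contribute; what is left is the hypothesis in one variable
              fewer.\<close>
            ultimately have "lexr c (Suc d) f + lexr (Suc c) d (l - f) \<le> f"
              using prems(1) f N by simp
            moreover have "l - f \<le> ?N" using prems(4) l f PQ \<open>k - e = ?Q + (l - f)\<close> by simp
            ultimately have "lexr (Suc (Suc c')) (Suc d) l \<le> f"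
              using less.hyps[of c' d f l] prems l f lf c by simp
            then show ?thesis using r f c by simp
          qed
        qed
      qed
    qed
  qed
qed

section \<open>Graded pieces of the polynomial ring\<close>

lemma vspace_scale: "vspace (scale :: 'k::field \<Rightarrow> ('b \<Rightarrow>\<^sub>0 'k) \<Rightarrow> ('b \<Rightarrow>\<^sub>0 'k))"
  by unfold_locales (rule poly_mapping_eqI, simp add: lookup_scale lookup_add algebra_simps)+

interpretation pv: vspace "scale :: 'k::field \<Rightarrow> ('b \<Rightarrow>\<^sub>0 'k) \<Rightarrow> ('b \<Rightarrow>\<^sub>0 'k)"
  by (rule vspace_scale)

lemma poly_mapping_expand: "(\<Sum>a\<in>keys p. Poly_Mapping.single a (lookup p a)) = p"
proof (rule poly_mapping_eqI)
  fix x
  have "lookup (\<Sum>a\<in>keys p. Poly_Mapping.single a (lookup p a)) x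
      = (\<Sum>a\<in>keys p. if a = x then lookup p a else 0)"
    unfolding lookup_sum by (rule sum.cong) (auto simp: lookup_single when_def)
  also have "\<dots> = lookup p x" by (simp add: in_keys_iff)
  finally show "lookup (\<Sum>a\<in>keys p. Poly_Mapping.single a (lookup p a)) x = lookup p x" .
qed

lemma keys_scale: "keys (scale c p) \<subseteq> keys p"
  by (auto simp: in_keys_iff lookup_scale)

definition supported :: "'b set \<Rightarrow> ('b \<Rightarrow>\<^sub>0 'k::field) set" where
  "supported A = {p. keys p \<subseteq> A}"

lemma scale_single: "scale c (Poly_Mapping.single a b) = Poly_Mapping.single a (c * b)"
  by (rule poly_mapping_eqI) (simp add: lookup_scale lookup_single when_def)

lemma supported_subspace: "pv.subspace (supported A :: ('b \<Rightarrow>\<^sub>0 'k::field) set)"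
proof (rule pv.subspaceI)
  show "x + z \<in> supported A" if "x \<in> supported A" "z \<in> supported A" for x z :: "'b \<Rightarrow>\<^sub>0 'k"
    using that Poly_Mapping.keys_add[of x z] unfolding supported_def by blast
  show "scale c x \<in> supported A" if "x \<in> supported A" for c and x :: "'b \<Rightarrow>\<^sub>0 'k"
    using that keys_scale[of c x] unfolding supported_def by blast
qed (simp add: supported_def)

lemma supported_span: "supported A = pv.span ((\<lambda>a. Poly_Mapping.single a (1::'k::field)) ` A)"
proof
  show "pv.span ((\<lambda>a. Poly_Mapping.single a (1::'k)) ` A) \<subseteq> supported A"
    by (rule pv.span_minimal[OF _ supported_subspace]) (auto simp: supported_def)
  show "supported A \<subseteq> pv.span ((\<lambda>a. Poly_Mapping.single a (1::'k)) ` A)"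
  proof
    fix p :: "'a \<Rightarrow>\<^sub>0 'k" assume "p \<in> supported A"
    then have "keys p \<subseteq> A" by (simp add: supported_def)
    have "(\<Sum>a\<in>keys p. scale (lookup p a) (Poly_Mapping.single a 1)) \<in> pv.span ((\<lambda>a. Poly_Mapping.single a (1::'k)) ` A)"
      by (intro pv.span_sum pv.span_scale pv.span_base) (use \<open>keys p \<subseteq> A\<close> in auto)
    then show "p \<in> pv.span ((\<lambda>a. Poly_Mapping.single a (1::'k)) ` A)"
      by (simp add: scale_single poly_mapping_expand)
  qed
qed

lemma supported_fdim: "finite A \<Longrightarrow> pv.fdim (supported A)"
  unfolding supported_span by (intro pv.fdim_span_image) simp

lemma supported_dim:
  assumes "finite A"
  shows "pv.dim (supported A :: ('b \<Rightarrow>\<^sub>0 'k::field) set) = card A"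
proof -
  let ?f = "\<lambda>a::'b. Poly_Mapping.single a (1::'k)"
  have inj: "inj_on ?f A"
    by (rule inj_onI) (metis lookup_single_eq lookup_single_not_eq zero_neq_one)
  have "pv.independent (?f ` A)"
  proof (rule pv.independent_if_scalars_zero)
    fix h x assume h: "(\<Sum>x\<in>?f ` A. scale (h x) x) = 0" and x: "x \<in> ?f ` A"
    then obtain a where a: "a \<in> A" "x = ?f a" by auto
    have "0 = lookup (\<Sum>b\<in>A. scale (h (?f b)) (?f b)) a"
      using h by (simp add: sum.reindex[OF inj])
    also have "\<dots> = (\<Sum>b\<in>A. if b = a then h (?f b) else 0)"
      unfolding lookup_sum by (rule sum.cong) (auto simp: lookup_scale lookup_single when_def)
    also have "\<dots> = h (?f a)" using a assms by simp
    finally show "h x = 0" using a by simp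
  qed (use assms in simp)
  then show ?thesis
    unfolding supported_span pv.dim_span using pv.dim_eq_card_independent inj
    by (metis card_image)
qed

lemma mdeg_superset: "finite A \<Longrightarrow> keys a \<subseteq> A \<Longrightarrow> mdeg a = (\<Sum>i\<in>A. lookup a i)"
  unfolding mdeg_def by (rule sum.mono_neutral_left) (auto simp: in_keys_iff)

lemma mdeg_add: "mdeg (a + b) = mdeg a + mdeg b"
  by (simp add: mdeg_superset[of "keys a \<union> keys b"] keys_add_nat lookup_add sum.distrib)

lemma mdeg_single [simp]: "mdeg (Poly_Mapping.single i c) = c"
  by (cases "c = 0") (simp_all add: mdeg_def)

lemma mdeg_0_iff [simp]: "mdeg a = 0 \<longleftrightarrow> a = 0"
proof
  assume "mdeg a = 0"
  then have "\<forall>i\<in>keys a. lookup a i = 0" by (simp add: mdeg_def)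
  then show "a = 0" by (metis in_keys_iff keys_eq_empty ex_in_conv)
qed (simp add: mdeg_def)

lemma mdeg_zero [simp]: "mdeg 0 = 0"
  by simp

lemma monomial_split:
  assumes "i \<in> keys a"
  obtains b where "a = Poly_Mapping.single i 1 + b" "mdeg a = Suc (mdeg b)" "keys b \<subseteq> keys a"
proof -
  define b where "b = a - Poly_Mapping.single i 1"
  have "a = Poly_Mapping.single i 1 + b"
    by (rule poly_mapping_eqI)
      (use assms in \<open>auto simp: b_def lookup_add lookup_minus lookup_single when_def in_keys_iff\<close>)
  moreover from this have "keys b \<subseteq> keys a" "mdeg a = Suc (mdeg b)"
    by (metis keys_add_nat sup_ge2, metis mdeg_add mdeg_single plus_1_eq_Suc)
  ultimately show ?thesis using that by blast
qed

section \<open>The monomials in decreasing lexicographic order\<close>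

fun lexmons :: "nat \<Rightarrow> nat \<Rightarrow> nat \<Rightarrow> (nat \<Rightarrow>\<^sub>0 nat) list" where
  "lexmons a c 0 = [0]"
| "lexmons a 0 (Suc d) = []"
| "lexmons a (Suc c) (Suc d) = map ((+) (Poly_Mapping.single a 1)) (lexmons a (Suc c) d) @ lexmons (Suc a) c (Suc d)"

lemma set_lexmons: "set (lexmons a c d) = {u. keys u \<subseteq> {a..<a + c} \<and> mdeg u = d}"
proof (induction a c d rule: lexmons.induct)
  case (2 a d)
  have "mdeg u = 0" if "keys u \<subseteq> {}" for u using that by simp
  then show ?case by auto
next
  case (3 a c d)
  show ?case
  proof (intro Set.set_eqI iffI)
    fix u assume "u \<in> set (lexmons a (Suc c) (Suc d))"
    then consider v where "u = Poly_Mapping.single a 1 + v" "v \<in> set (lexmons a (Suc c) d)"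
      | "u \<in> set (lexmons (Suc a) c (Suc d))" by auto
    then show "u \<in> {u. keys u \<subseteq> {a..<a + Suc c} \<and> mdeg u = Suc d}"
    proof cases
      case 1
      then show ?thesis using 3(1) by (auto simp: keys_add_nat mdeg_add)
    next
      case 2
      then show ?thesis using 3(2) by fastforce
    qed
  next
    fix u assume u: "u \<in> {u. keys u \<subseteq> {a..<a + Suc c} \<and> mdeg u = Suc d}"
    show "u \<in> set (lexmons a (Suc c) (Suc d))"
    proof (cases "a \<in> keys u")
      case True
      obtain v where "u = Poly_Mapping.single a 1 + v" "mdeg u = Suc (mdeg v)" "keys v \<subseteq> keys u"
        using monomial_split[OF True] .
      then show ?thesis using u 3(1) by auto
    next
      case False
      then have "keys u \<subseteq> {Suc a..<Suc a + c}" using u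
        by (auto simp: subset_iff) (metis le_antisym not_less_eq_eq)
      then show ?thesis using u 3(2) by auto
    qed
  qed
qed auto

lemma lexmons_monomials: "set (lexmons 1 n d) = monomials n d"
  unfolding set_lexmons monomials_def by auto

lemma finite_monomials [simp]: "finite (monomials n d)"
  by (metis List.finite_set lexmons_monomials)

lemma sorted_lexmons: "sorted_wrt lex_greater (lexmons a c d)"
proof (induction a c d rule: lexmons.induct)
  case (3 a c d)
  have shift: "lex_greater (Poly_Mapping.single a 1 + u) (Poly_Mapping.single a 1 + v)" if "lex_greater u v" for u v
    using that by (auto simp: lex_greater_def mdeg_add lookup_add)
  have "lex_greater (Poly_Mapping.single a 1 + u) v"
    if "u \<in> set (lexmons a (Suc c) d)" "v \<in> set (lexmons (Suc a) c (Suc d))" for u v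
    unfolding lex_greater_def
  proof (intro disjI2 conjI exI[of _ a] allI impI)
    show "mdeg (Poly_Mapping.single a 1 + u) = mdeg v"
      using that by (simp add: set_lexmons mdeg_add)
    have v: "lookup v i = 0" if "i \<le> a" for i
      using \<open>v \<in> _\<close> that by (auto simp: set_lexmons in_keys_iff subset_iff)
    show "lookup v a < lookup (Poly_Mapping.single a 1 + u) a"
      using v[of a] by (simp add: lookup_add)
    fix s assume s: "s < a"
    have "lookup u s = 0"
      using \<open>u \<in> _\<close> s by (auto simp: set_lexmons in_keys_iff subset_iff)
    then show "lookup (Poly_Mapping.single a 1 + u) s = lookup v s"
      using s v[of s] by (simp add: lookup_add lookup_single)
  qed
  then show ?case
    using 3 shift by (auto simp: sorted_wrt_append sorted_wrt_map intro: sorted_wrt_mono_rel[rotated])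
qed auto

lemma lex_greater_irrefl: "\<not> lex_greater u u"
  by (simp add: lex_greater_def)

lemma distinct_lexmons: "distinct (lexmons a c d)"
  using sorted_lexmons[of a c d] lex_greater_irrefl
  by (metis distinct_conv_nth linorder_neqE_nat sorted_wrt_nth_less)

text \<open>Ties the words to monomials, block by block. One variable is a case of its own, since
  there the first variable, by which the first block is multiplied, is also the last.\<close>

lemma map_lexmons: "map (\<lambda>u. a + c \<notin> keys u) (lexmons a (Suc c) d) = wd (Suc c) d"
proof (induction "Suc c" d arbitrary: a c rule: wd.induct)
  case (3 d)
  have "lexmons a (Suc 0) d = [Poly_Mapping.single a d]" for a
    by (induction d) (simp_all add: single_add[symmetric])
  then show ?case by (simp add: keys_add_nat)
next
  case (4 c d)
  have "map (\<lambda>u. a + Suc c \<notin> keys u) (lexmons (Suc a) (Suc c) (Suc d)) = wd (Suc c) (Suc d)"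
    using 4(2)[of "Suc a"] by simp
  moreover have "map (\<lambda>u. a + Suc c \<notin> keys u) (lexmons a (Suc (Suc c)) d) = wd (Suc (Suc c)) d"
    using 4(1) by simp
  ultimately show ?case by (simp add: comp_def keys_add_nat)
qed auto

lemma length_lexmons: "length (lexmons a c d) = length (wd c d)"
proof (cases c)
  case 0
  then show ?thesis by (cases d) auto
next
  case (Suc c')
  then show ?thesis using map_lexmons[of a c' d] by (metis length_map)
qed

lemma card_monomials: "card (monomials n d) = length (wd n d)"
  using distinct_card[OF distinct_lexmons[of 1 n d]] unfolding lexmons_monomials length_lexmons .

lemma length_wd_rec: "length (wd (Suc c) (Suc d)) = length (wd (Suc c) d) + length (wd c (Suc d))"
  by (cases c) auto

lemma length_wd: "length (wd n d) = (n + d - 1) choose d"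
proof (induction n d rule: wd.induct)
  case (4 c d)
  then show ?case by (simp add: algebra_simps)
next
  case (2 d)
  show ?case by simp
qed auto

section \<open>Graded components of the polynomial ring\<close>

definition Sd :: "nat \<Rightarrow> nat \<Rightarrow> 'k::field mpoly set" where
  "Sd n j = supported (monomials n j)"

lemma Sd_subspace: "pv.subspace (Sd n j)" and Sd_fdim: "pv.fdim (Sd n j)"
  and Sd_dim: "pv.dim (Sd n j :: 'k::field mpoly set) = length (wd n j)"
  by (simp_all add: Sd_def supported_subspace supported_fdim supported_dim card_monomials)

lemma Sd_iff: "p \<in> Sd n j \<longleftrightarrow> (\<forall>a\<in>keys p. keys a \<subseteq> {1..n} \<and> mdeg a = j)"
  by (auto simp: Sd_def supported_def monomials_def)

lemma Sd_0: "0 \<in> Sd n j" by (simp add: Sd_iff)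

lemma Sd_mult: "p \<in> Sd n i \<Longrightarrow> q \<in> Sd n j \<Longrightarrow> p * q \<in> Sd n (i + j)"
  unfolding Sd_iff
proof
  fix c assume p: "\<forall>a\<in>keys p. keys a \<subseteq> {1..n} \<and> mdeg a = i" and q: "\<forall>a\<in>keys q. keys a \<subseteq> {1..n} \<and> mdeg a = j"
    and "c \<in> keys (p * q)"
  then obtain a b where "c = a + b" "a \<in> keys p" "b \<in> keys q"
    using keys_mult[of p q] by blast
  then show "keys c \<subseteq> {1..n} \<and> mdeg c = i + j"
    using p q by (simp add: keys_add_nat mdeg_add)
qed

lemma Sd_linear_mult: "p \<in> Sd n 1 \<Longrightarrow> q \<in> Sd n j \<Longrightarrow> p * q \<in> Sd n (Suc j)"
  using Sd_mult[of p n 1 q j] by simp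

lemma scale_conv_mult: "scale c (p :: 'k::field mpoly) = Poly_Mapping.single 0 c * p"
  unfolding scale_def by (rule mult_map_scale_conv_mult)

lemma linear_mult: "Vector_Spaces.linear scale scale ((*) (p :: 'k::field mpoly))"
  by (simp add: Vector_Spaces.linear_iff pv.vector_space_axioms algebra_simps scale_conv_mult)

definition Var :: "nat \<Rightarrow> 'k::field mpoly" where
  "Var i = Poly_Mapping.single (Poly_Mapping.single i 1) 1"

lemma Var_Sd: "i \<in> {1..n} \<Longrightarrow> Var i \<in> Sd n 1"
  by (simp add: Var_def Sd_iff)

lemma Sd_const: "(Sd n 0 :: 'k::field mpoly set) = range (Poly_Mapping.single 0)"
proof safe
  fix p :: "'k mpoly" assume "p \<in> Sd n 0"
  then have "keys p \<subseteq> {0}" by (auto simp: Sd_iff)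
  then have "p = Poly_Mapping.single 0 (lookup p 0)"
    by (intro poly_mapping_eqI) (auto simp: lookup_single when_def in_keys_iff subset_iff)
  then show "p \<in> range (Poly_Mapping.single 0)" by blast
qed (simp add: Sd_iff)

interpretation pp: vspace_pair "scale :: 'k::field \<Rightarrow> ('b \<Rightarrow>\<^sub>0 'k) \<Rightarrow> ('b \<Rightarrow>\<^sub>0 'k)"
    "scale :: 'k::field \<Rightarrow> ('c \<Rightarrow>\<^sub>0 'k) \<Rightarrow> ('c \<Rightarrow>\<^sub>0 'k)" ..

text \<open>Phrased with \<open>Ysum\<close> so that \<open>good_full_all\<close> can trade the
  variables for any basis of linear forms.\<close>

lemma Sd_Suc: "(Sd n (Suc j) :: 'k::field mpoly set) = Ysum (\<lambda>q. (*) (Var (Suc q))) (Sd n) n (Suc j)"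
proof
  show "Ysum (\<lambda>q. (*) (Var (Suc q))) (Sd n) n (Suc j) \<subseteq> (Sd n (Suc j) :: 'k mpoly set)"
    unfolding Ysum_Suc by (auto intro!: pv.subspace_sum[OF Sd_subspace] Sd_linear_mult Var_Sd)
  have sub: "pv.subspace (Ysum (\<lambda>q. (*) (Var (Suc q))) (Sd n) n (Suc j) :: 'k mpoly set)"
  proof -
    have "pv.subspace (Ysum (\<lambda>q. (*) (Var (Suc q))) (Sd n) p (Suc j) :: 'k mpoly set)" for p
    proof (induction p)
      case (Suc p)
      have "Ysum (\<lambda>q. (*) (Var (Suc q))) (Sd n) (Suc p) (Suc j) =
          {a + b |a b. a \<in> Ysum (\<lambda>q. (*) (Var (Suc q))) (Sd n) p (Suc j) \<and> b \<in> (*) (Var (Suc p)) ` (Sd n j :: 'k mpoly set)}"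
        by (auto simp: Ysum_step)
      then show ?case
        using pv.subspace_sums[OF Suc pp.linear_subspace_image[OF linear_mult Sd_subspace]] by simp
    qed simp
    then show ?thesis .
  qed
  have mono: "Poly_Mapping.single a (1::'k) \<in> Ysum (\<lambda>q. (*) (Var (Suc q))) (Sd n) n (Suc j)"
    if a: "a \<in> monomials n (Suc j)" for a
  proof -
    have "a \<noteq> 0" using a by (auto simp: monomials_def)
    then obtain i where i: "i \<in> keys a" by (metis keys_eq_empty ex_in_conv)
    obtain b where b: "a = Poly_Mapping.single i 1 + b" "mdeg a = Suc (mdeg b)" "keys b \<subseteq> keys a"
      using monomial_split[OF i] .
    have "i \<in> {1..n}" using a i by (auto simp: monomials_def)
    then obtain q where q: "i = Suc q" "q < n" by (cases i) auto
    let ?f = "\<lambda>r. if r = q then Poly_Mapping.single b (1::'k) else 0"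
    have "(\<Sum>r<n. Var (Suc r) * ?f r) = (\<Sum>r<n. if r = q then Var (Suc r) * Poly_Mapping.single b 1 else 0)"
      by (rule sum.cong) auto
    also have "\<dots> = Poly_Mapping.single a 1"
      using q b by (simp add: Var_def mult_single)
    finally have "Poly_Mapping.single a (1::'k) = (\<Sum>r<n. Var (Suc r) * ?f r)" ..
    moreover have "\<forall>r<n. ?f r \<in> Sd n j" using a b by (auto simp: Sd_iff monomials_def)
    ultimately show ?thesis unfolding Ysum_Suc by (intro CollectI exI[of _ ?f] conjI)
  qed
  show "(Sd n (Suc j) :: 'k mpoly set) \<subseteq> Ysum (\<lambda>q. (*) (Var (Suc q))) (Sd n) n (Suc j)"
    unfolding Sd_def[of n "Suc j"] supported_span
    by (rule pv.span_minimal[OF _ sub]) (auto intro: mono)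
qed

section \<open>Regularity of sequences of independent linear forms\<close>

definition Yd :: "nat \<Rightarrow> (nat \<Rightarrow> 'k::field mpoly) \<Rightarrow> nat \<Rightarrow> nat \<Rightarrow> 'k mpoly set" where
  "Yd n y p j = Ysum (\<lambda>q. (*) (y q)) (Sd n) p j"

lemma Yd_0 [simp]: "Yd n y p 0 = {0}" and Yd_none [simp]: "Yd n y 0 j = {0}"
  by (simp_all add: Yd_def)

lemma Yd_step: "Yd n y (Suc p) (Suc l) = {a + y p * u |a u. a \<in> Yd n y p (Suc l) \<and> u \<in> Sd n l}"
  unfolding Yd_def by (rule Ysum_step)

lemma Yd_Suc: "Yd n y p (Suc l) = {\<Sum>q<p. y q * f q |f. \<forall>q<p. f q \<in> Sd n l}"
  by (simp add: Yd_def Ysum_Suc)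

lemma Yd_cong: "(\<And>q. q < p \<Longrightarrow> y q = y' q) \<Longrightarrow> Yd n y p j = Yd n y' p j"
  unfolding Yd_def by (rule Ysum_cong) simp

lemma Yd_subspace: "pv.subspace (Yd n y p j)"
proof (cases j)
  case (Suc l)
  show ?thesis unfolding Suc
  proof (induction p)
    case (Suc p)
    have "Yd n y (Suc p) (Suc l) = {a + b |a b. a \<in> Yd n y p (Suc l) \<and> b \<in> (*) (y p) ` Sd n l}"
      by (auto simp: Yd_step)
    then show ?case
      using pv.subspace_sums[OF Suc pp.linear_subspace_image[OF linear_mult Sd_subspace]] by simp
  qed simp
qed simp

lemma Yd_subset:
  assumes "\<forall>q<p. y q \<in> Sd n 1"
  shows "Yd n y p j \<subseteq> Sd n j"
  by (cases j) (use assms in \<open>auto simp: Yd_Suc Sd_0 intro!: pv.subspace_sum[OF Sd_subspace] Sd_linear_mult\<close>)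

lemma Yd_fdim: "\<forall>q<p. y q \<in> Sd n 1 \<Longrightarrow> pv.fdim (Yd n y p j)"
  by (rule pv.fdim_subset[OF Sd_fdim Yd_subset])

lemma Yd_mult:
  assumes "v \<in> Yd n y p j" "f \<in> Sd n i"
  shows "f * v \<in> Yd n y p (i + j)"
proof (cases j)
  case 0
  then show ?thesis using assms pv.subspace_0[OF Yd_subspace] by simp
next
  case (Suc l)
  then obtain g where g: "v = (\<Sum>q<p. y q * g q)" "\<forall>q<p. g q \<in> Sd n l"
    using assms by (auto simp: Yd_Suc)
  have "f * v = (\<Sum>q<p. y q * (f * g q))"
    unfolding g(1) sum_distrib_left by (simp add: ac_simps)
  moreover have "\<forall>q<p. f * g q \<in> Sd n (i + l)" using g assms Sd_mult by blast
  ultimately have "f * v \<in> Yd n y p (Suc (i + l))"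
    unfolding Yd_Suc by (intro CollectI exI[of _ "\<lambda>q. f * g q"] conjI)
  then show ?thesis using Suc by simp
qed

lemma Yd_dim_step:
  fixes y :: "nat \<Rightarrow> 'k::field mpoly"
  assumes "\<forall>q<p. y q \<in> Sd n 1"
  shows "pv.dim (Yd n y (Suc p) (Suc j)) + pv.dim {u \<in> Sd n j. y p * u \<in> Yd n y p (Suc j)}
    = pv.dim (Yd n y p (Suc j)) + pv.dim (Sd n j :: 'k mpoly set)"
  using pp.relative_rank_nullity[OF linear_mult[of "y p"] Sd_fdim[of n j] Sd_subspace Yd_fdim[OF assms, of "Suc j"] Yd_subspace]
  by (simp add: Yd_step)

text \<open>Linear independence of the first \<open>p\<close> forms, as \<open>Yd\<close> in degree
  1 is their span; this version can be checked one form at a time.\<close>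

definition good :: "nat \<Rightarrow> nat \<Rightarrow> (nat \<Rightarrow> 'k::field mpoly) \<Rightarrow> bool" where
  "good n p y \<longleftrightarrow> (\<forall>q<p. y q \<in> Sd n 1 \<and> y q \<notin> Yd n y q 1)"

lemma goodD: "good n p y \<Longrightarrow> \<forall>q<p. y q \<in> Sd n 1"
  by (simp add: good_def)

lemmas good_Yd_subset = Yd_subset[OF goodD]
  and good_Yd_fdim = Yd_fdim[OF goodD]

lemma good_mono: "good n p y \<Longrightarrow> q \<le> p \<Longrightarrow> good n q y"
  by (simp add: good_def)

lemma good_0 [simp]: "good n 0 y"
  by (simp add: good_def)

lemma good_Suc: "good n (Suc p) y \<longleftrightarrow> good n p y \<and> y p \<in> Sd n 1 \<and> y p \<notin> Yd n y p 1"
  by (auto simp: good_def less_Suc_eq)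

lemma good_cong: "(\<And>q. q < p \<Longrightarrow> y q = y' q) \<Longrightarrow> good n p y = good n p y'"
  unfolding good_def by (metis Yd_cong less_trans)

lemma dim_zero_space [simp]: "pv.dim {0} = 0"
  using pv.dim_zero_iff[of "{0}"] pv.fdim_zero by simp

lemma good_dim: "good n p y \<Longrightarrow> pv.dim (Yd n y p 1) = p"
proof (induction p)
  case (Suc p)
  then have g: "good n p y" "y p \<notin> Yd n y p 1" by (auto simp: good_Suc)
  have "{u \<in> Sd n 0. y p * u \<in> Yd n y p 1} = {0}"
  proof safe
    fix u assume "u \<in> Sd n 0" and u: "y p * u \<in> Yd n y p 1"
    then obtain c where c: "u = Poly_Mapping.single 0 c" by (auto simp: Sd_const)
    show "u = 0"
    proof (rule ccontr)
      assume "u \<noteq> 0"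
      then have "c \<noteq> 0" using c by auto
      have "y p * u = scale c (y p)" by (simp add: c scale_conv_mult ac_simps)
      then have "scale (inverse c) (scale c (y p)) \<in> Yd n y p 1"
        using u pv.subspace_scale[OF Yd_subspace] by metis
      then show False using g \<open>c \<noteq> 0\<close> by simp
    qed
  qed (simp_all add: Sd_0 pv.subspace_0[OF Yd_subspace])
  then show ?case
    using Yd_dim_step[OF goodD[OF g(1)], of 0] Suc.IH[OF g(1)] by (simp add: Sd_dim)
qed simp

lemma length_wd_1_deg: "length (wd n (Suc 0)) = n"
  by (cases n) (simp_all add: length_wd_degree_1)

lemma good_full:
  assumes "good n n y"
  shows "Yd n y n 1 = Sd n 1"
  by (rule pv.dim_eq_imp_eq[OF Sd_fdim Sd_subspace Yd_subspace good_Yd_subset[OF assms]])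
    (simp_all add: good_dim[OF assms, simplified] Sd_dim length_wd_1_deg)

lemma good_full_all:
  fixes y :: "nat \<Rightarrow> 'a::field mpoly"
  assumes "good n n y"
  shows "Yd n y n (Suc j) = Sd n (Suc j)"
proof
  show "Sd n (Suc j) \<subseteq> Yd n y n (Suc j)"
  proof
    fix p :: "'a mpoly" assume "p \<in> Sd n (Suc j)"
    then obtain f :: "nat \<Rightarrow> 'a mpoly" where f: "p = (\<Sum>q<n. Var (Suc q) * f q)" "\<forall>q<n. f q \<in> Sd n j"
      by (auto simp: Sd_Suc Ysum_Suc)
    have "f q * Var (Suc q) \<in> Yd n y n (Suc j)" if "q < n" for q
      using Yd_mult[where v="Var (Suc q)" and f="f q" and y=y and n=n and p=n and j=1 and i=j] that f(2) good_full[OF assms] Var_Sd[of "Suc q" n] by simp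
    then show "p \<in> Yd n y n (Suc j)"
      unfolding f(1) by (intro pv.subspace_sum[OF Yd_subspace]) (simp add: mult.commute)
  qed
qed (rule good_Yd_subset[OF assms])

lemma good_extend:
  assumes "good n p y" "p \<le> n"
  obtains y' where "\<And>q. q < p \<Longrightarrow> y' q = y q" "good n n y'"
proof -
  have "\<exists>y'. (\<forall>q<p. y' q = y q) \<and> good n n y'"
    using assms
  proof (induction "n - p" arbitrary: p y)
    case 0
    then show ?case by auto
  next
    case (Suc m)
    have "Yd n y p 1 \<noteq> Sd n 1"
    proof
      assume "Yd n y p 1 = Sd n 1"
      then have "p = n" using good_dim[OF Suc.prems(1)] by (simp add: Sd_dim length_wd_1_deg)
      then show False using Suc by simp
    qed
    then obtain l where l: "l \<in> Sd n 1" "l \<notin> Yd n y p 1"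
      using good_Yd_subset[OF Suc.prems(1), of 1] by blast
    define z where "z = y(p := l)"
    have "good n (Suc p) z"
      using Suc.prems(1) l Yd_cong[of p y z n 1] good_cong[of p y z n] by (simp add: good_Suc z_def)
    then obtain y' where "\<forall>q<Suc p. y' q = z q" "good n n y'"
    proof -
      have "m = n - Suc p" "Suc p \<le> n" using Suc.hyps(2) by simp_all
      then show ?thesis using that Suc.hyps(1)[of "Suc p" z] \<open>good n (Suc p) z\<close> by blast
    qed
    then show ?case by (intro exI[of _ y']) (auto simp: z_def)
  qed
  then show ?thesis using that by blast
qed

lemma Yd_cofactors:
  assumes "good n p y" "l \<in> Sd n 1"
  shows "Yd n y p j \<subseteq> {u \<in> Sd n j. l * u \<in> Yd n y p (Suc j)}"
  using Yd_mult[where f=l and i=1 and n=n and y=y and p=p and j=j] good_Yd_subset[OF assms(1)] assms(2) by auto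

text \<open>
  The Hilbert function of \<open>S/(y\<^sub>0,\<dots>,y\<^bsub>p-1\<^esub>)\<close> can only be too small if some \<open>y\<^sub>p\<close> is a zero divisor, but
  then the Hilbert function of \<open>S\<close> itself would be too small.
\<close>

lemma hilbert_function:
  assumes y: "good n n y"
  shows hilbert_exact: "p \<le> n \<Longrightarrow> pv.dim (Yd n y p j) + length (wd (n - p) j) = length (wd n j)"
    and hilbert_regular: "p < n \<Longrightarrow> {u \<in> Sd n j. y p * u \<in> Yd n y p (Suc j)} = Yd n y p j"
proof -
  let ?h = "\<lambda>p j. pv.dim (Yd n y p j)" and ?k = "\<lambda>p j. pv.dim {u \<in> Sd n j. y p * u \<in> Yd n y p (Suc j)}"
  have step: "?h (Suc p) (Suc j) + ?k p j = ?h p (Suc j) + length (wd n j)" if "p < n" for p j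
    using Yd_dim_step[where p=p and y=y and n=n and j=j] goodD[OF y] that by (simp add: Sd_dim)
  have ker_sub: "pv.subspace {u \<in> Sd n j. y p * u \<in> Yd n y p (Suc j)}" for p j
    using pv.subspace_inter[OF Sd_subspace pp.linear_subspace_linear_preimage[OF linear_mult Yd_subspace]]
    by (simp add: Int_def)
  have ker_fd: "pv.fdim {u \<in> Sd n j. y p * u \<in> Yd n y p (Suc j)}" for p j
    by (rule pv.fdim_subset[OF Sd_fdim]) auto
  have cof: "Yd n y p j \<subseteq> {u \<in> Sd n j. y p * u \<in> Yd n y p (Suc j)}" if "p < n" for p j
    by (rule Yd_cofactors[OF good_mono[OF y]]) (use that goodD[OF y] in auto)
  have ker: "?h p j \<le> ?k p j" if "p < n" for p j
    by (rule pv.dim_mono'[OF ker_fd ker_sub cof[OF that]])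
  have wdr: "length (wd (n - p) (Suc j)) = length (wd (n - p) j) + length (wd (n - Suc p) (Suc j))" if "p < n" for p j
    using that length_wd_rec[of "n - Suc p" j] by (simp add: Suc_diff_Suc)
  \<comment> \<open>Downward from \<open>p = n\<close>, where only constants survive: in degree
    \<open>j + 1\<close> the quotient for \<open>p\<close> is at most the multiples of
    \<open>y p\<close>, coming from degree \<open>j\<close>, plus the quotient for
    \<open>p + 1\<close>.\<close>
  have upper: "length (wd n j) \<le> ?h p j + length (wd (n - p) j)" if "p \<le> n" for p j
    using that
  proof (induction "n - p" arbitrary: p j)
    case 0
    then have "p = n" by simp
    then show ?case
      by (cases j) (simp_all add: good_full_all[OF y] Sd_dim)
  next
    case (Suc m)
    show ?case
    proof (induction j)
      case (Suc j)
      have "length (wd n (Suc j)) \<le> ?h (Suc p) (Suc j) + length (wd (n - Suc p) (Suc j))"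
        by (rule Suc.hyps(1)) (use \<open>Suc m = n - p\<close> in auto)
      moreover have "p < n" using \<open>Suc m = n - p\<close> by simp
      ultimately show ?case
        using step[of p j] ker[of p j] Suc wdr[of p j] by simp
    qed simp
  qed
  \<comment> \<open>Upward from \<open>p = 0\<close>: a kernel of \<open>y p\<close> larger than
    \<open>Yd n y p l\<close> would push the next quotient above the bound
    \<open>upper\<close>.\<close>
  have ex: "?h p j + length (wd (n - p) j) = length (wd n j)" if "p \<le> n" for p j
    using that
  proof (induction p arbitrary: j)
    case (Suc p)
    show ?case
    proof (cases j)
      case (Suc l)
      have "?h p (Suc l) + length (wd (n - p) (Suc l)) = length (wd n (Suc l))"
        "?h p l + length (wd (n - p) l) = length (wd n l)"
        using Suc.IH Suc.prems by simp_all
      then show ?thesis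
        using step[of p l] ker[of p l] wdr[of p l] upper[of "Suc p" "Suc l"] Suc.prems Suc by simp
    qed simp
  qed simp
  then show "p \<le> n \<Longrightarrow> ?h p j + length (wd (n - p) j) = length (wd n j)" by blast
  show "{u \<in> Sd n j. y p * u \<in> Yd n y p (Suc j)} = Yd n y p j" if "p < n"
  proof (rule pv.dim_eq_imp_eq[OF ker_fd ker_sub Yd_subspace cof[OF that], symmetric])
    show "?k p j \<le> ?h p j"
      using step[OF that, of j] ex[of p j] ex[of p "Suc j"] ex[of "Suc p" "Suc j"] wdr[OF that, of j] that by simp
  qed
qed

lemma good_dim_all:
  assumes "good n p y" "p \<le> n"
  shows "pv.dim (Yd n y p j) + length (wd (n - p) j) = length (wd n j)"
proof -
  obtain y' where y': "\<And>q. q < p \<Longrightarrow> y' q = y q" "good n n y'"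
    using good_extend[OF assms] by blast
  then show ?thesis using hilbert_exact[OF y'(2) assms(2), of j] Yd_cong[of p y' y n j] by simp
qed

lemma good_le: fixes y :: "nat \<Rightarrow> 'a::field mpoly" assumes "good n p y" shows "p \<le> n"
proof -
  have "p \<le> pv.dim (Sd n 1 :: 'a mpoly set)"
    using pv.dim_mono'[OF Sd_fdim Sd_subspace good_Yd_subset[OF assms], of 1] good_dim[OF assms] by simp
  then show ?thesis by (simp add: Sd_dim length_wd_1_deg)
qed

text \<open>\<open>hilbert_regular\<close> concerns full bases; completing the forms to one leaves
  the submodules generated by the given forms unchanged.\<close>

lemma good_regular:
  assumes "good n (Suc p) y" "u \<in> Sd n j" "y p * u \<in> Yd n y p (Suc j)"
  shows "u \<in> Yd n y p j"
proof -
  obtain y' where y': "\<And>q. q < Suc p \<Longrightarrow> y' q = y q" "good n n y'"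
    using good_extend[OF assms(1) good_le[OF assms(1)]] by blast
  have "p < n" using good_le[OF assms(1)] by simp
  then show ?thesis
    using hilbert_regular[OF y'(2), of p j] y'(1)[of p] Yd_cong[of p y' y n j] Yd_cong[of p y' y n "Suc j"] y'(1) assms by auto
qed

section \<open>Generic linear forms\<close>

definition dependent_at :: "'a set \<Rightarrow> ('a \<Rightarrow> 'x \<Rightarrow> 'k::field poly) \<Rightarrow> 'k \<Rightarrow> bool" where
  "dependent_at A v t \<longleftrightarrow> (\<exists>c. (\<exists>a\<in>A. c a \<noteq> 0) \<and> (\<forall>x. (\<Sum>a\<in>A. c a * poly (v a x) t) = 0))"

text \<open>Elimination without division: row \<open>a\<close> clears coordinate \<open>z\<close> by
  cross multiplication, so that entries remain polynomials.\<close>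

definition pivot :: "('a \<Rightarrow> 'x \<Rightarrow> 'k::field poly) \<Rightarrow> 'a \<Rightarrow> 'x \<Rightarrow> 'a \<Rightarrow> 'x \<Rightarrow> 'k poly" where
  "pivot v a z b x = v a z * v b x - v b z * v a x"

lemma dependent_at_pivot:
  assumes A: "finite A" "a \<in> A" and dep: "dependent_at A v t" and nz: "poly (v a z) t \<noteq> 0"
  shows "dependent_at (A - {a}) (pivot v a z) t"
proof -
  obtain c where c: "\<exists>b\<in>A. c b \<noteq> 0" "\<And>x. (\<Sum>b\<in>A. c b * poly (v b x) t) = 0"
    using dep by (auto simp: dependent_at_def)
  have rest: "(\<Sum>b\<in>A - {a}. c b * poly (v b x) t) = - (c a * poly (v a x) t)" for x
    using c(2)[of x] sum.remove[OF A, of "\<lambda>b. c b * poly (v b x) t"] by (simp add: eq_neg_iff_add_eq_0 add.commute)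
  have rel: "(\<Sum>b\<in>A - {a}. c b * poly (pivot v a z b x) t) = 0" for x
  proof -
    have "(\<Sum>b\<in>A - {a}. c b * poly (pivot v a z b x) t)
        = poly (v a z) t * (\<Sum>b\<in>A - {a}. c b * poly (v b x) t) - (\<Sum>b\<in>A - {a}. c b * poly (v b z) t) * poly (v a x) t"
      unfolding sum_distrib_left sum_distrib_right sum_subtractf[symmetric]
      by (rule sum.cong) (auto simp: pivot_def algebra_simps)
    then show ?thesis by (simp add: rest)
  qed
  have "\<exists>b\<in>A - {a}. c b \<noteq> 0"
  proof (rule ccontr)
    assume "\<not> ?thesis"
    then have 0: "\<And>b. b \<in> A - {a} \<Longrightarrow> c b = 0" by blast
    then have "c a * poly (v a z) t = 0" using rest[of z] by simp
    then show False using nz 0 c(1) by auto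
  qed
  then show ?thesis unfolding dependent_at_def by (intro exI[of _ c] conjI allI rel)
qed

text \<open>Back substitution: a relation of the pivoted rows becomes one of the original rows, with
  row \<open>a\<close> receiving the coefficient that balances coordinate \<open>z\<close>.\<close>

lemma pivot_sum:
  assumes "finite A" "a \<in> A"
  shows "(\<Sum>b\<in>A. (if b = a then - (\<Sum>b\<in>A - {a}. f b * v b z) else f b * v a z) * v b x)
    = (\<Sum>b\<in>A - {a}. f b * pivot v a z b x)"
proof -
  have "(\<Sum>b\<in>A. (if b = a then - (\<Sum>b\<in>A - {a}. f b * v b z) else f b * v a z) * v b x)
      = - (\<Sum>b\<in>A - {a}. f b * v b z) * v a x + (\<Sum>b\<in>A - {a}. f b * v a z * v b x)"
    unfolding sum.remove[OF assms] by (auto intro!: sum.cong)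
  also have "\<dots> = (\<Sum>b\<in>A - {a}. f b * pivot v a z b x)"
    by (simp add: pivot_def sum_distrib_left sum_distrib_right sum_subtractf algebra_simps)
  finally show ?thesis .
qed

lemma finite_dependent_pivot:
  assumes "finite A" "a \<in> A" "v a z \<noteq> 0" "finite {t. dependent_at (A - {a}) (pivot v a z) t}"
  shows "finite {t. dependent_at A v t}"
proof (rule finite_subset)
  show "{t. dependent_at A v t} \<subseteq> {t. dependent_at (A - {a}) (pivot v a z) t} \<union> {t. poly (v a z) t = 0}"
    using dependent_at_pivot[OF assms(1,2)] by auto
  show "finite ({t. dependent_at (A - {a}) (pivot v a z) t} \<union> {t. poly (v a z) t = 0})"
    using assms poly_roots_finite by blast
qed

text \<open>Elimination with a pivot that is nonzero at \<open>t0\<close> preserves independence at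
  \<open>t0\<close>, and each step excludes only the roots of its pivot.\<close>

lemma dependent_at_semicontinuous:
  fixes v :: "'a \<Rightarrow> 'x \<Rightarrow> 'b::field poly"
  assumes "finite A" "\<not> dependent_at A v t0"
  shows "finite {t. dependent_at A v t}"
  using assms
proof (induction "card A" arbitrary: A v)
  case 0
  then show ?case by (simp add: dependent_at_def)
next
  case (Suc m)
  then obtain a where a: "a \<in> A" by (metis card.empty ex_in_conv nat.distinct(1))
  have "\<exists>z. poly (v a z) t0 \<noteq> 0"
  proof (rule ccontr)
    assume "\<not> ?thesis"
    then have "(\<Sum>b\<in>A. (if b = a then 1 else 0) * poly (v b x) t0) = 0" for x
      by (intro sum.neutral) auto
    moreover have "\<exists>b\<in>A. (if b = a then 1 else (0::'b)) \<noteq> 0" using a by auto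
    ultimately have "dependent_at A v t0"
      unfolding dependent_at_def by (intro exI[of _ "\<lambda>b. if b = a then 1 else 0"] conjI allI)
    then show False using Suc.prems(2) by blast
  qed
  then obtain z where z: "poly (v a z) t0 \<noteq> 0" by blast
  have "\<not> dependent_at (A - {a}) (pivot v a z) t0"
  proof
    assume "dependent_at (A - {a}) (pivot v a z) t0"
    then obtain c where c: "\<exists>b\<in>A - {a}. c b \<noteq> 0"
        "\<And>x. (\<Sum>b\<in>A - {a}. c b * poly (pivot v a z b x) t0) = 0"
      by (auto simp: dependent_at_def)
    \<comment> \<open>Constant polynomials turn the numerical relation \<open>c\<close> into one to
      which \<open>pivot_sum\<close> applies; away from \<open>a\<close> its value at
      \<open>t0\<close> is \<open>c b\<close> times the nonzero pivot.\<close>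
    define g where "g b = (if b = a then - (\<Sum>b\<in>A - {a}. [:c b:] * v b z) else [:c b:] * v a z)" for b
    have rel: "(\<Sum>b\<in>A. poly (g b) t0 * poly (v b x) t0) = 0" for x
    proof -
      have "(\<Sum>b\<in>A. poly (g b) t0 * poly (v b x) t0) = poly (\<Sum>b\<in>A. g b * v b x) t0"
        by (simp add: poly_sum)
      also have "\<dots> = poly (\<Sum>b\<in>A - {a}. [:c b:] * pivot v a z b x) t0"
        unfolding g_def pivot_sum[OF Suc.prems(1) a, of "\<lambda>b. [:c b:]" v z x] ..
      also have "\<dots> = 0" using c(2)[of x] by (simp add: poly_sum)
      finally show ?thesis .
    qed
    have nz: "\<exists>b\<in>A. poly (g b) t0 \<noteq> 0"
    proof -
      obtain b where "b \<in> A" "b \<noteq> a" "c b \<noteq> 0" using c(1) by blast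
      then show ?thesis using z by (intro bexI[of _ b]) (simp_all add: g_def)
    qed
    have "dependent_at A v t0"
      unfolding dependent_at_def by (intro exI[of _ "\<lambda>b. poly (g b) t0"] conjI allI rel nz)
    then show False using Suc.prems(2) by blast
  qed
  then have "finite {t. dependent_at (A - {a}) (pivot v a z) t}"
    using Suc a by (intro Suc.hyps(1)) auto
  then show ?case using finite_dependent_pivot[OF Suc.prems(1) a, of v z] z by fastforce
qed

text \<open>A pivot step doubles the degree of the entries, and back substitution multiplies the
  coefficients by entries of degree at most \<open>d\<close>.\<close>

fun relation_bound :: "nat \<Rightarrow> nat \<Rightarrow> nat" where
  "relation_bound 0 d = 0"
| "relation_bound (Suc m) d = relation_bound m (2 * d) + d"

text \<open>Dependence at infinitely many \<open>t\<close> survives every pivot step, so elimination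
  must reach an identically vanishing row. The degree bound will keep the socle condition of
  \<open>McCoy\<close> to finitely many degrees.\<close>

lemma polynomial_relation:
  assumes "finite A" "\<And>a x. a \<in> A \<Longrightarrow> degree (v a x) \<le> d" "infinite {t. dependent_at A v t}"
  shows "\<exists>f. (\<forall>a\<in>A. degree (f a) \<le> relation_bound (card A) d) \<and> (\<exists>a\<in>A. f a \<noteq> 0) \<and>
    (\<forall>x. (\<Sum>a\<in>A. f a * v a x) = 0)"
  using assms
proof (induction "card A" arbitrary: A v d)
  case 0
  then show ?case by (simp add: dependent_at_def)
next
  case (Suc m)
  then obtain a where a: "a \<in> A" by (metis card.empty ex_in_conv nat.distinct(1))
  show ?case
  proof (cases "\<exists>z. v a z \<noteq> 0")
    case False
    then have "(\<Sum>b\<in>A. (if b = a then 1 else 0) * v b x) = 0" for x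
      by (intro sum.neutral) auto
    then show ?thesis using a by (intro exI[of _ "\<lambda>b. if b = a then 1 else 0"]) auto
  next
    case True
    then obtain z where z: "v a z \<noteq> 0" by blast
    let ?A = "A - {a}" and ?w = "pivot v a z"
    have m: "m = card ?A" using Suc a by simp
    have "infinite {t. dependent_at ?A ?w t}"
      using finite_dependent_pivot[OF Suc.prems(1) a, of v z] z Suc.prems(3) by blast
    moreover have "degree (?w b x) \<le> 2 * d" if "b \<in> ?A" for b x
    proof -
      have "degree (v a z * v b x) \<le> 2 * d" "degree (v b z * v a x) \<le> 2 * d"
        using Suc.prems(2)[OF a] Suc.prems(2)[of b] that
        by (metis Diff_iff add_mono degree_mult_le le_trans mult_2)+
      then show ?thesis unfolding pivot_def by (rule degree_diff_le)
    qed
    ultimately obtain f where f: "\<forall>b\<in>?A. degree (f b) \<le> relation_bound m (2 * d)" "\<exists>b\<in>?A. f b \<noteq> 0"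
        "\<forall>x. (\<Sum>b\<in>?A. f b * ?w b x) = 0"
      using Suc.hyps(1)[of ?A ?w "2 * d"] m Suc.prems(1) by blast
    define g where "g b = (if b = a then - (\<Sum>b\<in>?A. f b * v b z) else f b * v a z)" for b
    have prod: "degree (f b * v c z) \<le> relation_bound m (2 * d) + d" if "b \<in> ?A" "c \<in> A" for b c
      using f(1) that Suc.prems(2)[of c z] by (meson add_mono degree_mult_le le_trans)
    have "degree (g b) \<le> relation_bound (card A) d" if "b \<in> A" for b
    proof -
      have "degree (\<Sum>b\<in>?A. f b * v b z) \<le> relation_bound m (2 * d) + d"
        by (rule degree_sum_le) (use Suc.prems(1) prod in auto)
      then show ?thesis using that prod[of b a] a Suc.hyps(2)[symmetric] by (auto simp: g_def)
    qed
    moreover have "\<exists>b\<in>A. g b \<noteq> 0"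
    proof -
      obtain b where "b \<in> A" "b \<noteq> a" "f b \<noteq> 0" using f(2) by blast
      then show ?thesis using z by (intro bexI[of _ b]) (simp_all add: g_def)
    qed
    moreover have "\<forall>x. (\<Sum>b\<in>A. g b * v b x) = 0"
      unfolding g_def pivot_sum[OF Suc.prems(1) a, of f v z] using f(3) by blast
    ultimately show ?thesis by (intro exI[of _ g] conjI ballI)
  qed
qed

text \<open>
  By Vandermonde, any \<open>n\<close> of these forms are independent, so that all but finitely many of them are generic in any given
  sense.
\<close>

definition ell :: "nat \<Rightarrow> 'k::field \<Rightarrow> 'k mpoly" where
  "ell n t = (\<Sum>a<n. scale (t ^ a) (Var (Suc a)))"

lemma ell_Sd: "ell n t \<in> Sd n 1"
  unfolding ell_def by (intro pv.subspace_sum[OF Sd_subspace] pv.subspace_scale[OF Sd_subspace] Var_Sd) auto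

lemma ell_mult: "ell n t * u = (\<Sum>a<n. scale (t ^ a) (Var (Suc a) * u))"
  by (simp add: ell_def sum_distrib_right scale_conv_mult mult.assoc)

text \<open>Rows of a matrix over K[t] whose columns are the monomials: the coordinates of
  \<open>ell n t * u\<close> for \<open>Inl u\<close>, constant ones for \<open>Inr b\<close>. A
  dependence at \<open>t\<close> is a kernel of multiplication by \<open>ell n t\<close> modulo the
  span of the constant rows, as \<open>dependent_pencil\<close> says. The sum type keeps rows of
  both kinds apart even if the vectors coincide.\<close>

definition pencil :: "nat \<Rightarrow> 'k::field mpoly + 'k mpoly \<Rightarrow> (nat \<Rightarrow>\<^sub>0 nat) \<Rightarrow> 'k poly" where
  "pencil n s x = (case s of
      Inl u \<Rightarrow> \<Sum>a<n. monom (lookup (Var (Suc a) * u) x) a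
    | Inr b \<Rightarrow> [:lookup b x:])"

lemma poly_pencil_Inl: "poly (pencil n (Inl u) x) t = lookup (ell n t * u) x"
  unfolding ell_mult by (simp add: pencil_def poly_sum poly_monom lookup_sum lookup_scale ac_simps)

lemma poly_pencil_Inr: "poly (pencil n (Inr b) x) t = lookup b x"
  by (simp add: pencil_def)

lemma sum_Plus: "finite A \<Longrightarrow> finite B \<Longrightarrow> (\<Sum>s\<in>A <+> B. h s) = (\<Sum>a\<in>A. h (Inl a)) + (\<Sum>b\<in>B. h (Inr b))"
  by (simp add: sum.Plus)

lemma dependent_pencil:
  assumes C: "finite C" "pv.independent C" and B: "finite B" "pv.independent B"
  shows "dependent_at (C <+> B) (pencil n) t \<longleftrightarrow> (\<exists>u\<in>pv.span C. u \<noteq> 0 \<and> ell n t * u \<in> pv.span B)"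
proof
  assume "dependent_at (C <+> B) (pencil n) t"
  then obtain c where c: "\<exists>s\<in>C <+> B. c s \<noteq> 0" "\<And>x. (\<Sum>s\<in>C <+> B. c s * poly (pencil n s x) t) = 0"
    by (auto simp: dependent_at_def)
  define u where "u = (\<Sum>e\<in>C. scale (c (Inl e)) e)"
  define w where "w = (\<Sum>b\<in>B. scale (c (Inr b)) b)"
  have "ell n t * u + w = 0"
  proof (rule poly_mapping_eqI)
    fix x
    have "ell n t * u = (\<Sum>e\<in>C. scale (c (Inl e)) (ell n t * e))"
      by (simp add: u_def sum_distrib_left scale_conv_mult ac_simps)
    then show "lookup (ell n t * u + w) x = lookup 0 x"
      using c(2)[of x] C B
      by (simp add: sum_Plus poly_pencil_Inl poly_pencil_Inr lookup_add lookup_sum lookup_scale w_def)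
  qed
  then have eq: "ell n t * u = - w" by (simp add: eq_neg_iff_add_eq_0)
  have "u \<noteq> 0"
  proof
    assume "u = 0"
    then have "w = 0" using eq by simp
    have "c (Inl e) = 0" if "e \<in> C" for e
      using pv.independentD[OF C(2,1) subset_refl, of "\<lambda>e. c (Inl e)"] \<open>u = 0\<close> that by (simp add: u_def)
    moreover have "c (Inr b) = 0" if "b \<in> B" for b
      using pv.independentD[OF B(2,1) subset_refl, of "\<lambda>b. c (Inr b)"] \<open>w = 0\<close> that by (simp add: w_def)
    ultimately show False using c(1) by auto
  qed
  moreover have "u \<in> pv.span C"
    unfolding u_def by (intro pv.span_sum pv.span_scale pv.span_base)
  moreover have "- w \<in> pv.span B"
    unfolding w_def by (intro pv.span_neg pv.span_sum pv.span_scale pv.span_base)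
  ultimately show "\<exists>u\<in>pv.span C. u \<noteq> 0 \<and> ell n t * u \<in> pv.span B" using eq by auto
next
  assume "\<exists>u\<in>pv.span C. u \<noteq> 0 \<and> ell n t * u \<in> pv.span B"
  then obtain f g where fg: "(\<Sum>e\<in>C. scale (f e) e) \<noteq> 0" "ell n t * (\<Sum>e\<in>C. scale (f e) e) = (\<Sum>b\<in>B. scale (g b) b)"
    using C(1) B(1) by (auto simp: pv.span_finite)
  let ?c = "\<lambda>s. case s of Inl e \<Rightarrow> f e | Inr b \<Rightarrow> - g b"
  have rel: "(\<Sum>s\<in>C <+> B. ?c s * poly (pencil n s x) t) = 0" for x
  proof -
    have "ell n t * (\<Sum>e\<in>C. scale (f e) e) = (\<Sum>e\<in>C. scale (f e) (ell n t * e))"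
      by (simp add: sum_distrib_left scale_conv_mult ac_simps)
    then have "lookup (ell n t * (\<Sum>e\<in>C. scale (f e) e)) x = (\<Sum>e\<in>C. f e * lookup (ell n t * e) x)"
      by (simp add: lookup_sum lookup_scale)
    then show ?thesis
      using arg_cong[OF fg(2), of "\<lambda>p. lookup p x"] C(1) B(1)
      by (simp add: sum_Plus poly_pencil_Inl poly_pencil_Inr lookup_sum lookup_scale sum_negf)
  qed
  have "\<exists>s\<in>C <+> B. ?c s \<noteq> 0"
  proof -
    have "\<exists>e\<in>C. f e \<noteq> 0"
    proof (rule ccontr)
      assume "\<not> ?thesis"
      then have "(\<Sum>e\<in>C. scale (f e) e) = 0" by (intro sum.neutral) auto
      then show False using fg(1) by simp
    qed
    then obtain e where "e \<in> C" "f e \<noteq> 0" by blast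
    then show ?thesis by (intro bexI[of _ "Inl e"]) auto
  qed
  then show "dependent_at (C <+> B) (pencil n) t"
    unfolding dependent_at_def by (intro exI[of _ ?c] conjI allI rel)
qed

text \<open>Injectivity modulo \<open>W\<close> is independence of the rows of a pencil. This
  transports dimension counts from one parameter \<open>t0\<close> to almost all others.\<close>

lemma pencil_semicontinuous:
  assumes U: "pv.fdim U" "pv.subspace U" and W: "pv.fdim W" "pv.subspace W"
    and inj: "\<And>u. u \<in> U \<Longrightarrow> ell n t0 * u \<in> W \<Longrightarrow> u = 0"
  shows "finite {t. \<exists>u\<in>U. u \<noteq> 0 \<and> ell n t * u \<in> W}"
proof -
  obtain C where C: "finite C" "pv.independent C" "pv.span C = U" using pv.fdim_basis[OF U] by metis
  obtain B where B: "finite B" "pv.independent B" "pv.span B = W" using pv.fdim_basis[OF W] by metis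
  have "\<not> dependent_at (C <+> B) (pencil n) t0"
    using dependent_pencil[OF C(1,2) B(1,2)] C B inj by auto
  then have "finite {t. dependent_at (C <+> B) (pencil n) t}"
    by (rule dependent_at_semicontinuous[rotated]) (use C(1) B(1) in simp)
  then show ?thesis
    unfolding dependent_pencil[OF C(1,2) B(1,2)] C(3) B(3) .
qed

lemma relation_bound_mono: "m \<le> m' \<Longrightarrow> d \<le> d' \<Longrightarrow> relation_bound m d \<le> relation_bound m' d'"
proof (induction m' arbitrary: m d d')
  case (Suc m')
  show ?case
  proof (cases m)
    case (Suc l)
    then show ?thesis using Suc.IH[of l "2 * d" "2 * d'"] Suc.prems by simp
  qed simp
qed simp

lemma degree_pencil: "degree (pencil n s x) \<le> n"
  unfolding pencil_def by (auto split: sum.split intro!: degree_sum_le order_trans[OF degree_monom_le])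

lemma coeff_mult_pencil_Inl:
  "coeff (f * pencil n (Inl u) x) k = (\<Sum>a<n. if a \<le> k then coeff f (k - a) * lookup (Var (Suc a) * u) x else 0)"
proof -
  have "f * pencil n (Inl u) x = (\<Sum>a<n. monom (lookup (Var (Suc a) * u) x) a * f)"
    by (simp add: pencil_def sum_distrib_left mult.commute)
  then show ?thesis
    by (auto simp: coeff_sum coeff_monom_mult intro!: sum.cong)
qed

text \<open>The coefficient of t^k in the product of the generic form, the sum of all x_{a+1} t^a,
  with the polynomial whose coefficients are \<open>F\<close>.\<close>

definition conv :: "nat \<Rightarrow> (nat \<Rightarrow> 'k::field mpoly) \<Rightarrow> nat \<Rightarrow> 'k mpoly" where
  "conv n F k = (\<Sum>a<n. if a \<le> k then Var (Suc a) * F (k - a) else 0)"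

text \<open>The \<open>Inl\<close> part of the relation over K[t] is a polynomial in
  \<open>t\<close> with coefficients in \<open>U\<close>; the \<open>Inr\<close> part shows that its
  product with the generic form has coefficients in \<open>W\<close>.\<close>

lemma pencil_relation:
  fixes U W :: "'k::field mpoly set"
  assumes U: "pv.fdim U" "pv.subspace U" and W: "pv.fdim W" "pv.subspace W"
    and inf: "infinite {t. \<exists>u\<in>U. u \<noteq> 0 \<and> ell n t * u \<in> W}"
    and m: "pv.dim U + pv.dim W \<le> m"
  obtains F where "\<And>k. F k \<in> U" "\<exists>k. F k \<noteq> 0" "\<And>k. relation_bound m n < k \<Longrightarrow> F k = 0"
    "\<And>k. conv n F k \<in> W"
proof -
  obtain C where C: "finite C" "pv.independent C" "pv.span C = U" "card C = pv.dim U"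
    using pv.fdim_basis[OF U] by metis
  obtain B where B: "finite B" "pv.independent B" "pv.span B = W" "card B = pv.dim W"
    using pv.fdim_basis[OF W] by metis
  have fin: "finite (C <+> B)" using C B by simp
  have "infinite {t. dependent_at (C <+> B) (pencil n) t}"
    using inf unfolding dependent_pencil[OF C(1,2) B(1,2)] C(3) B(3) .
  then obtain f where f: "\<forall>s\<in>C <+> B. degree (f s) \<le> relation_bound (card (C <+> B)) n"
      "\<exists>s\<in>C <+> B. f s \<noteq> 0" "\<forall>x. (\<Sum>s\<in>C <+> B. f s * pencil n s x) = 0"
    using polynomial_relation[OF fin, of "pencil n" n] degree_pencil[of n] by blast
  have "relation_bound (card (C <+> B)) n \<le> relation_bound m n"
    using m C B by (intro relation_bound_mono) (simp_all add: card_Plus)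
  then have deg: "degree (f (Inl u)) \<le> relation_bound m n" if "u \<in> C" for u
    using f(1) that by (meson InlI le_trans)
  define F where "F k = (\<Sum>u\<in>C. scale (coeff (f (Inl u)) k) u)" for k
  define G where "G k = (\<Sum>b\<in>B. scale (coeff (f (Inr b)) k) b)" for k
  have GW: "G k \<in> W" for k
    unfolding G_def B(3)[symmetric] by (intro pv.span_sum pv.span_scale pv.span_base)
  have conv: "conv n F k + G k = 0" for k
  proof (rule poly_mapping_eqI)
    fix x
    have "conv n F k = (\<Sum>a<n. \<Sum>u\<in>C. if a \<le> k then scale (coeff (f (Inl u)) (k - a)) (Var (Suc a) * u) else 0)"
      unfolding conv_def F_def
      by (intro sum.cong) (auto simp: sum_distrib_left scale_conv_mult mult.left_commute)
    then have "lookup (conv n F k) x = (\<Sum>u\<in>C. coeff (f (Inl u) * pencil n (Inl u) x) k)"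
      unfolding coeff_mult_pencil_Inl
      by (subst sum.swap) (auto simp: lookup_sum lookup_scale intro!: sum.cong)
    moreover have "lookup (G k) x = (\<Sum>b\<in>B. coeff (f (Inr b) * pencil n (Inr b) x) k)"
      by (simp add: G_def pencil_def lookup_sum lookup_scale mult.commute)
    moreover have "coeff (\<Sum>s\<in>C <+> B. f s * pencil n s x) k = 0" using f(3) by simp
    ultimately show "lookup (conv n F k + G k) x = lookup 0 x"
      using C(1) B(1) by (simp add: lookup_add coeff_sum sum_Plus)
  qed
  show ?thesis
  proof (rule that)
    show "F k \<in> U" for k
      unfolding F_def C(3)[symmetric] by (intro pv.span_sum pv.span_scale pv.span_base)
    show "F k = 0" if "relation_bound m n < k" for k
    proof -
      have "coeff (f (Inl u)) k = 0" if "u \<in> C" for u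
        using deg[OF that] \<open>relation_bound m n < k\<close> by (intro coeff_eq_0) simp
      then show ?thesis unfolding F_def by (intro sum.neutral) auto
    qed
    show "conv n F k \<in> W" for k
      using conv[of k] GW[of k] pv.subspace_neg[OF W(2)] by (simp add: add_eq_0_iff2)
    \<comment> \<open>If \<open>F\<close> vanished, so would its partner \<open>G\<close>, and
      independence of both bases would make the whole relation trivial.\<close>
    show "\<exists>k. F k \<noteq> 0"
    proof (rule ccontr)
      assume "\<not> ?thesis"
      then have F0: "F k = 0" for k by blast
      then have "conv n F k = 0" for k unfolding conv_def by (intro sum.neutral) simp
      then have G0: "G k = 0" for k using conv[of k] by simp
      have "coeff (f (Inl u)) k = 0" if "u \<in> C" for u k
        using pv.independentD[OF C(2,1) subset_refl, of "\<lambda>u. coeff (f (Inl u)) k"] F0[of k] that by (simp add: F_def)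
      moreover have "coeff (f (Inr b)) k = 0" if "b \<in> B" for b k
        using pv.independentD[OF B(2,1) subset_refl, of "\<lambda>b. coeff (f (Inr b)) k"] G0[of k] that by (simp add: G_def)
      ultimately show False using f(2) by (auto simp: poly_eq_iff)
    qed
  qed
qed

text \<open>McCoy's argument: if a polynomial with coefficients \<open>x\<^sub>1, \<dots>, x\<^sub>n\<close> is a zero divisor, then its
  coefficients have a common annihilator.\<close>

lemma conv_mult: "conv n (\<lambda>k. p * F k) k = p * conv n F k"
  unfolding conv_def sum_distrib_left by (rule sum.cong) (auto simp: ac_simps)

lemma McCoy:
  assumes J: "\<And>j. pv.subspace (J j)" and JV: "\<And>j i u. i < n \<Longrightarrow> u \<in> J j \<Longrightarrow> Var (Suc i) * u \<in> J (Suc j)"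
    and soc: "\<And>j u. d \<le> j \<Longrightarrow> j \<le> D \<Longrightarrow> u \<in> Sd n j \<Longrightarrow> (\<And>i. i < n \<Longrightarrow> Var (Suc i) * u \<in> J (Suc j)) \<Longrightarrow> u \<in> J j"
    and j: "d \<le> j" "j + e \<le> D" and F: "\<And>k. F k \<in> Sd n j" "\<And>k. e < k \<Longrightarrow> F k \<in> J j"
    and rel: "\<And>k. conv n F k \<in> J (Suc j)"
  shows "F k \<in> J j"
  using j F rel
proof (induction e arbitrary: j F k)
  case (0 j F k)
  \<comment> \<open>Modulo \<open>J\<close> only \<open>F 0\<close> is left, so the coefficients of
    the relation are its products with the variables.\<close>
  have top: "F 0 \<in> J j"
  proof (rule soc)
    fix i assume i: "i < n"
    have "conv n F i - (\<Sum>a<n. if a < i then Var (Suc a) * F (i - a) else 0) =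
      (\<Sum>a<n. if a = i then Var (Suc a) * F 0 else 0)"
      unfolding conv_def sum_subtractf[symmetric] by (rule sum.cong) auto
    also have "\<dots> = Var (Suc i) * F 0" using i by simp
    finally have eq: "conv n F i - (\<Sum>a<n. if a < i then Var (Suc a) * F (i - a) else 0) = Var (Suc i) * F 0" .
    show "Var (Suc i) * F 0 \<in> J (Suc j)"
    proof -
      have "(\<Sum>a<n. if a < i then Var (Suc a) * F (i - a) else 0) \<in> J (Suc j)"
        by (rule pv.subspace_sum[OF J]) (use JV 0(4) pv.subspace_0[OF J] in auto)
      then show ?thesis
        unfolding eq[symmetric] by (rule pv.subspace_diff[OF J 0(5)])
    qed
  qed (use 0 in auto)
  then show ?case using 0(4)[of k] by (cases "k = 0") auto
next
  case (Suc e j F k)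
  \<comment> \<open>From the last variable down: in the coefficient of index
    \<open>i + Suc e\<close>, earlier variables meet coefficients beyond \<open>Suc e\<close> and
    later ones are settled, so variable \<open>i\<close> sends the top coefficient into
    \<open>J\<close>. Its product with \<open>F\<close> is then shorter by one and one degree
    higher, which keeps \<open>j + e <= D\<close>.\<close>
  have step: "Var (Suc i) * F l \<in> J (Suc j)" if "i < n" for i l
    using that
  proof (induction "n - i" arbitrary: i l rule: less_induct)
    case (less i)
    have above: "Var (Suc a) * F l \<in> J (Suc j)" if "i < a" "a < n" for a l
      using less.hyps[of a l] that by simp
    have top: "Var (Suc i) * F (Suc e) \<in> J (Suc j)"
    proof -
      let ?r = "\<lambda>a. if a \<le> i + Suc e \<and> a \<noteq> i then Var (Suc a) * F (i + Suc e - a) else 0"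
      have "conv n F (i + Suc e) - (\<Sum>a<n. ?r a) = (\<Sum>a<n. if a = i then Var (Suc a) * F (Suc e) else 0)"
        unfolding conv_def sum_subtractf[symmetric] by (rule sum.cong) auto
      also have "\<dots> = Var (Suc i) * F (Suc e)" using less by simp
      finally have eq: "Var (Suc i) * F (Suc e) = conv n F (i + Suc e) - (\<Sum>a<n. ?r a)" ..
      have "?r a \<in> J (Suc j)" if "a < n" for a
      proof (cases "a < i")
        case True
        then have "F (i + Suc e - a) \<in> J j" using Suc.prems(4) by simp
        then show ?thesis using JV that pv.subspace_0[OF J] by simp
      next
        case False
        then show ?thesis using above[of a] that pv.subspace_0[OF J] by simp
      qed
      then show ?thesis
        unfolding eq by (intro pv.subspace_diff[OF J Suc.prems(5)] pv.subspace_sum[OF J]) auto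
    qed
    show ?case
    proof (rule Suc.IH[of "Suc j" "\<lambda>k. Var (Suc i) * F k"])
      show "Var (Suc i) * F k \<in> Sd n (Suc j)" for k
        using less Suc.prems(3) by (intro Sd_linear_mult Var_Sd) auto
      show "Var (Suc i) * F k \<in> J (Suc j)" if "e < k" for k
        using top JV[OF less.prems Suc.prems(4)[of k]] that by (cases "k = Suc e") auto
      show "conv n (\<lambda>k. Var (Suc i) * F k) k \<in> J (Suc (Suc j))" for k
        unfolding conv_mult by (rule JV[OF less.prems Suc.prems(5)])
    qed (use Suc.prems in auto)
  qed
  show ?case
    by (rule soc) (use Suc.prems step in auto)
qed

text \<open>\<open>McCoy\<close> climbs one degree per coefficient. The dimensions of two components
  of S bound the size of the pencil for every \<open>J\<close>, so the number depends on
  \<open>n\<close> and \<open>j\<close> only.\<close>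

definition generic_bound :: "nat \<Rightarrow> nat \<Rightarrow> nat" where
  "generic_bound n j = j + relation_bound (length (wd n j) + length (wd n (Suc j))) n"

text \<open>If injectivity failed for infinitely many \<open>t\<close>,
  \<open>pencil_relation\<close> would give a nonzero polynomial with coefficients in a complement
  \<open>U\<close> of \<open>J j\<close>; \<open>McCoy\<close> puts these into \<open>J j\<close>,
  so they vanish.\<close>

lemma generic_injective:
  fixes J :: "nat \<Rightarrow> 'k::field mpoly set"
  assumes J: "\<And>j. pv.subspace (J j)" "\<And>j. J j \<subseteq> Sd n j"
    and JV: "\<And>j i u. i < n \<Longrightarrow> u \<in> J j \<Longrightarrow> Var (Suc i) * u \<in> J (Suc j)"
    and soc: "\<And>j u. d \<le> j \<Longrightarrow> j \<le> D \<Longrightarrow> u \<in> Sd n j \<Longrightarrow> (\<And>i. i < n \<Longrightarrow> Var (Suc i) * u \<in> J (Suc j)) \<Longrightarrow> u \<in> J j"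
    and j: "d \<le> j" "generic_bound n j \<le> D"
  shows "finite {t. \<exists>u\<in>Sd n j. u \<notin> J j \<and> ell n t * u \<in> J (Suc j)}"
proof -
  have fd: "pv.fdim (J j)" for j by (rule pv.fdim_subset[OF Sd_fdim J(2)])
  obtain U where U: "pv.subspace U" "U \<subseteq> Sd n j" "\<And>w. w \<in> U \<Longrightarrow> w \<in> J j \<Longrightarrow> w = 0"
      and split: "\<And>u. u \<in> Sd n j \<Longrightarrow> \<exists>a\<in>J j. \<exists>w\<in>U. u = a + w"
    using pv.complement[OF Sd_fdim Sd_subspace J(1,2)] by metis
  have fdU: "pv.fdim U" by (rule pv.fdim_subset[OF Sd_fdim U(2)])
  have ellJ: "ell n t * a \<in> J (Suc j)" if "a \<in> J j" for a t
    unfolding ell_mult by (intro pv.subspace_sum[OF J(1)] pv.subspace_scale[OF J(1)] JV that) auto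
  have "finite {t. \<exists>u\<in>U. u \<noteq> 0 \<and> ell n t * u \<in> J (Suc j)}"
  proof (rule ccontr)
    assume inf: "infinite {t. \<exists>u\<in>U. u \<noteq> 0 \<and> ell n t * u \<in> J (Suc j)}"
    let ?m = "length (wd n j) + length (wd n (Suc j))"
    have "pv.dim U + pv.dim (J (Suc j)) \<le> ?m"
      using pv.dim_mono'[OF Sd_fdim Sd_subspace U(2)] pv.dim_mono'[OF Sd_fdim Sd_subspace J(2)[of "Suc j"]]
      by (simp add: Sd_dim)
    then obtain F where F: "\<And>k. F k \<in> U" "\<exists>k. F k \<noteq> 0" "\<And>k. relation_bound ?m n < k \<Longrightarrow> F k = 0"
        "\<And>k. conv n F k \<in> J (Suc j)"
      using pencil_relation[OF fdU U(1) fd J(1) inf] by metis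
    have "F k \<in> J j" for k
      by (rule McCoy[where n = n and J = J and d = d and D = D and e = "relation_bound ?m n", OF J(1) JV soc j(1)])
        (use F U(2) j(2) pv.subspace_0[OF J(1)] in \<open>auto simp: generic_bound_def\<close>)
    then show False using F(1,2) U(3) by blast
  qed
  moreover have "{t. \<exists>u\<in>Sd n j. u \<notin> J j \<and> ell n t * u \<in> J (Suc j)} \<subseteq> {t. \<exists>u\<in>U. u \<noteq> 0 \<and> ell n t * u \<in> J (Suc j)}"
  proof safe
    fix t u assume u: "u \<in> Sd n j" "u \<notin> J j" "ell n t * u \<in> J (Suc j)"
    obtain a w where w: "a \<in> J j" "w \<in> U" "u = a + w" using split[OF u(1)] by blast
    have "ell n t * w = ell n t * u - ell n t * a" using w by (simp add: algebra_simps)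
    then have "ell n t * w \<in> J (Suc j)" using u ellJ[OF w(1)] pv.subspace_diff[OF J(1)] by simp
    moreover have "w \<noteq> 0" using u w by auto
    ultimately show "\<exists>u\<in>U. u \<noteq> 0 \<and> ell n t * u \<in> J (Suc j)" using w by blast
  qed
  ultimately show ?thesis by (rule rev_finite_subset)
qed

lemma linear_form_mult_in:
  assumes J: "pv.subspace J" and V: "\<And>i. i < n \<Longrightarrow> Var (Suc i) * u \<in> J" and l: "l \<in> Sd n 1"
  shows "l * u \<in> J"
proof -
  obtain f where f: "l = (\<Sum>q<n. Var (Suc q) * f q)" "\<forall>q<n. f q \<in> Sd n 0"
    using l by (auto simp: Sd_Suc[of n 0] Ysum_Suc)
  have "Var (Suc q) * f q * u \<in> J" if q: "q < n" for q
  proof -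
    obtain c where "f q = Poly_Mapping.single 0 c" using f(2) q by (auto simp: Sd_const)
    then have "Var (Suc q) * f q * u = scale c (Var (Suc q) * u)" by (simp add: scale_conv_mult ac_simps)
    then show ?thesis using V[OF q] pv.subspace_scale[OF J] by simp
  qed
  then show ?thesis unfolding f(1) sum_distrib_right by (intro pv.subspace_sum[OF J]) auto
qed

text \<open>Independence of \<open>ell n t\<close> from the earlier forms is injectivity on the
  constants of S modulo these forms. There is no socle there, because any further independent form
  is a nonzerodivisor.\<close>

lemma good_generic:
  fixes y :: "nat \<Rightarrow> 'k::field mpoly"
  assumes "good n p y" "p < n"
  shows "finite {t. \<not> good n (Suc p) (y(p := ell n t))}"
proof -
  obtain y' where y': "\<And>q. q < p \<Longrightarrow> y' q = y q" "good n n y'"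
    using good_extend[OF assms(1)] assms(2) by auto
  have Y: "Yd n y' p j = Yd n y p j" for j using Yd_cong y'(1) by blast
  have "finite {t. \<exists>u\<in>Sd n 0. u \<notin> Yd n y p 0 \<and> ell n t * u \<in> Yd n y p (Suc 0)}"
  proof (rule generic_injective[where d = 0 and D = "generic_bound n 0"])
    show "Var (Suc i) * u \<in> Yd n y p (Suc j)" if "i < n" "u \<in> Yd n y p j" for j i u
      using Yd_mult[OF that(2) Var_Sd[of "Suc i" n]] that(1) by simp
    fix j u assume u: "u \<in> Sd n j" "\<And>i. i < n \<Longrightarrow> Var (Suc i) * u \<in> Yd n y p (Suc j)"
    have "y' p * u \<in> Yd n y p (Suc j)"
      by (rule linear_form_mult_in[OF Yd_subspace u(2)]) (use goodD[OF y'(2)] assms(2) in auto)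
    then show "u \<in> Yd n y p j"
      using good_regular[of n p y' u j] good_mono[OF y'(2), of "Suc p"] u(1) assms(2) Y by auto
  qed (use Yd_subspace good_Yd_subset[OF assms(1)] in auto)
  moreover have "{t. \<not> good n (Suc p) (y(p := ell n t))}
      \<subseteq> {t. \<exists>u\<in>Sd n 0. u \<notin> Yd n y p 0 \<and> ell n t * u \<in> Yd n y p (Suc 0)}"
  proof safe
    fix t assume "\<not> good n (Suc p) (y(p := ell n t))"
    moreover have "good n p (y(p := ell n t))" using assms(1) good_cong[of p "y(p := ell n t)" y n] by simp
    ultimately have "ell n t \<in> Yd n (y(p := ell n t)) p 1" using ell_Sd by (auto simp: good_Suc)
    also have "Yd n (y(p := ell n t)) p 1 = Yd n y p 1" by (rule Yd_cong) simp
    finally have "ell n t * 1 \<in> Yd n y p (Suc 0)" by simp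
    moreover have "1 \<in> (Sd n 0 :: 'k mpoly set)" by (simp add: Sd_iff)
    ultimately show "\<exists>u\<in>Sd n 0. u \<notin> Yd n y p 0 \<and> ell n t * u \<in> Yd n y p (Suc 0)"
      by (intro bexI[of _ 1]) auto
  qed
  ultimately show ?thesis by (rule rev_finite_subset)
qed

section \<open>Green's hyperplane restriction theorem\<close>

text \<open>The preimage in S of the restriction of \<open>V\<close> to the hyperplane
  \<open>l = 0\<close>; spaces of forms in fewer variables are represented by such preimages
  throughout.\<close>

definition add_mult :: "nat \<Rightarrow> 'k::field mpoly \<Rightarrow> 'k mpoly set \<Rightarrow> nat \<Rightarrow> 'k mpoly set" where
  "add_mult n l V d = (case d of 0 \<Rightarrow> V | Suc e \<Rightarrow> {v + l * u |v u. v \<in> V \<and> u \<in> Sd n e})"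

lemma add_mult_0 [simp]: "add_mult n l V 0 = V"
  by (simp add: add_mult_def)

lemma add_mult_Suc: "add_mult n l V (Suc e) = {v + l * u |v u. v \<in> V \<and> u \<in> Sd n e}"
  by (simp add: add_mult_def)

lemma add_mult_Yd: "add_mult n (y p) (Yd n y p d) d = Yd n y (Suc p) d"
  by (cases d) (simp_all add: add_mult_Suc Yd_step)

lemma add_mult_subspace: "pv.subspace V \<Longrightarrow> pv.subspace (add_mult n l V d)"
proof (cases d)
  case (Suc e)
  assume "pv.subspace V"
  moreover have "add_mult n l V d = {a + b |a b. a \<in> V \<and> b \<in> (*) l ` Sd n e}"
    by (auto simp: Suc add_mult_Suc)
  ultimately show ?thesis
    using pv.subspace_sums[OF _ pp.linear_subspace_image[OF linear_mult[of l] Sd_subspace[of n e]]] by simp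
qed simp

lemma add_mult_subset: "V \<subseteq> Sd n d \<Longrightarrow> l \<in> Sd n 1 \<Longrightarrow> add_mult n l V d \<subseteq> Sd n d"
  by (cases d) (auto simp: add_mult_Suc intro!: pv.subspace_add[OF Sd_subspace] Sd_linear_mult)

lemma add_mult_mono: "V \<subseteq> W \<Longrightarrow> add_mult n l V d \<subseteq> add_mult n l W d"
  by (cases d) (auto simp: add_mult_Suc)

lemma add_mult_swap: "add_mult n l (add_mult n l' V d) d \<subseteq> add_mult n l' (add_mult n l V d) d"
proof (cases d)
  case (Suc e)
  show ?thesis unfolding Suc
  proof
    fix x assume "x \<in> add_mult n l (add_mult n l' V (Suc e)) (Suc e)"
    then obtain v u w where "v \<in> V" "u \<in> Sd n e" "w \<in> Sd n e" "x = (v + l' * u) + l * w"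
      by (auto simp: add_mult_Suc)
    moreover from this have "x = (v + l * w) + l' * u" by (simp add: ac_simps)
    ultimately show "x \<in> add_mult n l' (add_mult n l V (Suc e)) (Suc e)"
      unfolding add_mult_Suc by blast
  qed
qed simp

lemma add_mult_dim:
  fixes l :: "'k::field mpoly"
  assumes "pv.subspace V" "V \<subseteq> Sd n (Suc e)"
  shows "pv.dim (add_mult n l V (Suc e)) + pv.dim {u \<in> Sd n e. l * u \<in> V} = pv.dim V + length (wd n e)"
  using pp.relative_rank_nullity[OF linear_mult[of l] Sd_fdim[of n e] Sd_subspace
      pv.fdim_subset[OF Sd_fdim assms(2)] assms(1)]
  by (simp add: add_mult_Suc Sd_dim)

lemma colon_subspace: "pv.subspace V \<Longrightarrow> pv.subspace {u \<in> Sd n e. l * u \<in> V}"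
  using pv.subspace_inter[OF Sd_subspace pp.linear_subspace_linear_preimage[OF linear_mult[of l], of V]]
  by (simp add: Int_def)

lemma good_wd_identity:
  assumes "Suc p \<le> n"
  shows "length (wd (n - p) (Suc e)) = length (wd (n - p) e) + length (wd (n - Suc p) (Suc e))"
  using length_wd_rec[of "n - Suc p" e] assms by (simp add: Suc_diff_Suc)

text \<open>Green's induction, relative to S modulo the first \<open>p\<close> forms: subspaces of
  the quotient are the spaces containing \<open>Yd n y p d\<close>. The restriction
  \<open>?R\<close> and the colon \<open>?W\<close> of \<open>V\<close> by one form are both
  restricted by a second form, and \<open>lexr_restriction\<close> combines the two bounds.\<close>

theorem Green_restriction:
  fixes y :: "nat \<Rightarrow> 'k::field mpoly"
  assumes inf: "infinite (UNIV :: 'k set)"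
    and "good n p y" "p < n" "pv.subspace V" "Yd n y p d \<subseteq> V" "V \<subseteq> Sd n d"
  shows "finite {t. \<not> (good n (Suc p) (y(p := ell n t)) \<and>
    lexr (n - p) d (pv.dim V - pv.dim (Yd n y p d)) + pv.dim (Yd n (y(p := ell n t)) (Suc p) d)
      \<le> pv.dim (add_mult n (ell n t) V d))}"
  using assms(2-)
proof (induction "n - p + d" arbitrary: p d y V rule: less_induct)
  case less
  note y = less.prems(1) and p = less.prems(2) and V = less.prems(3-5)
  let ?y = "\<lambda>t. y(p := ell n t)" and ?k = "pv.dim V - pv.dim (Yd n y p d)"
  have Yt: "Yd n (?y t) p j = Yd n y p j" for t j by (rule Yd_cong) simp
  have YtS: "Yd n (?y t) (Suc p) j = add_mult n (ell n t) (Yd n y p j) j" for t j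
    using add_mult_Yd[of n "?y t" p j] Yt by simp
  have goodfin: "finite {t. \<not> good n (Suc p) (?y t)}" by (rule good_generic[OF y p])
  have fdV: "pv.fdim V" by (rule pv.fdim_subset[OF Sd_fdim V(3)])
  have Vk: "pv.dim V = ?k + pv.dim (Yd n y p d)" using pv.dim_mono'[OF fdV V(1,2)] by simp
  consider "d = 0" | e where "d = Suc e" "n - p = 1" | e c where "d = Suc e" "n - p = Suc (Suc c)"
    using p by (cases d; cases "n - p"; cases "n - p - 1") auto
  then show ?case
  proof cases
    case 1
    then show ?thesis
      using lexr_le[of "n - p" 0 "pv.dim V"] by (intro finite_subset[OF _ goodfin]) auto
  next
    case (2 e)
    have "lexr (n - p) d ?k = 0" using 2 by (cases ?k) (simp_all add: lexr_def)
    moreover have "pv.dim (Yd n (?y t) (Suc p) d) \<le> pv.dim (add_mult n (ell n t) V d)" for t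
      unfolding YtS
      by (intro pv.dim_mono' add_mult_mono V add_mult_subspace
          pv.fdim_subset[OF Sd_fdim add_mult_subset[OF V(3) ell_Sd]])
    ultimately show ?thesis by (intro finite_subset[OF _ goodfin]) auto
  next
    case (3 e c)
    note d = 3(1) and m = 3(2)
    let ?W = "\<lambda>t. {u \<in> Sd n e. ell n t * u \<in> V}" and ?R = "\<lambda>t. add_mult n (ell n t) V d"
    have R: "pv.subspace (?R t)" "?R t \<subseteq> Sd n d" "pv.fdim (?R t)" for t
      using add_mult_subspace[OF V(1)] add_mult_subset[OF V(3) ell_Sd] pv.fdim_subset[OF Sd_fdim] by blast+
    have W: "pv.subspace (?W t)" "?W t \<subseteq> Sd n e" "pv.fdim (?W t)" for t
      by (auto intro: colon_subspace[OF V(1)] pv.fdim_subset[OF Sd_fdim[of n e]])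
    have YW: "Yd n y p e \<subseteq> ?W t" for t
      using Yd_cofactors[OF y ell_Sd, of e t] V(2) d by auto
    have wd1: "length (wd (n - p) d) = length (wd (n - p) e) + length (wd (n - Suc p) d)"
      using good_wd_identity[of p n e] p d by simp
    have RW: "pv.dim (?R t) + pv.dim (?W t) = pv.dim V + length (wd n e)" for t
      using add_mult_dim[OF V(1) V(3)[unfolded d]] d by simp
    \<comment> \<open>The dimension of the restriction of \<open>V\<close> by
      \<open>ell n t\<close>, counted in the quotient ring; \<open>exW\<close> splits
      \<open>?k\<close> into it and the dimension of the colon.\<close>
    define ex where "ex t = pv.dim (?R t) - pv.dim (Yd n (?y t) (Suc p) d)" for t
    have dimY: "pv.dim (Yd n y p j) + length (wd (n - p) j) = length (wd n j)" for j
      using good_dim_all[OF y] p by simp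
    have exW: "ex t + (pv.dim (?W t) - pv.dim (Yd n y p e)) = ?k"
      and exR: "pv.dim (?R t) = ex t + pv.dim (Yd n (?y t) (Suc p) d)"
      if "good n (Suc p) (?y t)" for t
    proof -
      have "pv.dim (Yd n (?y t) (Suc p) d) + length (wd (n - Suc p) d) = length (wd n d)"
        using good_dim_all[OF that] p by simp
      moreover have "pv.dim (Yd n y p e) \<le> pv.dim (?W t)" by (rule pv.dim_mono'[OF W(3,1) YW])
      moreover have "pv.dim (Yd n (?y t) (Suc p) d) \<le> pv.dim (?R t)"
        unfolding YtS by (intro pv.dim_mono'[OF R(3,1)] add_mult_mono V)
      ultimately show "ex t + (pv.dim (?W t) - pv.dim (Yd n y p e)) = ?k"
          "pv.dim (?R t) = ex t + pv.dim (Yd n (?y t) (Suc p) d)"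
        using RW[of t] Vk dimY[of d] dimY[of e] wd1 by (auto simp: ex_def)
    qed
    \<comment> \<open>The generic value of \<open>ex\<close> is represented by its maximum, which
      exists because \<open>ex\<close> is bounded by \<open>?k\<close>.\<close>
    have "\<exists>t0. good n (Suc p) (?y t0) \<and> (\<forall>t. good n (Suc p) (?y t) \<longrightarrow> ex t \<le> ex t0)"
    proof -
      obtain s where "s \<notin> {t. \<not> good n (Suc p) (?y t)}"
        using ex_new_if_finite[OF inf goodfin] by blast
      then have s: "good n (Suc p) (?y s)" by simp
      have "ex t \<le> ?k" if "good n (Suc p) (?y t)" for t using exW[OF that] by simp
      then show ?thesis
        using s by (intro ex_has_greatest_nat[of _ s ex "Suc ?k"]) (auto simp: less_Suc_eq_le)
    qed
    then obtain t0 where t0: "good n (Suc p) (?y t0)" and max: "\<And>t. good n (Suc p) (?y t) \<Longrightarrow> ex t \<le> ex t0"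
      by blast
    let ?z = "\<lambda>t. (?y t0)(Suc p := ell n t)"
    have "finite {t. \<not> (good n (Suc (Suc p)) (?z t) \<and>
        lexr (n - Suc p) d (pv.dim (?R t0) - pv.dim (Yd n (?y t0) (Suc p) d)) + pv.dim (Yd n (?z t) (Suc (Suc p)) d)
          \<le> pv.dim (add_mult n (ell n t) (?R t0) d))}"
    proof (rule less.hyps)
      show "Yd n (?y t0) (Suc p) d \<subseteq> ?R t0" unfolding YtS by (rule add_mult_mono[OF V(2)])
    qed (use m p t0 R in auto)
    moreover have "finite {t. \<not> (good n (Suc p) (?y t) \<and>
        lexr (n - p) e (pv.dim (?W t0) - pv.dim (Yd n y p e)) + pv.dim (Yd n (?y t) (Suc p) e)
          \<le> pv.dim (add_mult n (ell n t) (?W t0) e))}"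
      by (rule less.hyps) (use d y p W YW in auto)
    ultimately have "finite ({t. \<not> (good n (Suc (Suc p)) (?z t) \<and>
        lexr (n - Suc p) d (pv.dim (?R t0) - pv.dim (Yd n (?y t0) (Suc p) d)) + pv.dim (Yd n (?z t) (Suc (Suc p)) d)
          \<le> pv.dim (add_mult n (ell n t) (?R t0) d))} \<union> {t. \<not> (good n (Suc p) (?y t) \<and>
        lexr (n - p) e (pv.dim (?W t0) - pv.dim (Yd n y p e)) + pv.dim (Yd n (?y t) (Suc p) e)
          \<le> pv.dim (add_mult n (ell n t) (?W t0) e))})" by (rule finite_UnI)
    then obtain t where "t \<notin> {t. \<not> (good n (Suc (Suc p)) (?z t) \<and>
        lexr (n - Suc p) d (pv.dim (?R t0) - pv.dim (Yd n (?y t0) (Suc p) d)) + pv.dim (Yd n (?z t) (Suc (Suc p)) d)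
          \<le> pv.dim (add_mult n (ell n t) (?R t0) d))} \<union> {t. \<not> (good n (Suc p) (?y t) \<and>
        lexr (n - p) e (pv.dim (?W t0) - pv.dim (Yd n y p e)) + pv.dim (Yd n (?y t) (Suc p) e)
          \<le> pv.dim (add_mult n (ell n t) (?W t0) e))}"
      using ex_new_if_finite[OF inf] by blast
    then have t: "good n (Suc (Suc p)) (?z t)" "good n (Suc p) (?y t)"
      and le1: "lexr (n - Suc p) d (ex t0) + pv.dim (Yd n (?z t) (Suc (Suc p)) d)
          \<le> pv.dim (add_mult n (ell n t) (?R t0) d)"
      and le2: "lexr (n - p) e (pv.dim (?W t0) - pv.dim (Yd n y p e)) + pv.dim (Yd n (?y t) (Suc p) e)
          \<le> pv.dim (add_mult n (ell n t) (?W t0) e)"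
      by (auto simp: ex_def)
    \<comment> \<open>Restricting by the forms of \<open>t0\<close> and \<open>t\<close> in either
      order gives the same space. So the bound for the double restriction and the one for the colon
      of \<open>?R t\<close> by \<open>ell n t0\<close> add up to a bound for \<open>ex t\<close>,
      which is at most \<open>ex t0\<close>.\<close>
    have swap: "add_mult n (ell n t) (add_mult n (ell n t0) A d) d = add_mult n (ell n t0) (add_mult n (ell n t) A d) d" for A
      by (intro equalityI add_mult_swap)
    have eqR: "pv.dim (add_mult n (ell n t) (?R t0) d) + pv.dim {u \<in> Sd n e. ell n t0 * u \<in> ?R t} = pv.dim (?R t) + length (wd n e)"
      unfolding swap[of V] using add_mult_dim[OF R(1)[of t, unfolded d] R(2)[of t, unfolded d], where l = "ell n t0"] unfolding d .
    have "add_mult n (ell n t) (?W t0) e \<subseteq> {u \<in> Sd n e. ell n t0 * u \<in> ?R t}"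
    proof
      fix x assume x: "x \<in> add_mult n (ell n t) (?W t0) e"
      have "x \<in> Sd n e" using add_mult_subset[OF W(2) ell_Sd] x by blast
      moreover have "ell n t0 * x \<in> ?R t"
      proof (cases e)
        case 0
        then have "ell n t0 * x \<in> V" using x by simp
        then have "ell n t0 * x + ell n t * 0 \<in> ?R t" unfolding d add_mult_Suc using Sd_0 by blast
        then show ?thesis by simp
      next
        case (Suc f)
        then obtain u w where u: "x = u + ell n t * w" "ell n t0 * u \<in> V" "w \<in> Sd n f"
          using x by (auto simp: add_mult_Suc)
        have "ell n t0 * x = ell n t0 * u + ell n t * (ell n t0 * w)" using u by (simp add: algebra_simps)
        moreover have "ell n t0 * w \<in> Sd n e" using Sd_linear_mult[OF ell_Sd u(3)] Suc by simp
        ultimately show ?thesis unfolding d add_mult_Suc using u(2) by blast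
      qed
      ultimately show "x \<in> {u \<in> Sd n e. ell n t0 * u \<in> ?R t}" by blast
    qed
    then have "pv.dim (add_mult n (ell n t) (?W t0) e) \<le> pv.dim {u \<in> Sd n e. ell n t0 * u \<in> ?R t}"
      by (intro pv.dim_mono' colon_subspace R pv.fdim_subset[OF Sd_fdim[of n e]]) auto
    moreover have "pv.dim (Yd n (?z t) (Suc (Suc p)) d) + length (wd (n - Suc (Suc p)) d) = length (wd n d)"
      using good_dim_all[OF t(1)] m by simp
    moreover have "pv.dim (Yd n (?y t) (Suc p) j) + length (wd (n - Suc p) j) = length (wd n j)" for j
      using good_dim_all[OF t(2)] p by simp
    from this[of d] this[of e] have "pv.dim (Yd n (?y t) (Suc p) d) + length (wd (n - Suc p) d) = length (wd n d)"
      "pv.dim (Yd n (?y t) (Suc p) e) + length (wd (n - Suc p) e) = length (wd n e)" .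
    moreover have "length (wd (n - Suc p) d) = length (wd (n - Suc p) e) + length (wd (n - Suc (Suc p)) d)"
      using good_wd_identity[of "Suc p" n e] m d by simp
    moreover have "pv.dim (?W t0) - pv.dim (Yd n y p e) = ?k - ex t0" using exW[OF t0] by simp
    ultimately have "lexr (n - Suc p) d (ex t0) + lexr (n - p) e (?k - ex t0) \<le> ex t"
      using le1 le2 eqR exR[OF t(2)] by simp
    also have "ex t \<le> ex t0" by (rule max[OF t(2)])
    finally have num: "lexr (Suc c) (Suc e) (ex t0) + lexr (Suc (Suc c)) e (?k - ex t0) \<le> ex t0"
    proof -
      have "n - Suc p = Suc c" using m by simp
      then show "lexr (n - Suc p) d (ex t0) + lexr (n - p) e (?k - ex t0) \<le> ex t0 \<Longrightarrow> ?thesis"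
        using m d by simp
    qed
    have "lexr (Suc (Suc c)) (Suc e) ?k \<le> ex t0"
    proof (rule lexr_restriction[OF num])
      show "ex t0 \<le> ?k" using exW[OF t0] by simp
      show "?k \<le> length (wd (Suc (Suc c)) (Suc e))"
        using pv.dim_mono'[OF Sd_fdim Sd_subspace V(3)] dimY[of d] m d by (simp add: Sd_dim)
      show "?k - ex t0 \<le> length (wd (Suc (Suc c)) e)"
        using pv.dim_mono'[OF Sd_fdim Sd_subspace W(2)[of t0]] dimY[of e] m exW[OF t0] by (simp add: Sd_dim)
      show "ex t0 \<le> length (wd (Suc c) (Suc e))"
      proof -
        have "pv.dim (?R t0) \<le> length (wd n d)"
          using pv.dim_mono'[OF Sd_fdim Sd_subspace R(2)[of t0]] by (simp add: Sd_dim)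
        moreover have "pv.dim (Yd n (?y t0) (Suc p) d) + length (wd (n - Suc p) d) = length (wd n d)"
          using good_dim_all[OF t0] p by simp
        moreover have "n - Suc p = Suc c" using m by simp
        ultimately show ?thesis using exR[OF t0] d by simp
      qed
    qed
    then have final: "lexr (n - p) d ?k \<le> ex t0" using m d by simp
    \<comment> \<open>For almost all \<open>t\<close> a complement of the colon at \<open>t0\<close>
      still meets the colon at \<open>t\<close> trivially, so the colon is no larger there and
      \<open>ex\<close> no smaller than \<open>ex t0\<close>.\<close>
    obtain U where U: "pv.subspace U" "U \<subseteq> Sd n e" "pv.dim (?W t0) + pv.dim U = pv.dim (Sd n e :: 'k mpoly set)"
        "\<And>u. u \<in> U \<Longrightarrow> u \<in> ?W t0 \<Longrightarrow> u = 0"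
      by (rule pv.complement[OF Sd_fdim Sd_subspace W(1)[of t0] W(2)[of t0]]) blast
    have "finite {t. \<exists>u\<in>U. u \<noteq> 0 \<and> ell n t * u \<in> V}"
      by (rule pencil_semicontinuous[OF pv.fdim_subset[OF Sd_fdim U(2)] U(1) fdV V(1), of n t0])
        (use U in blast)
    then have "finite ({t. \<exists>u\<in>U. u \<noteq> 0 \<and> ell n t * u \<in> V} \<union> {t. \<not> good n (Suc p) (?y t)})"
      using goodfin by simp
    moreover have "lexr (n - p) d ?k + pv.dim (Yd n (?y t) (Suc p) d) \<le> pv.dim (?R t)"
      if "t \<notin> {t. \<exists>u\<in>U. u \<noteq> 0 \<and> ell n t * u \<in> V}" "good n (Suc p) (?y t)" for t
    proof -
      have "pv.dim U + pv.dim (?W t) \<le> pv.dim (Sd n e :: 'k mpoly set)"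
        by (rule pv.dim_disjoint[OF Sd_fdim Sd_subspace U(1,2) W(1,2)]) (use that(1) in auto)
      then have "ex t0 \<le> ex t" using U(3) exW[OF t0] exW[OF that(2)] by simp
      then show ?thesis using final exR[OF that(2)] by simp
    qed
    ultimately show ?thesis by (elim rev_finite_subset) blast
  qed
qed

section \<open>Graded free modules\<close>

text \<open>Restriction of scalars: on these vectors \<open>scale\<close> takes polynomial scalars,
  while dimensions are taken over the constants.\<close>

definition mscale :: "'k::field \<Rightarrow> (nat \<Rightarrow>\<^sub>0 'k mpoly) \<Rightarrow> (nat \<Rightarrow>\<^sub>0 'k mpoly)" where
  "mscale c v = scale (Poly_Mapping.single 0 c) v"

lemma lookup_mscale: "lookup (mscale c v) g = scale c (lookup v g)"
  by (simp add: mscale_def lookup_scale scale_conv_mult)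

lemma vspace_mscale: "vspace (mscale :: 'k::field \<Rightarrow> _)"
  by unfold_locales
    (rule poly_mapping_eqI, simp add: lookup_mscale lookup_add pv.scale_right_distrib pv.scale_left_distrib)+

interpretation mv: vspace "mscale :: 'k::field \<Rightarrow> (nat \<Rightarrow>\<^sub>0 'k mpoly) \<Rightarrow> _"
  by (rule vspace_mscale)

interpretation mp: vspace_pair "mscale :: 'k::field \<Rightarrow> (nat \<Rightarrow>\<^sub>0 'k mpoly) \<Rightarrow> _"
    "scale :: 'k::field \<Rightarrow> ('c \<Rightarrow>\<^sub>0 'k) \<Rightarrow> ('c \<Rightarrow>\<^sub>0 'k)" ..

interpretation pm: vspace_pair "scale :: 'k::field \<Rightarrow> ('c \<Rightarrow>\<^sub>0 'k) \<Rightarrow> ('c \<Rightarrow>\<^sub>0 'k)"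
    "mscale :: 'k::field \<Rightarrow> (nat \<Rightarrow>\<^sub>0 'k mpoly) \<Rightarrow> _" ..

lemma scale_add_right: "scale p (v + w) = scale p v + scale p w"
  and scale_add_left: "scale (p + q) v = scale p v + scale q v"
  and scale_scale: "scale p (scale q v) = scale (p * q) v"
  and scale_zero_left: "scale 0 v = 0"
  and scale_zero_right: "scale p 0 = 0"
  for p q :: "'a::comm_ring_1"
  by (rule poly_mapping_eqI, simp add: lookup_scale lookup_add algebra_simps)+

lemma scale_sum_right: "scale p (\<Sum>x\<in>A. f x) = (\<Sum>x\<in>A. scale p (f x))" for p :: "'a::comm_ring_1"
  by (induction A rule: infinite_finite_induct) (simp_all add: scale_add_right scale_zero_right)

lemma linear_scale_poly: "Vector_Spaces.linear mscale mscale (scale (p :: 'k::field mpoly))"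
  by (simp add: Vector_Spaces.linear_iff mv.vector_space_axioms mscale_def scale_scale mult.commute scale_add_right)

lemma lin_ext_superset:
  "finite A \<Longrightarrow> keys v \<subseteq> A \<Longrightarrow> lin_ext f v = (\<Sum>g\<in>A. scale (lookup v g) (f g))"
  unfolding lin_ext_def
  by (rule sum.mono_neutral_left) (auto simp: in_keys_iff scale_zero_left)

lemma lin_ext_add: "lin_ext f (v + w) = lin_ext f v + lin_ext f w"
proof -
  have "keys (v + w) \<subseteq> keys v \<union> keys w" by (rule Poly_Mapping.keys_add)
  then show ?thesis
    by (simp add: lin_ext_superset[of "keys v \<union> keys w"] lookup_add scale_add_left sum.distrib)
qed

lemma lin_ext_scale: "lin_ext f (scale p v) = scale p (lin_ext f v)"
proof -
  have "keys (scale p v) \<subseteq> keys v" by (auto simp: in_keys_iff lookup_scale)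
  then show ?thesis
    by (simp add: lin_ext_superset[of "keys v"] lookup_scale scale_sum_right scale_scale)
qed

lemma linear_lin_ext: "Vector_Spaces.linear mscale mscale (lin_ext (f :: nat \<Rightarrow> (nat \<Rightarrow>\<^sub>0 'k::field mpoly)))"
  by (simp add: Vector_Spaces.linear_iff mv.vector_space_axioms mscale_def lin_ext_add lin_ext_scale)

lemma lin_ext_zero [simp]: "lin_ext f 0 = 0"
  by (simp add: lin_ext_def)

lemma lin_ext_sum: "lin_ext (f :: nat \<Rightarrow> (nat \<Rightarrow>\<^sub>0 'k::field mpoly)) (\<Sum>x\<in>A. h x) = (\<Sum>x\<in>A. lin_ext f (h x))"
  by (induction A rule: infinite_finite_induct) (simp_all add: lin_ext_add)

lemma lin_ext_single: "lin_ext f (Poly_Mapping.single g p) = scale p (f g)"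
  by (simp add: lin_ext_superset[of "{g}"])

lemma lookup_lin_ext: "lookup (lin_ext f v) h = (\<Sum>g\<in>keys v. lookup v g * lookup (f g) h)"
  by (simp add: lin_ext_def lookup_sum lookup_scale)

text \<open>The degree \<open>j\<close> part of a graded free module. Adding the shift instead of
  subtracting it forces coordinates with \<open>sh g > j\<close> to be 0.\<close>

definition hpart :: "nat \<Rightarrow> nat set \<Rightarrow> (nat \<Rightarrow> nat) \<Rightarrow> nat \<Rightarrow> (nat \<Rightarrow>\<^sub>0 'k::field mpoly) set" where
  "hpart n G sh j = {v. keys v \<subseteq> G \<and> (\<forall>g. \<forall>a\<in>keys (lookup v g). keys a \<subseteq> {1..n} \<and> mdeg a + sh g = j)}"

lemma hpart_lookup: "v \<in> hpart n G sh j \<Longrightarrow> sh g \<le> j \<Longrightarrow> lookup v g \<in> Sd n (j - sh g)"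
  by (fastforce simp: hpart_def Sd_iff)

lemma hpart_lookup_0: "v \<in> hpart n G sh j \<Longrightarrow> j < sh g \<Longrightarrow> lookup v g = 0"
  by (fastforce simp: hpart_def simp flip: keys_eq_empty)

lemma hpartI:
  assumes "keys v \<subseteq> G" "\<And>g. sh g \<le> j \<Longrightarrow> lookup v g \<in> Sd n (j - sh g)" "\<And>g. j < sh g \<Longrightarrow> lookup v g = 0"
  shows "v \<in> hpart n G sh j"
  unfolding hpart_def
proof (intro CollectI conjI allI ballI)
  fix g a assume a: "a \<in> keys (lookup v g)"
  then have le: "sh g \<le> j" using assms(3)[of g] by (metis keys_zero empty_iff linorder_not_le)
  then show "keys a \<subseteq> {1..n}" "mdeg a + sh g = j"
    using assms(2)[OF le] a by (auto simp: Sd_iff)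
qed fact

lemma hpart_subspace: "mv.subspace (hpart n G sh j)"
proof (rule mv.subspaceI)
  show "0 \<in> hpart n G sh j" by (simp add: hpart_def)
  show "v + w \<in> hpart n G sh j" if vw: "v \<in> hpart n G sh j" "w \<in> hpart n G sh j" for v w
  proof (rule hpartI)
    show "keys (v + w) \<subseteq> G" using vw Poly_Mapping.keys_add[of v w] by (auto simp: hpart_def)
    show "lookup (v + w) g \<in> Sd n (j - sh g)" if "sh g \<le> j" for g
      unfolding lookup_add
      using hpart_lookup[of _ n G sh j g] vw that by (intro pv.subspace_add[OF Sd_subspace]) auto
    show "lookup (v + w) g = 0" if g: "j < sh g" for g
      using hpart_lookup_0[OF vw(1), of g] hpart_lookup_0[OF vw(2), of g] g by (simp add: lookup_add)
  qed
  show "mscale c v \<in> hpart n G sh j" if "v \<in> hpart n G sh j" for c v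
  proof (rule hpartI)
    show "keys (mscale c v) \<subseteq> G" using that by (auto simp: hpart_def in_keys_iff lookup_mscale)
  qed (use hpart_lookup[OF that] hpart_lookup_0[OF that] in
      \<open>auto simp: lookup_mscale intro: pv.subspace_scale[OF Sd_subspace]\<close>)
qed

lemma single_sum: "Poly_Mapping.single g (\<Sum>a\<in>A. f a) = (\<Sum>a\<in>A. Poly_Mapping.single g (f a))"
  by (induction A rule: infinite_finite_induct) (simp_all add: single_add)

lemma mscale_single: "mscale c (Poly_Mapping.single g p) = Poly_Mapping.single g (scale c p)"
  by (rule poly_mapping_eqI) (simp add: lookup_mscale lookup_single when_def)

lemma hpart_fdim:
  assumes "\<And>j. finite {g \<in> G. sh g = j}"
  shows "mv.fdim (hpart n G sh j)"
proof (rule mv.fdimI)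
  let ?E = "{g \<in> G. sh g \<le> j}"
  let ?B = "\<Union>g\<in>?E. (\<lambda>a. Poly_Mapping.single g (Poly_Mapping.single a (1::'a))) ` monomials n (j - sh g)"
  have "?E = (\<Union>l\<le>j. {g \<in> G. sh g = l})" by auto
  then have "finite ?E" using assms by simp
  then show "finite ?B" by simp
  show "hpart n G sh j \<subseteq> mv.span ?B"
  proof
    fix v :: "nat \<Rightarrow>\<^sub>0 'a mpoly" assume v: "v \<in> hpart n G sh j"
    have "v = (\<Sum>g\<in>keys v. \<Sum>a\<in>keys (lookup v g).
        mscale (lookup (lookup v g) a) (Poly_Mapping.single g (Poly_Mapping.single a 1)))"
      unfolding mscale_single scale_single single_sum[symmetric] by (simp add: poly_mapping_expand)
    also have "\<dots> \<in> mv.span ?B"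
    proof (intro mv.span_sum mv.span_scale mv.span_base)
      fix g a assume "g \<in> keys v" "a \<in> keys (lookup v g)"
      then have "g \<in> G" "keys a \<subseteq> {1..n}" "mdeg a + sh g = j" using v by (auto simp: hpart_def)
      then show "Poly_Mapping.single g (Poly_Mapping.single a 1) \<in> ?B" by (auto simp: monomials_def)
    qed
    finally show "v \<in> mv.span ?B" .
  qed
qed

lemma hpart_scale:
  assumes "l \<in> Sd n i" "v \<in> hpart n G sh j"
  shows "scale l v \<in> hpart n G sh (i + j)"
  unfolding hpart_def
proof (intro CollectI conjI allI ballI)
  show "keys (scale l v) \<subseteq> G" using assms(2) by (auto simp: hpart_def in_keys_iff lookup_scale)
  fix g c assume "c \<in> keys (lookup (scale l v) g)"
  then obtain a b where "c = a + b" "a \<in> keys l" "b \<in> keys (lookup v g)"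
    using keys_mult[of l "lookup v g"] by (auto simp: lookup_scale)
  then show "keys c \<subseteq> {1..n}" "mdeg c + sh g = i + j"
    using assms by (auto simp: hpart_def Sd_iff keys_add_nat mdeg_add)
qed

lemma hpart_lin_ext:
  assumes f: "\<And>g. g \<in> G' \<Longrightarrow> f g \<in> hpart n G sh (sh' g)" and v: "v \<in> hpart n G' sh' j"
  shows "lin_ext f v \<in> hpart n G sh j"
  unfolding lin_ext_def
proof (rule mv.subspace_sum[OF hpart_subspace])
  fix g assume g: "g \<in> keys v"
  then have "g \<in> G'" using v by (auto simp: hpart_def)
  moreover have le: "sh' g \<le> j"
    by (rule ccontr) (use hpart_lookup_0[OF v, of g] g in \<open>simp add: in_keys_iff\<close>)
  ultimately show "scale (lookup v g) (f g) \<in> hpart n G sh j"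
    using hpart_scale[OF hpart_lookup[OF v le] f[of g]] by simp
qed

text \<open>The forms act on each coordinate separately, so cofactors can be chosen coordinate by
  coordinate.\<close>

lemma Ysum_hpart:
  assumes y: "\<forall>q<p. y q \<in> Sd n 1"
  shows "v \<in> Ysum (\<lambda>q. scale (y q)) (hpart n G sh) p j \<longleftrightarrow>
    v \<in> hpart n G sh j \<and> (\<forall>g. sh g \<le> j \<longrightarrow> lookup v g \<in> Yd n y p (j - sh g))"
proof (cases j)
  case 0
  have "v = 0" if "v \<in> hpart n G sh 0" "\<forall>g. sh g \<le> 0 \<longrightarrow> lookup v g = 0"
    by (rule poly_mapping_eqI) (use that hpart_lookup_0[OF that(1)] in \<open>auto simp: not_less[symmetric]\<close>)
  then show ?thesis using 0 mv.subspace_0[OF hpart_subspace] by auto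
next
  case (Suc l)
  show ?thesis
  proof
    assume "v \<in> Ysum (\<lambda>q. scale (y q)) (hpart n G sh) p j"
    then obtain f where f: "v = (\<Sum>q<p. scale (y q) (f q))" "\<forall>q<p. f q \<in> hpart n G sh l"
      by (auto simp: Suc Ysum_Suc)
    have "v \<in> hpart n G sh j"
      unfolding f(1) Suc
      by (rule mv.subspace_sum[OF hpart_subspace]) (use f(2) y hpart_scale[of _ n 1 _ G sh l] in auto)
    moreover have "lookup v g \<in> Yd n y p (j - sh g)" if "sh g \<le> j" for g
    proof (cases "sh g \<le> l")
      case True
      have "lookup v g = (\<Sum>q<p. y q * lookup (f q) g)" by (simp add: f(1) lookup_sum lookup_scale)
      moreover have "\<forall>q<p. lookup (f q) g \<in> Sd n (l - sh g)" using f(2) hpart_lookup True by blast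
      ultimately have "lookup v g \<in> Yd n y p (Suc (l - sh g))"
        unfolding Yd_Suc by (intro CollectI exI[of _ "\<lambda>q. lookup (f q) g"] conjI)
      then show ?thesis using True Suc by (simp add: Suc_diff_le)
    next
      case False
      then have "lookup v g = 0"
        using f(2) hpart_lookup_0[of _ n G sh l g]
        unfolding f(1) lookup_sum lookup_scale by (intro sum.neutral) auto
      then show ?thesis using pv.subspace_0[OF Yd_subspace] by simp
    qed
    ultimately show "v \<in> hpart n G sh j \<and> (\<forall>g. sh g \<le> j \<longrightarrow> lookup v g \<in> Yd n y p (j - sh g))" by blast
  next
    assume v: "v \<in> hpart n G sh j \<and> (\<forall>g. sh g \<le> j \<longrightarrow> lookup v g \<in> Yd n y p (j - sh g))"
    have "\<exists>h. lookup v g = (\<Sum>q<p. y q * h q) \<and> (\<forall>q<p. h q \<in> Sd n (l - sh g))" if "sh g \<le> l" for g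
    proof -
      have "lookup v g \<in> Yd n y p (Suc (l - sh g))" using v that Suc by (auto simp: Suc_diff_le dest!: spec[of _ g])
      then show ?thesis unfolding Yd_Suc by blast
    qed
    then obtain h where h: "\<And>g. sh g \<le> l \<Longrightarrow> lookup v g = (\<Sum>q<p. y q * h g q)"
        "\<And>g q. sh g \<le> l \<Longrightarrow> q < p \<Longrightarrow> h g q \<in> Sd n (l - sh g)" by metis
    have above: "lookup v g = 0" if "\<not> sh g \<le> l" for g
    proof (cases "sh g = j")
      case True
      then have "lookup v g \<in> Yd n y p 0" using v by (metis diff_self_eq_0 order_refl)
      then show ?thesis by simp
    next
      case False
      then show ?thesis using hpart_lookup_0[of v n G sh j g] v that Suc by simp
    qed
    \<comment> \<open>The cofactors are assembled over finitely many coordinates, so that they form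
      finitely supported vectors.\<close>
    define K where "K = {g \<in> keys v. sh g \<le> l}"
    define f where "f q = (\<Sum>g\<in>K. Poly_Mapping.single g (h g q))" for q
    have K: "finite K" by (simp add: K_def)
    have lf: "lookup (f q) g = (if g \<in> K then h g q else 0)" for q g
    proof -
      have "lookup (f q) g = (\<Sum>g'\<in>K. if g' = g then h g' q else 0)"
        unfolding f_def lookup_sum by (rule sum.cong) (auto simp: lookup_single when_def)
      then show ?thesis using K by simp
    qed
    have "v = (\<Sum>q<p. scale (y q) (f q))"
    proof (rule poly_mapping_eqI)
      fix g
      show "lookup v g = lookup (\<Sum>q<p. scale (y q) (f q)) g"
      proof (cases "g \<in> K")
        case True
        then show ?thesis using h(1)[of g] by (simp add: lookup_sum lookup_scale lf K_def)
      next
        case False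
        then have "lookup v g = 0" using above[of g] by (auto simp: K_def in_keys_iff)
        then show ?thesis using False by (simp add: lookup_sum lookup_scale lf)
      qed
    qed
    moreover have "\<forall>q<p. f q \<in> hpart n G sh l"
    proof (intro allI impI hpartI)
      fix q assume "q < p"
      show "keys (f q) \<subseteq> G" using v by (auto simp: in_keys_iff lf K_def hpart_def split: if_splits)
      show "lookup (f q) g \<in> Sd n (l - sh g)" if "sh g \<le> l" for g
        using h(2)[OF that \<open>q < p\<close>] by (simp add: lf Sd_0)
      show "lookup (f q) g = 0" if "l < sh g" for g using that by (simp add: lf K_def)
    qed
    ultimately show "v \<in> Ysum (\<lambda>q. scale (y q)) (hpart n G sh) p j"
      unfolding Suc Ysum_Suc by blast
  qed
qed

lemma hpart_regular:
  assumes y: "good n (Suc p) y" and v: "v \<in> hpart n G sh j"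
    and "scale (y p) v \<in> Ysum (\<lambda>q. scale (y q)) (hpart n G sh) p (Suc j)"
  shows "v \<in> Ysum (\<lambda>q. scale (y q)) (hpart n G sh) p j"
proof -
  have yp: "\<forall>q<p. y q \<in> Sd n 1" using goodD[OF y] by simp
  have "lookup v g \<in> Yd n y p (j - sh g)" if "sh g \<le> j" for g
  proof (rule good_regular[OF y hpart_lookup[OF v that]])
    have "lookup (scale (y p) v) g \<in> Yd n y p (Suc j - sh g)"
      using assms(3) that unfolding Ysum_hpart[OF yp] by simp
    then show "y p * lookup v g \<in> Yd n y p (Suc (j - sh g))"
      using that by (simp add: lookup_scale Suc_diff_le)
  qed
  then show ?thesis unfolding Ysum_hpart[OF yp] using v by blast
qed

text \<open>Modulo a basis of linear forms S is 0 in positive degrees, so reduction leaves exactly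
  the constant terms, as in the tensor product with K that defines Tor.\<close>

lemma hpart_Ysum_full:
  assumes y: "good n n y" and v: "v \<in> hpart n G sh j"
  shows "v \<in> Ysum (\<lambda>q. scale (y q)) (hpart n G sh) n j \<longleftrightarrow> (\<forall>g. lookup (lookup v g) 0 = 0)"
proof -
  have "lookup v g \<in> Yd n y n (j - sh g) \<longleftrightarrow> lookup (lookup v g) 0 = 0" if "sh g \<le> j" for g
  proof (cases "j - sh g")
    case 0
    then have "lookup v g \<in> Sd n 0" using hpart_lookup[OF v that] by simp
    then obtain c where c: "lookup v g = Poly_Mapping.single 0 c" by (auto simp: Sd_const)
    have "Poly_Mapping.single (0 :: nat \<Rightarrow>\<^sub>0 nat) c = 0 \<longleftrightarrow> c = 0"
      by (metis lookup_single_eq lookup_zero single_zero)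
    then show ?thesis using 0 c by simp
  next
    case (Suc e)
    then have "lookup v g \<in> Sd n (Suc e)" using hpart_lookup[OF v that] by simp
    moreover from this have "0 \<notin> keys (lookup v g)" by (auto simp: Sd_iff)
    ultimately show ?thesis using Suc good_full_all[OF y, of e] by (simp add: in_keys_iff)
  qed
  moreover have "lookup v g = 0" if "\<not> sh g \<le> j" for g using hpart_lookup_0[OF v] that by simp
  ultimately show ?thesis unfolding Ysum_hpart[OF goodD[OF y]] using v by (metis lookup_zero)
qed

section \<open>Homogeneous components of vectors\<close>

lemma lookup_hom_component: "lookup (hom_component j p) a = (if mdeg a = j then lookup p a else 0)"
proof -
  have "lookup (hom_component j p) a = (\<Sum>b\<in>{b \<in> keys p. mdeg b = j}. if b = a then lookup p b else 0)"
    unfolding hom_component_def lookup_sum by (rule sum.cong) (auto simp: lookup_single when_def)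
  also have "\<dots> = (if a \<in> {b \<in> keys p. mdeg b = j} then lookup p a else 0)" by (rule sum.delta) simp
  also have "\<dots> = (if mdeg a = j then lookup p a else 0)" by (simp add: in_keys_iff)
  finally show ?thesis .
qed

definition hcomp :: "(nat \<Rightarrow> nat) \<Rightarrow> nat \<Rightarrow> (nat \<Rightarrow>\<^sub>0 'k::field mpoly) \<Rightarrow> (nat \<Rightarrow>\<^sub>0 'k mpoly)" where
  "hcomp sh j v = Poly_Mapping.mapp (\<lambda>g p. if sh g \<le> j then hom_component (j - sh g) p else 0) v"

lemma lookup_hcomp: "lookup (lookup (hcomp sh j v) g) a = (if mdeg a + sh g = j then lookup (lookup v g) a else 0)"
  by (auto simp: hcomp_def lookup_mapp when_def lookup_hom_component in_keys_iff)

lemma mpoly_vec_eqI: "(\<And>g a. lookup (lookup v g) a = lookup (lookup w g) a) \<Longrightarrow> v = w"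
  by (intro poly_mapping_eqI) blast

lemma hcomp_add: "hcomp sh j (v + w) = hcomp sh j v + hcomp sh j w"
  by (rule mpoly_vec_eqI) (simp add: lookup_hcomp lookup_add)

lemma hcomp_zero [simp]: "hcomp sh j 0 = 0"
  by (rule mpoly_vec_eqI) (simp add: lookup_hcomp)

lemma hcomp_sum: "hcomp sh j (\<Sum>x\<in>A. f x) = (\<Sum>x\<in>A. hcomp sh j (f x))"
  by (induction A rule: infinite_finite_induct) (simp_all add: hcomp_add)

lemma hcomp_hpart: "v \<in> hpart n G sh l \<Longrightarrow> hcomp sh j v = (if j = l then v else 0)"
proof (rule mpoly_vec_eqI)
  fix g a assume "v \<in> hpart n G sh l"
  then have "a \<in> keys (lookup v g) \<Longrightarrow> mdeg a + sh g = l"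
    by (simp add: hpart_def)
  then show "lookup (lookup (hcomp sh j v) g) a = lookup (lookup (if j = l then v else 0) g) a"
    by (auto simp: lookup_hcomp in_keys_iff)
qed

lemma hcomp_in_hpart: "v \<in> free_module n G \<Longrightarrow> hcomp sh j v \<in> hpart n G sh j"
  unfolding hpart_def
proof (intro CollectI conjI allI ballI)
  assume v: "v \<in> free_module n G"
  have "keys (hcomp sh j v) \<subseteq> keys v" unfolding hcomp_def by (rule keys_mapp_subset)
  also have "keys v \<subseteq> G" using v by (simp add: free_module_def)
  finally show "keys (hcomp sh j v) \<subseteq> G" .
  fix g a assume "a \<in> keys (lookup (hcomp sh j v) g)"
  then have "mdeg a + sh g = j" "a \<in> keys (lookup v g)" by (auto simp: in_keys_iff lookup_hcomp split: if_splits)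
  then show "mdeg a + sh g = j" "keys a \<subseteq> {1..n}" using v by (auto simp: free_module_def poly_ring_def)
qed

lemma hpart_free_module: "hpart n G sh j \<subseteq> free_module n G"
  by (auto simp: hpart_def free_module_def poly_ring_def)

lemma hcomp_decompose:
  obtains L where "finite L" "v = (\<Sum>l\<in>L. hcomp sh l v)"
proof -
  define L where "L = (\<lambda>(g, a). mdeg a + sh g) ` Sigma (keys v) (\<lambda>g. keys (lookup v g))"
  have fin: "finite L" unfolding L_def by (intro finite_imageI finite_SigmaI) auto
  have "lookup (lookup v g) a = lookup (lookup (\<Sum>l\<in>L. hcomp sh l v) g) a" for g a
  proof (cases "mdeg a + sh g \<in> L")
    case True
    then show ?thesis using fin by (simp add: lookup_sum lookup_hcomp)
  next
    case False
    then have "lookup (lookup v g) a = 0"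
      unfolding L_def by (force simp: in_keys_iff)
    then show ?thesis by (simp add: lookup_sum lookup_hcomp cong: if_cong)
  qed
  then have "v = (\<Sum>l\<in>L. hcomp sh l v)" by (rule mpoly_vec_eqI)
  then show ?thesis using fin that by blast
qed

text \<open>Maps of degree 0 respect the grading. Hence kernels are graded, and exactness of a
  resolution holds in each degree separately, as in \<open>D_exact\<close>.\<close>

lemma hcomp_lin_ext:
  assumes f: "\<And>g. g \<in> G' \<Longrightarrow> f g \<in> hpart n G sh (sh' g)" and v: "v \<in> free_module n G'"
  shows "hcomp sh j (lin_ext f v) = lin_ext f (hcomp sh' j v)"
proof -
  obtain L where L: "finite L" "v = (\<Sum>l\<in>L. hcomp sh' l v)" by (rule hcomp_decompose)
  have part: "hcomp sh' l v \<in> hpart n G' sh' l" for l by (rule hcomp_in_hpart[OF v])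
  have "hcomp sh j (lin_ext f v) = (\<Sum>l\<in>L. hcomp sh j (lin_ext f (hcomp sh' l v)))"
    by (subst L(2)) (simp add: lin_ext_sum hcomp_sum)
  also have "\<dots> = (\<Sum>l\<in>L. if j = l then lin_ext f (hcomp sh' l v) else 0)"
    by (intro sum.cong refl hcomp_hpart[OF hpart_lin_ext[OF f part]])
  also have "\<dots> = lin_ext f (\<Sum>l\<in>L. if j = l then hcomp sh' l v else 0)"
    by (simp add: lin_ext_sum if_distrib[of "lin_ext f"] cong: if_cong)
  also have "(\<Sum>l\<in>L. if j = l then hcomp sh' l v else 0) = (\<Sum>l\<in>L. hcomp sh' j (hcomp sh' l v))"
    by (intro sum.cong refl hcomp_hpart[OF part, symmetric])
  also have "\<dots> = hcomp sh' j v" unfolding hcomp_sum[symmetric] L(2)[symmetric] ..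
  finally show ?thesis .
qed

section \<open>The complex of a resolution and its Betti numbers\<close>

abbreviation emb :: "'a::zero \<Rightarrow> (nat \<Rightarrow>\<^sub>0 'a)" where
  "emb \<equiv> Poly_Mapping.single 0"

interpretation mm: vspace_pair "mscale :: 'k::field \<Rightarrow> (nat \<Rightarrow>\<^sub>0 'k mpoly) \<Rightarrow> _" mscale ..

text \<open>The resolution is extended by S, the free module on one generator 0 of degree 0, with
  the augmentation as last map; its homology at the new place is S/I. Polynomials enter it through
  \<open>emb\<close>.\<close>

definition egens :: "'k::field free_complex \<Rightarrow> nat \<Rightarrow> nat set" where
  "egens F i = (case i of 0 \<Rightarrow> {0} | Suc l \<Rightarrow> gens F l)"

definition eshift :: "'k::field free_complex \<Rightarrow> nat \<Rightarrow> nat \<Rightarrow> nat" where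
  "eshift F i = (case i of 0 \<Rightarrow> \<lambda>_. 0 | Suc l \<Rightarrow> shift F l)"

definition ebdry :: "'k::field free_complex \<Rightarrow> nat \<Rightarrow> nat \<Rightarrow> (nat \<Rightarrow>\<^sub>0 'k mpoly)" where
  "ebdry F i = (case i of 0 \<Rightarrow> \<lambda>g. emb (aug F g) | Suc l \<Rightarrow> bdry F l)"

definition Ipart :: "nat \<Rightarrow> 'k::field mpoly set \<Rightarrow> nat \<Rightarrow> 'k mpoly set" where
  "Ipart n I j = I \<inter> Sd n j"

definition IY :: "nat \<Rightarrow> (nat \<Rightarrow> 'k::field mpoly) \<Rightarrow> 'k mpoly set \<Rightarrow> nat \<Rightarrow> nat \<Rightarrow> 'k mpoly set" where
  "IY n y I p j = {a + b |a b. a \<in> Yd n y p j \<and> b \<in> Ipart n I j}"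

definition colon_at :: "nat \<Rightarrow> (nat \<Rightarrow> 'k::field mpoly) \<Rightarrow> 'k mpoly set \<Rightarrow> nat \<Rightarrow> nat \<Rightarrow> bool" where
  "colon_at n y I p j \<longleftrightarrow> (\<forall>u\<in>Sd n j. y p * u \<in> IY n y I p (Suc j) \<longrightarrow> u \<in> IY n y I p j)"

definition restr_dim :: "nat \<Rightarrow> (nat \<Rightarrow> 'k::field mpoly) \<Rightarrow> 'k mpoly set \<Rightarrow> nat \<Rightarrow> nat \<Rightarrow> int" where
  "restr_dim n y I p d = int (pv.dim (IY n y I p d)) - int (pv.dim (Yd n y p d))"

definition tor_dim :: "'k::field free_complex \<Rightarrow> nat \<Rightarrow> nat \<Rightarrow> nat" where
  "tor_dim F i j = kspace.dim (tor_cycles F i j) - kspace.dim (tor_boundaries F i j)"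

definition cterm :: "(nat \<Rightarrow>\<^sub>0 'k::field mpoly) \<Rightarrow> (nat \<Rightarrow>\<^sub>0 'k)" where
  "cterm v = Poly_Mapping.map (\<lambda>p. lookup p 0) v"

lemma lookup_cterm: "lookup (cterm v) g = lookup (lookup v g) 0"
  by (simp add: cterm_def Poly_Mapping.map.rep_eq when_def)

lemma linear_cterm: "Vector_Spaces.linear mscale scale (cterm :: (nat \<Rightarrow>\<^sub>0 'k::field mpoly) \<Rightarrow> _)"
  by (auto simp: Vector_Spaces.linear_iff mv.vector_space_axioms pv.vector_space_axioms lookup_cterm
      lookup_add lookup_mscale lookup_scale intro!: poly_mapping_eqI)

lemma lookup_mult_0: "lookup (p * q) 0 = lookup p 0 * lookup (q :: 'k::field mpoly) 0"
proof -
  have zero: "a + b = 0 \<longleftrightarrow> a = 0 \<and> b = 0" for a b :: "nat \<Rightarrow>\<^sub>0 nat"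
    using mdeg_add[of a b] by (metis add_is_0 mdeg_0_iff)
  have "p * q = (\<Sum>a\<in>keys p. \<Sum>b\<in>keys q. Poly_Mapping.single (a + b) (lookup p a * lookup q b))"
    by (subst (1) poly_mapping_expand[of p, symmetric], subst (1) poly_mapping_expand[of q, symmetric])
      (simp add: sum_product mult_single)
  then have "lookup (p * q) 0 = (\<Sum>a\<in>keys p. \<Sum>b\<in>keys q. if a + b = 0 then lookup p a * lookup q b else 0)"
    by (simp add: lookup_sum lookup_single when_def)
  also have "\<dots> = (\<Sum>a\<in>keys p. \<Sum>b\<in>keys q. if b = 0 then (if a = 0 then lookup p a * lookup q b else 0) else 0)"
    by (intro sum.cong refl) (auto simp: zero)
  also have "\<dots> = (\<Sum>a\<in>keys p. if 0 \<in> keys q then (if a = 0 then lookup p a * lookup q 0 else 0) else 0)"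
    by (intro sum.cong refl sum.delta) simp
  also have "\<dots> = lookup p 0 * lookup q 0"
    by (cases "0 \<in> keys q") (auto simp: in_keys_iff)
  finally show ?thesis .
qed

lemma cterm_lin_ext: "cterm (lin_ext f v) = lin_ext (\<lambda>g. cterm (f g)) (cterm v)"
proof (rule poly_mapping_eqI)
  fix h
  have k: "keys (cterm v) \<subseteq> keys v" by (auto simp: in_keys_iff lookup_cterm)
  show "lookup (cterm (lin_ext f v)) h = lookup (lin_ext (\<lambda>g. cterm (f g)) (cterm v)) h"
    by (simp add: lin_ext_superset[OF _ k] lookup_cterm lookup_lin_ext lookup_sum lookup_scale lookup_mult_0)
qed

lemma scale_single_vec: "scale p (Poly_Mapping.single g q) = Poly_Mapping.single g (p * q)"
  for p :: "'a::comm_ring_1"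
  by (rule poly_mapping_eqI) (simp add: lookup_scale lookup_single when_def)

lemma linear_embed: "Vector_Spaces.linear scale mscale (Poly_Mapping.single g :: 'k::field mpoly \<Rightarrow> _)"
  by (simp add: Vector_Spaces.linear_iff mv.vector_space_axioms pv.vector_space_axioms single_add mscale_single)

lemma embed_inj: "Poly_Mapping.single g p = Poly_Mapping.single g q \<longleftrightarrow> p = q"
  by (metis lookup_single_eq)

lemma embed_dim:
  fixes A :: "'k::field mpoly set"
  assumes "pv.fdim A" "pv.subspace A"
  shows "mv.dim (Poly_Mapping.single g ` A) = pv.dim A"
  by (rule pm.dim_injective_image[OF linear_embed assms]) (metis embed_inj single_zero)

lemma hpart_base: "(hpart n {0} (\<lambda>_. 0) j :: (nat \<Rightarrow>\<^sub>0 'k::field mpoly) set) = emb ` Sd n j"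
proof
  show "(hpart n {0} (\<lambda>_. 0) j :: (nat \<Rightarrow>\<^sub>0 'k mpoly) set) \<subseteq> emb ` Sd n j"
  proof
    fix v :: "nat \<Rightarrow>\<^sub>0 'k mpoly" assume v: "v \<in> hpart n {0} (\<lambda>_. 0) j"
    have "v = emb (lookup v 0)"
    proof (rule poly_mapping_eqI)
      fix k show "lookup v k = lookup (emb (lookup v 0)) k"
        using v by (cases "k = 0") (auto simp: hpart_def lookup_single not_in_keys_iff_lookup_eq_zero[symmetric])
    qed
    moreover have "lookup v 0 \<in> Sd n j" using hpart_lookup[OF v, of 0] by simp
    ultimately show "v \<in> emb ` Sd n j" by blast
  qed
  show "emb ` Sd n j \<subseteq> (hpart n {0} (\<lambda>_. 0) j :: (nat \<Rightarrow>\<^sub>0 'k mpoly) set)"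
  proof safe
    fix p :: "'k mpoly" assume "p \<in> Sd n j"
    then show "emb p \<in> hpart n {0} (\<lambda>_. 0) j"
      by (intro hpartI) (auto simp: lookup_single when_def Sd_0)
  qed
qed

lemma Ysum_base:
  assumes "\<forall>q<p. y q \<in> Sd n 1"
  shows "Ysum (\<lambda>q. scale (y q)) (hpart n {0} (\<lambda>_. 0)) p j = emb ` Yd n y p j"
proof
  show "Ysum (\<lambda>q. scale (y q)) (hpart n {0} (\<lambda>_. 0)) p j \<subseteq> emb ` Yd n y p j"
  proof
    fix v assume "v \<in> Ysum (\<lambda>q. scale (y q)) (hpart n {0} (\<lambda>_. 0)) p j"
    then have v: "v \<in> hpart n {0} (\<lambda>_. 0) j" "lookup v 0 \<in> Yd n y p j"
      by (auto simp: Ysum_hpart[OF assms])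
    then obtain f where "v = emb f" by (auto simp: hpart_base)
    then show "v \<in> emb ` Yd n y p j" using v by simp
  qed
  show "emb ` Yd n y p j \<subseteq> Ysum (\<lambda>q. scale (y q)) (hpart n {0} (\<lambda>_. 0)) p j"
  proof
    fix v assume "v \<in> emb ` Yd n y p j"
    then obtain f where f: "f \<in> Yd n y p j" "v = emb f" by blast
    then have "v \<in> hpart n {0} (\<lambda>_. 0) j" using Yd_subset[OF assms] by (auto simp: hpart_base)
    moreover have "lookup v g \<in> Yd n y p j" for g
      using f pv.subspace_0[OF Yd_subspace] by (auto simp: lookup_single when_def)
    ultimately show "v \<in> Ysum (\<lambda>q. scale (y q)) (hpart n {0} (\<lambda>_. 0)) p j"
      by (simp add: Ysum_hpart[OF assms])
  qed
qed

locale resolution =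
  fixes n :: nat and I :: "'k::field mpoly set" and F :: "'k free_complex"
  assumes res: "graded_free_resolution n I F" and I_carrier: "I \<subseteq> carrier (poly_ring n)"
begin

abbreviation M :: "nat \<Rightarrow> nat \<Rightarrow> (nat \<Rightarrow>\<^sub>0 'k mpoly) set" where
  "M i \<equiv> hpart n (egens F i) (eshift F i)"
abbreviation D :: "nat \<Rightarrow> (nat \<Rightarrow>\<^sub>0 'k mpoly) \<Rightarrow> (nat \<Rightarrow>\<^sub>0 'k mpoly)" where
  "D i \<equiv> lin_ext (ebdry F i)"
abbreviation FM where "FM i \<equiv> (free_module n (egens F i) :: (nat \<Rightarrow>\<^sub>0 'k mpoly) set)"

lemma ebdry_hpart:
  assumes g: "g \<in> egens F (Suc i)"
  shows "ebdry F i g \<in> M i (eshift F (Suc i) g)"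
proof (cases i)
  case 0
  then have g0: "g \<in> gens F 0" using g by (simp add: egens_def)
  have "Poly_Mapping.single g 1 \<in> free_module n (gens F 0)"
    using g0 by (auto simp: free_module_def poly_ring_def lookup_single when_def)
  moreover have "aug_map F (Poly_Mapping.single g 1) = aug F g"
    by (simp add: aug_map_def)
  ultimately have "aug F g \<in> I"
    using res unfolding graded_free_resolution_def by (metis imageI)
  then have "aug F g \<in> Sd n (shift F 0 g)"
    using I_carrier res g0 by (auto simp: Sd_iff poly_ring_def graded_free_resolution_def)
  then show ?thesis
    using 0 by (auto simp: ebdry_def egens_def eshift_def hpart_base)
next
  case (Suc l)
  then have "g \<in> gens F (Suc l)" using g by (simp add: egens_def)
  then have "bdry F l g \<in> free_module n (gens F l)"
    "\<forall>h. \<forall>a\<in>keys (lookup (bdry F l g) h). mdeg a + shift F l h = shift F (Suc l) g"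
    using res by (auto simp: graded_free_resolution_def)
  then show ?thesis
    using Suc by (auto simp: ebdry_def egens_def eshift_def hpart_def free_module_def poly_ring_def)
qed

lemma D_0: "D 0 v = emb (aug_map F v)"
  unfolding lin_ext_def aug_map_def ebdry_def by (simp add: scale_single_vec single_sum)

lemma FM_Suc: "FM (Suc i) = free_module n (gens F i)"
  by (simp add: egens_def)

lemma kernel_eq_image: "{v \<in> FM (Suc i). D i v = 0} = D (Suc i) ` FM (Suc (Suc i))"
proof (cases i)
  case 0
  have "D 0 v = 0 \<longleftrightarrow> aug_map F v = 0" for v
    unfolding D_0 by (metis embed_inj single_zero)
  then show ?thesis
    using res 0 by (simp add: graded_free_resolution_def FM_Suc ebdry_def)
next
  case (Suc l)
  then show ?thesis
    using res by (simp add: graded_free_resolution_def FM_Suc ebdry_def)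
qed

lemma hcomp_D: "v \<in> FM (Suc i) \<Longrightarrow> hcomp (eshift F i) j (D i v) = D i (hcomp (eshift F (Suc i)) j v)"
  by (rule hcomp_lin_ext[OF ebdry_hpart])

lemma D_hpart: "v \<in> M (Suc i) j \<Longrightarrow> D i v \<in> M i j"
  by (rule hpart_lin_ext[OF ebdry_hpart])

lemma D_D: "v \<in> M (Suc (Suc i)) j \<Longrightarrow> D i (D (Suc i) v) = 0"
  using kernel_eq_image[of i] hpart_free_module by blast

lemma D_exact:
  assumes v: "v \<in> M (Suc i) j" "D i v = 0"
  shows "\<exists>w\<in>M (Suc (Suc i)) j. v = D (Suc i) w"
proof -
  have "v \<in> FM (Suc i)" using v hpart_free_module by blast
  then obtain w where w: "w \<in> FM (Suc (Suc i))" "v = D (Suc i) w"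
    using kernel_eq_image[of i] v by blast
  have "v = hcomp (eshift F (Suc i)) j v" by (simp add: hcomp_hpart[OF v(1)])
  also have "\<dots> = D (Suc i) (hcomp (eshift F (Suc (Suc i))) j w)"
    unfolding w(2) by (rule hcomp_D[OF w(1)])
  finally show ?thesis using hcomp_in_hpart[OF w(1)] by blast
qed

lemma M_finite: "finite {g \<in> egens F i. eshift F i g = j}"
  using res by (cases i) (auto simp: egens_def eshift_def graded_free_resolution_def)

lemma M_0: "M 0 j = emb ` Sd n j"
  using hpart_base[of n j] by (simp add: egens_def eshift_def)

lemma D_0_image: "D 0 ` M (Suc 0) j = emb ` Ipart n I j"
proof
  show "D 0 ` M (Suc 0) j \<subseteq> emb ` Ipart n I j"
  proof safe
    fix v assume v: "v \<in> M (Suc 0) j"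
    have "aug_map F v \<in> I"
      using res v hpart_free_module[of n "egens F (Suc 0)" "eshift F (Suc 0)" j]
      by (auto simp: graded_free_resolution_def FM_Suc)
    moreover have "aug_map F v \<in> Sd n j"
      using D_hpart[OF v] unfolding M_0 D_0 by (auto simp: embed_inj)
    ultimately show "D 0 v \<in> emb ` Ipart n I j" by (auto simp: D_0 Ipart_def)
  qed
  show "emb ` Ipart n I j \<subseteq> D 0 ` M (Suc 0) j"
  proof safe
    fix p assume "p \<in> Ipart n I j"
    then have p: "p \<in> I" "p \<in> Sd n j" by (auto simp: Ipart_def)
    then obtain w where w: "w \<in> FM (Suc 0)" "p = aug_map F w"
      using res by (auto simp: graded_free_resolution_def FM_Suc)
    have "emb p \<in> M 0 j" using p by (simp add: M_0)
    then have "emb p = hcomp (eshift F 0) j (emb p)"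
      by (simp add: hcomp_hpart)
    also have "\<dots> = D 0 (hcomp (eshift F (Suc 0)) j w)"
      unfolding w(2) D_0[symmetric] by (rule hcomp_D[OF w(1)])
    finally show "emb p \<in> D 0 ` M (Suc 0) j"
      using hcomp_in_hpart[OF w(1)] by blast
  qed
qed

lemma Ipart_subspace: "pv.subspace (Ipart n I j)"
proof -
  have "Ipart n I j = emb -` (D 0 ` M (Suc 0) j)"
    unfolding D_0_image by (auto simp: embed_inj)
  then show ?thesis
    using pm.linear_subspace_vimage[OF linear_embed, of "D 0 ` M (Suc 0) j" 0]
      mm.linear_subspace_image[OF linear_lin_ext hpart_subspace]
    by metis
qed

end

locale flagged_resolution = resolution n I F for n and I :: "'k::field mpoly set" and F +
  fixes y :: "nat \<Rightarrow> 'k mpoly"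
  assumes y: "good n n y"
begin

sublocale gc: graded_complex mscale n M D "\<lambda>q. scale (y q)"
proof (intro graded_complex.intro graded_complex_axioms.intro vspace_mscale)
  show "mv.fdim (M i j)" for i j by (rule hpart_fdim[OF M_finite])
  show "q < n \<Longrightarrow> v \<in> M i j \<Longrightarrow> scale (y q) v \<in> M i (Suc j)" for q v i j
    using hpart_scale[of "y q" n 1 v] goodD[OF y] by simp
  show "p < n \<Longrightarrow> v \<in> M i j \<Longrightarrow> scale (y p) v \<in> Ysum (\<lambda>q. scale (y q)) (M i) p (Suc j) \<Longrightarrow>
      v \<in> Ysum (\<lambda>q. scale (y q)) (M i) p j" for p v i j
    by (rule hpart_regular[OF good_mono[OF y]]) auto
  show "D i (scale (y q) v) = scale (y q) (D i v)" for i q v by (rule lin_ext_scale)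
  show "scale (y q) (scale (y r) v) = scale (y r) (scale (y q) v)" for q r and v :: "nat \<Rightarrow>\<^sub>0 'k mpoly"
    by (simp add: scale_scale mult.commute)
qed (fact hpart_subspace linear_scale_poly linear_lin_ext D_hpart D_D D_exact)+

lemma Y_base: "p \<le> n \<Longrightarrow> gc.Y p 0 j = emb ` Yd n y p j"
  using Ysum_base[of p y n j] goodD[OF y] by (simp add: egens_def eshift_def)

lemma B_base: "p \<le> n \<Longrightarrow> gc.B p 0 j = emb ` IY n y I p j"
proof -
  assume p: "p \<le> n"
  have "gc.B p 0 j = {a + b |a b. a \<in> emb ` Yd n y p j \<and> b \<in> emb ` Ipart n I j}"
    unfolding gc.B_def Y_base[OF p] D_0_image[symmetric] by blast
  also have "\<dots> = emb ` IY n y I p j"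
  proof safe
    fix a b assume "a \<in> Yd n y p j" "b \<in> Ipart n I j"
    then show "emb a + emb b \<in> emb ` IY n y I p j"
      unfolding single_add[symmetric] IY_def by blast
  next
    fix x assume "x \<in> IY n y I p j"
    then obtain a b where "x = a + b" "a \<in> Yd n y p j" "b \<in> Ipart n I j" by (auto simp: IY_def)
    then show "\<exists>a b. emb x = a + b \<and> a \<in> emb ` Yd n y p j \<and> b \<in> emb ` Ipart n I j"
      by (intro exI[of _ "emb a"] exI[of _ "emb b"]) (simp add: single_add)
  qed
  finally show ?thesis .
qed

lemma colon_base:
  assumes "p < n"
  shows "gc.colon p 0 j \<longleftrightarrow> colon_at n y I p j"
proof -
  have "(emb a \<in> emb ` A) = (a \<in> A)" for a :: "'k mpoly" and A
    by (auto simp: embed_inj)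
  then show ?thesis
    using assms by (simp add: gc.colon_def colon_at_def B_base M_0 scale_single_vec)
qed

lemma IY_subspace: "pv.subspace (IY n y I p j)"
  unfolding IY_def by (rule pv.subspace_sums[OF Yd_subspace Ipart_subspace])

lemma IY_subset: "p \<le> n \<Longrightarrow> IY n y I p j \<subseteq> Sd n j"
  using Yd_subset[of p y n j] goodD[OF y] pv.subspace_add[OF Sd_subspace]
  by (fastforce simp: IY_def Ipart_def)

lemma mu_base: "p \<le> n \<Longrightarrow> gc.mu p j = restr_dim n y I p j"
  using embed_dim[OF pv.fdim_subset[OF Sd_fdim IY_subset] IY_subspace]
    embed_dim[OF Yd_fdim Yd_subspace, of p y n] goodD[OF y]
  by (simp add: gc.mu_def restr_dim_def B_base Y_base)

lemma Y_cterm: "v \<in> M i j \<Longrightarrow> v \<in> gc.Y n i j \<longleftrightarrow> cterm v = 0"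
  unfolding hpart_Ysum_full[OF y] by (simp add: poly_mapping_eq_iff fun_eq_iff lookup_cterm)

lemma cterm_M: "cterm ` M (Suc i) j = tensorK_part F i j"
proof
  show "cterm ` M (Suc i) j \<subseteq> tensorK_part F i j"
  proof safe
    fix v assume v: "v \<in> M (Suc i) j"
    have "shift F i g = j" "g \<in> gens F i" if "g \<in> keys (cterm v)" for g
    proof -
      have "0 \<in> keys (lookup v g)" using that by (simp add: in_keys_iff lookup_cterm)
      then have "mdeg 0 + eshift F (Suc i) g = j" using v unfolding hpart_def by blast
      then show "shift F i g = j" by (simp add: eshift_def)
      have "g \<in> keys v" using that by (auto simp: in_keys_iff lookup_cterm)
      then show "g \<in> gens F i" using v by (auto simp: hpart_def egens_def)
    qed
    then show "cterm v \<in> tensorK_part F i j" by (auto simp: tensorK_part_def)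
  qed
  show "tensorK_part F i j \<subseteq> cterm ` M (Suc i) j"
  proof
    fix w assume w: "w \<in> tensorK_part F i j"
    define v where "v = Poly_Mapping.map (\<lambda>c. Poly_Mapping.single (0 :: nat \<Rightarrow>\<^sub>0 nat) c) w"
    have lv: "lookup v g = Poly_Mapping.single 0 (lookup w g)" for g
      by (simp add: v_def Poly_Mapping.map.rep_eq when_def)
    have "w = cterm v" by (rule poly_mapping_eqI) (simp add: lookup_cterm lv)
    moreover have "v \<in> M (Suc i) j"
    proof (rule hpartI)
      have kv: "keys v \<subseteq> keys w" by (rule subsetI) (metis in_keys_iff lv single_zero)
      then show "keys v \<subseteq> egens F (Suc i)" using w by (auto simp: tensorK_part_def egens_def)
      show "lookup v g \<in> Sd n (j - eshift F (Suc i) g)" for g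
      proof (cases "g \<in> keys w")
        case True
        then have "eshift F (Suc i) g = j" using w by (auto simp: tensorK_part_def eshift_def)
        then show ?thesis by (simp add: lv Sd_const)
      qed (simp add: lv in_keys_iff Sd_0)
      show "lookup v g = 0" if "j < eshift F (Suc i) g" for g
        using that w by (cases "g \<in> keys w") (auto simp: lv in_keys_iff tensorK_part_def eshift_def)
    qed
    ultimately show "w \<in> cterm ` M (Suc i) j" by blast
  qed
qed

lemma cterm_D: "cterm (D (Suc i) v) = tensorK_bdry F i (cterm v)"
  unfolding tensorK_bdry_def cterm_lin_ext by (simp add: ebdry_def cterm_def)

lemma tor_boundaries_cterm: "tor_boundaries F i j = cterm ` gc.B n (Suc i) j"
proof
  show "tor_boundaries F i j \<subseteq> cterm ` gc.B n (Suc i) j"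
    unfolding tor_boundaries_def cterm_M[symmetric] using gc.D_in_B cterm_D[symmetric] by auto
  show "cterm ` gc.B n (Suc i) j \<subseteq> tor_boundaries F i j"
  proof safe
    fix v assume "v \<in> gc.B n (Suc i) j"
    then obtain a w where v: "v = a + D (Suc i) w" "a \<in> gc.Y n (Suc i) j" "w \<in> M (Suc (Suc i)) j"
      by (auto simp: gc.B_def)
    have "cterm a = 0" using Y_cterm v(2) gc.Y_subset by blast
    then have "cterm v = tensorK_bdry F i (cterm w)"
      by (simp add: v(1) mp.linear_add[OF linear_cterm] cterm_D)
    then show "cterm v \<in> tor_boundaries F i j"
      unfolding tor_boundaries_def cterm_M[symmetric] using v by blast
  qed
qed

text \<open>For \<open>i = 0\<close> every vector is a cycle of Tor, whereas \<open>Z\<close> wants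
  its image in S to vanish modulo all forms. This can fail only through constants in
  \<open>I\<close>, hence the hypothesis.\<close>

lemma tor_cycles_cterm:
  assumes "i = 0 \<Longrightarrow> \<forall>v\<in>M (Suc 0) j. D 0 v \<in> gc.Y n 0 j"
  shows "tor_cycles F i j = cterm ` gc.Z n (Suc i) j"
proof (cases i)
  case 0
  have "gc.Z n (Suc 0) j = M (Suc 0) j" using assms 0 by (auto simp: gc.Z_Suc)
  then show ?thesis using 0 cterm_M[of 0 j] by (simp add: tor_cycles_def)
next
  case (Suc l)
  have "D (Suc l) v \<in> gc.Y n (Suc l) j \<longleftrightarrow> tensorK_bdry F l (cterm v) = 0" if "v \<in> M (Suc (Suc l)) j" for v
    using Y_cterm[OF D_hpart[OF that]] by (simp add: cterm_D)
  note bdry = this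
  have "tor_cycles F i j = {v \<in> cterm ` M (Suc (Suc l)) j. tensorK_bdry F l v = 0}"
    unfolding cterm_M by (simp add: tor_cycles_def Suc)
  also have "\<dots> = cterm ` gc.Z n (Suc i) j"
    unfolding Suc gc.Z_Suc using bdry by auto
  finally show ?thesis .
qed

lemma cterm_dim:
  assumes "mv.subspace A" "gc.Y n i j \<subseteq> A" "A \<subseteq> M i j"
  shows "kspace.dim (cterm ` A) + mv.dim (gc.Y n i j) = mv.dim A"
proof -
  have "{a \<in> A. cterm a = 0} = gc.Y n i j" using Y_cterm assms by blast
  then show ?thesis
    using mp.rank_nullity[OF linear_cterm mv.fdim_subset[OF gc.M_fdim assms(3)] assms(1)] by simp
qed

text \<open>\<open>Z\<close> and \<open>B\<close> both contain the kernel of \<open>cterm\<close>,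
  which therefore cancels from the difference of their dimensions.\<close>

lemma tor_dim_hdim:
  assumes "i = 0 \<Longrightarrow> \<forall>v\<in>M (Suc 0) j. D 0 v \<in> gc.Y n 0 j"
  shows "int (tor_dim F i j) = gc.hdim n i j"
proof -
  have B: "kspace.dim (tor_boundaries F i j) + mv.dim (gc.Y n (Suc i) j) = mv.dim (gc.B n (Suc i) j)"
    unfolding tor_boundaries_cterm
    by (rule cterm_dim[OF gc.B_subspace]) (use gc.YI_B gc.B_subset_Z[of n "Suc i" j] gc.Z_subset in blast)+
  have cyc: "tor_cycles F i j = cterm ` gc.Z n (Suc i) j"
    by (rule tor_cycles_cterm) (rule assms)
  have Z: "kspace.dim (tor_cycles F i j) + mv.dim (gc.Y n (Suc i) j) = mv.dim (gc.Z n (Suc i) j)"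
    unfolding cyc
    by (rule cterm_dim[OF gc.Z_subspace]) (use gc.YI_B gc.B_subset_Z[of n "Suc i" j] gc.Z_subset in blast)+
  have "mv.dim (gc.B n (Suc i) j) \<le> mv.dim (gc.Z n (Suc i) j)"
    by (rule mv.dim_mono'[OF gc.Z_fdim gc.Z_subspace gc.B_subset_Z]) simp
  then show ?thesis using B Z by (simp add: tor_dim_def gc.hdim_def)
qed

end

section \<open>Existence of graded free resolutions\<close>

lemma carrier_poly_ring: "carrier (poly_ring n) = {p. \<forall>a\<in>keys p. keys a \<subseteq> {1..n}}"
  and add_poly_ring: "p \<oplus>\<^bsub>poly_ring n\<^esub> q = p + q"
  and mult_poly_ring: "p \<otimes>\<^bsub>poly_ring n\<^esub> q = p * q"
  and zero_poly_ring: "\<zero>\<^bsub>poly_ring n\<^esub> = 0"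
  by (simp_all add: poly_ring_def)

lemma carrier_add: "p \<in> carrier (poly_ring n) \<Longrightarrow> q \<in> carrier (poly_ring n) \<Longrightarrow> p + q \<in> carrier (poly_ring n)"
  using cring.cring_simprules(1)[OF cring_poly_ring, of p n q] by (simp add: add_poly_ring)

lemma carrier_mult: "p \<in> carrier (poly_ring n) \<Longrightarrow> q \<in> carrier (poly_ring n) \<Longrightarrow> p * q \<in> carrier (poly_ring n)"
  using cring.cring_simprules(5)[OF cring_poly_ring, of p n q] by (simp add: mult_poly_ring)

lemma carrier_const: "Poly_Mapping.single 0 c \<in> carrier (poly_ring n)"
  by (simp add: carrier_poly_ring)

lemma Sd_carrier: "Sd n j \<subseteq> carrier (poly_ring n)"
  by (simp add: subset_iff Sd_iff carrier_poly_ring)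

lemma poly_ideal:
  assumes "ideal I (poly_ring n)"
  shows ideal_carrier: "I \<subseteq> carrier (poly_ring n)" and ideal_zero: "0 \<in> I"
    and ideal_add: "p \<in> I \<Longrightarrow> q \<in> I \<Longrightarrow> p + q \<in> I"
    and ideal_mult: "f \<in> carrier (poly_ring n) \<Longrightarrow> p \<in> I \<Longrightarrow> f * p \<in> I"
  using additive_subgroup.a_subset[OF ideal.axioms(1)[OF assms]]
    additive_subgroup.zero_closed[OF ideal.axioms(1)[OF assms]]
    additive_subgroup.a_closed[OF ideal.axioms(1)[OF assms]] ideal.I_l_closed[OF assms]
  by (auto simp: add_poly_ring mult_poly_ring zero_poly_ring)

definition graded_submodule :: "nat \<Rightarrow> nat set \<Rightarrow> (nat \<Rightarrow> nat) \<Rightarrow> (nat \<Rightarrow>\<^sub>0 'k::field mpoly) set \<Rightarrow> bool" where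
  "graded_submodule n G sh K \<longleftrightarrow> K \<subseteq> free_module n G \<and> 0 \<in> K \<and> (\<forall>v\<in>K. \<forall>w\<in>K. v + w \<in> K) \<and>
    (\<forall>p\<in>carrier (poly_ring n). \<forall>v\<in>K. scale p v \<in> K) \<and> (\<forall>v\<in>K. \<forall>j. hcomp sh j v \<in> K)"

lemma graded_submodule_subspace: "graded_submodule n G sh K \<Longrightarrow> mv.subspace K"
  by (rule mv.subspaceI) (auto simp: graded_submodule_def mscale_def carrier_const)

lemma free_module_add: "v \<in> free_module n G \<Longrightarrow> w \<in> free_module n G \<Longrightarrow> v + w \<in> free_module n G"
  using Poly_Mapping.keys_add[of v w] by (auto simp: free_module_def lookup_add intro: carrier_add)

lemma free_module_scale: "p \<in> carrier (poly_ring n) \<Longrightarrow> v \<in> free_module n G \<Longrightarrow> scale p v \<in> free_module n G"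
  by (auto simp: free_module_def lookup_scale in_keys_iff intro: carrier_mult)

lemma free_module_zero: "0 \<in> free_module n G"
  by (simp add: free_module_def carrier_poly_ring)

lemma free_module_subspace: "mv.subspace (free_module n G)"
  by (rule mv.subspaceI) (auto simp: mscale_def carrier_const intro: free_module_add free_module_scale free_module_zero)

text \<open>Bases of all homogeneous components are taken together as generators; there may be
  infinitely many of them, but only finitely many in each degree.\<close>

lemma homogeneous_generators:
  fixes K :: "(nat \<Rightarrow>\<^sub>0 'k::field mpoly) set"
  assumes K: "graded_submodule n G sh K" and fin: "\<And>j. finite {g \<in> G. sh g = j}"
  shows "\<exists>G' sh' f. (\<forall>j. finite {g \<in> G'. sh' g = j}) \<and> (\<forall>g\<in>G'. f g \<in> hpart n G sh (sh' g)) \<and>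
    lin_ext f ` free_module n G' = K"
proof -
  have "\<exists>xs. set xs \<subseteq> K \<inter> hpart n G sh j \<and> K \<inter> hpart n G sh j \<subseteq> mv.span (set xs)" for j
  proof -
    have "mv.subspace (K \<inter> hpart n G sh j)"
      by (rule mv.subspace_inter[OF graded_submodule_subspace[OF K] hpart_subspace])
    moreover have "mv.fdim (K \<inter> hpart n G sh j)"
      by (rule mv.fdim_subset[OF hpart_fdim[OF fin]]) auto
    ultimately obtain B where "finite B" "mv.span B = K \<inter> hpart n G sh j" "B \<subseteq> K \<inter> hpart n G sh j"
      using mv.fdim_basis by metis
    then show ?thesis using finite_list[of B] by auto
  qed
  then obtain xs where xs: "\<And>j. set (xs j) \<subseteq> K \<inter> hpart n G sh j" "\<And>j. K \<inter> hpart n G sh j \<subseteq> mv.span (set (xs j))"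
    by metis
  \<comment> \<open>A generator is coded by its degree and its position in the list for that
    degree.\<close>
  define sh' where "sh' g = fst (prod_decode g)" for g
  define f where "f g = xs (fst (prod_decode g)) ! snd (prod_decode g)" for g
  define G' where "G' = {g. snd (prod_decode g) < length (xs (sh' g))}"
  have "finite {g \<in> G'. sh' g = j}" for j
  proof (rule finite_subset)
    show "{g \<in> G'. sh' g = j} \<subseteq> (\<lambda>t. prod_encode (j, t)) ` {..<length (xs j)}"
    proof
      fix g assume "g \<in> {g \<in> G'. sh' g = j}"
      then have "snd (prod_decode g) < length (xs j)" "fst (prod_decode g) = j" by (auto simp: G'_def sh'_def)
      moreover have "g = prod_encode (prod_decode g)" by simp
      ultimately show "g \<in> (\<lambda>t. prod_encode (j, t)) ` {..<length (xs j)}"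
        by (metis image_eqI lessThan_iff prod.collapse)
    qed
  qed simp
  moreover have fK: "f g \<in> K \<inter> hpart n G sh (sh' g)" if "g \<in> G'" for g
    using xs(1)[of "sh' g"] that by (auto simp: f_def G'_def sh'_def)
  moreover have "lin_ext f ` free_module n G' = K"
  proof
    show "lin_ext f ` free_module n G' \<subseteq> K"
    proof safe
      fix v :: "nat \<Rightarrow>\<^sub>0 'k mpoly" assume v: "v \<in> free_module n G'"
      show "lin_ext f v \<in> K"
        unfolding lin_ext_def
      proof (rule mv.subspace_sum[OF graded_submodule_subspace[OF K]])
        fix g assume "g \<in> keys v"
        then have "g \<in> G'" "lookup v g \<in> carrier (poly_ring n)" using v by (auto simp: free_module_def)
        then show "scale (lookup v g) (f g) \<in> K" using fK K by (auto simp: graded_submodule_def)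
      qed
    qed
    show "K \<subseteq> lin_ext f ` free_module n G'"
    proof
      fix v assume v: "v \<in> K"
      have sub: "mv.subspace (lin_ext f ` free_module n G')"
        by (rule mm.linear_subspace_image[OF linear_lin_ext free_module_subspace])
      have gen: "set (xs j) \<subseteq> lin_ext f ` free_module n G'" for j
      proof
        fix x assume "x \<in> set (xs j)"
        then obtain t where t: "t < length (xs j)" "x = xs j ! t" by (metis in_set_conv_nth)
        let ?g = "prod_encode (j, t)"
        have "?g \<in> G'" "f ?g = x" using t by (auto simp: G'_def sh'_def f_def)
        moreover have "Poly_Mapping.single ?g 1 \<in> free_module n G'"
          using \<open>?g \<in> G'\<close> by (auto simp: free_module_def lookup_single when_def carrier_poly_ring)
        moreover have "lin_ext f (Poly_Mapping.single ?g 1) = f ?g"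
          unfolding lin_ext_single by (rule poly_mapping_eqI) (simp add: lookup_scale)
        ultimately show "x \<in> lin_ext f ` free_module n G'" by (metis imageI)
      qed
      obtain L where L: "finite L" "v = (\<Sum>l\<in>L. hcomp sh l v)" by (rule hcomp_decompose)
      have "hcomp sh l v \<in> lin_ext f ` free_module n G'" for l
      proof -
        have "hcomp sh l v \<in> K \<inter> hpart n G sh l"
          using v K hcomp_in_hpart[of v n G sh l] by (auto simp: graded_submodule_def)
        then show ?thesis using xs(2)[of l] mv.span_minimal[OF gen[of l] sub] by blast
      qed
      then show "v \<in> lin_ext f ` free_module n G'"
        by (subst L(2)) (intro mv.subspace_sum[OF sub])
    qed
  qed
  ultimately show ?thesis by blast
qed

lemma graded_submodule_kernel:
  assumes "\<And>g. g \<in> G' \<Longrightarrow> f g \<in> hpart n G sh (sh' g)"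
  shows "graded_submodule n G' sh' {v \<in> free_module n G'. lin_ext f v = 0}"
proof -
  have "hcomp sh' j v \<in> free_module n G'" if "v \<in> free_module n G'" for j and v :: "nat \<Rightarrow>\<^sub>0 'a mpoly"
    using hcomp_in_hpart[OF that] hpart_free_module by blast
  moreover have "lin_ext f (hcomp sh' j v) = 0" if "v \<in> free_module n G'" "lin_ext f v = 0" for j v
  proof -
    have "lin_ext f (hcomp sh' j v) = hcomp sh j (lin_ext f v)"
      by (rule hcomp_lin_ext[OF assms that(1), symmetric])
    then show ?thesis using that(2) by simp
  qed
  ultimately show ?thesis
    unfolding graded_submodule_def
    by (auto simp: lin_ext_add lin_ext_scale scale_zero_right free_module_zero
        intro: free_module_add free_module_scale)
qed

lemma graded_submodule_ideal:
  assumes "graded_ideal n I"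
  shows "graded_submodule n {0} (\<lambda>_. 0) (emb ` I)"
proof -
  have I: "ideal I (poly_ring n)" using assms by (simp add: graded_ideal_def)
  have "hcomp (\<lambda>_. 0) j (emb p) = emb (hom_component j p)" for j and p :: "'a mpoly"
    by (rule mpoly_vec_eqI) (auto simp: lookup_hcomp lookup_single when_def lookup_hom_component)
  moreover have "emb p \<in> free_module n {0}" if "p \<in> I" for p
    using ideal_carrier[OF I] that by (auto simp: free_module_def lookup_single when_def carrier_poly_ring)
  moreover have "0 \<in> emb ` I" using ideal_zero[OF I] by (metis imageI single_zero)
  moreover have "emb p + emb q \<in> emb ` I" if "p \<in> I" "q \<in> I" for p q
    using ideal_add[OF I that] by (simp add: single_add[symmetric])
  ultimately show ?thesis
    using assms ideal_mult[OF I]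
    by (auto simp: graded_submodule_def scale_single_vec graded_ideal_def)
qed

theorem graded_free_resolution_exists:
  fixes I :: "'k::field mpoly set"
  assumes "graded_ideal n I"
  shows "\<exists>F. graded_free_resolution n I F"
proof -
  \<comment> \<open>One stage of the resolution: basis and shifts of the target, basis and shifts of
    the source, and the map on generators. With all of this in the state, the next stage can be
    chosen from the previous one.\<close>
  define ok where "ok = (\<lambda>(T, tsh, G, sh, f :: nat \<Rightarrow> (nat \<Rightarrow>\<^sub>0 'k mpoly)).
    (\<forall>j. finite {g \<in> G. sh g = (j::nat)}) \<and> (\<forall>g\<in>G. f g \<in> hpart n T tsh (sh g)))"
  define P where "P i x \<longleftrightarrow> ok x \<and> (i = 0 \<longrightarrow> (case x of (T, tsh, G, sh, f) \<Rightarrow>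
    T = {0} \<and> tsh = (\<lambda>_. 0) \<and> lin_ext f ` free_module n G = emb ` I))"
    for i :: nat and x :: "nat set \<times> (nat \<Rightarrow> nat) \<times> nat set \<times> (nat \<Rightarrow> nat) \<times> (nat \<Rightarrow> (nat \<Rightarrow>\<^sub>0 'k mpoly))"
  define Q where "Q x z \<longleftrightarrow> (case x of (T, tsh, G, sh, f) \<Rightarrow> case z of (T', tsh', G', sh', f') \<Rightarrow>
    T' = G \<and> tsh' = sh \<and> lin_ext f' ` free_module n G' = {v \<in> free_module n G. lin_ext f v = 0})"
    for x z :: "nat set \<times> (nat \<Rightarrow> nat) \<times> nat set \<times> (nat \<Rightarrow> nat) \<times> (nat \<Rightarrow> (nat \<Rightarrow>\<^sub>0 'k mpoly))"
  have start: "\<exists>x. P 0 x"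
  proof -
    obtain G sh f where "\<forall>j. finite {g \<in> G. sh g = j}" "\<forall>g\<in>G. f g \<in> hpart n {0} (\<lambda>_. 0) (sh g)"
        "lin_ext f ` free_module n G = emb ` I"
      using homogeneous_generators[OF graded_submodule_ideal[OF assms]] by auto
    then have "P 0 ({0}, \<lambda>_. 0, G, sh, f)" by (simp add: P_def ok_def)
    then show ?thesis ..
  qed
  have step: "\<exists>z. P (Suc i) z \<and> Q x z" if "P i x" for i x
  proof -
    obtain T tsh G sh f where x: "x = (T, tsh, G, sh, f)" by (cases x)
    then have ok: "\<And>j. finite {g \<in> G. sh g = j}" "\<And>g. g \<in> G \<Longrightarrow> f g \<in> hpart n T tsh (sh g)"
      using that by (auto simp: P_def ok_def)
    obtain G' sh' f' where "\<forall>j. finite {g \<in> G'. sh' g = j}" "\<forall>g\<in>G'. f' g \<in> hpart n G sh (sh' g)"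
        "lin_ext f' ` free_module n G' = {v \<in> free_module n G. lin_ext f v = 0}"
      using homogeneous_generators[OF graded_submodule_kernel[OF ok(2)] ok(1)] by blast
    then have "P (Suc i) (G, sh, G', sh', f') \<and> Q x (G, sh, G', sh', f')" by (simp add: P_def ok_def Q_def x)
    then show ?thesis ..
  qed
  obtain X where X: "\<And>i. P i (X i)" "\<And>i. Q (X i) (X (Suc i))"
    using dependent_nat_choice[of P "\<lambda>_. Q", OF start step] by blast
  define T where "T i = fst (X i)" for i
  define tsh where "tsh i = fst (snd (X i))" for i
  define G where "G i = fst (snd (snd (X i)))" for i
  define sh where "sh i = fst (snd (snd (snd (X i))))" for i
  define f where "f i = snd (snd (snd (snd (X i))))" for i
  have Xi: "X i = (T i, tsh i, G i, sh i, f i)" for i by (simp add: T_def tsh_def G_def sh_def f_def)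
  have fin: "finite {g \<in> G i. sh i g = j}" for i j using X(1)[of i] by (simp add: Xi P_def ok_def)
  have hom: "f i g \<in> hpart n (T i) (tsh i) (sh i g)" if "g \<in> G i" for i g
    using X(1)[of i] that by (simp add: Xi P_def ok_def)
  have T0: "T 0 = {0}" "tsh 0 = (\<lambda>_. 0)" "lin_ext (f 0) ` free_module n (G 0) = emb ` I"
    using X(1)[of 0] by (simp_all add: Xi P_def)
  have TS: "T (Suc i) = G i" "tsh (Suc i) = sh i"
    "lin_ext (f (Suc i)) ` free_module n (G (Suc i)) = {v \<in> free_module n (G i). lin_ext (f i) v = 0}" for i
    using X(2)[of i] by (simp_all add: Xi Q_def)
  define F :: "'k free_complex" where "F = \<lparr>gens = G, shift = sh, aug = \<lambda>g. lookup (f 0 g) 0, bdry = \<lambda>i. f (Suc i)\<rparr>"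
  have F: "gens F = G" "shift F = sh" "aug F = (\<lambda>g. lookup (f 0 g) 0)" "bdry F = (\<lambda>i. f (Suc i))"
    by (simp_all add: F_def)
  \<comment> \<open>The first target is S on the generator 0, so coordinate 0 recovers the
    augmentation.\<close>
  have f0: "f 0 g = emb (lookup (f 0 g) 0)" if "g \<in> G 0" for g
    using hom[OF that] unfolding T0 hpart_base by auto
  have augm: "emb (aug_map F v) = lin_ext (f 0) v" if "v \<in> free_module n (G 0)" for v
  proof -
    have "lin_ext (f 0) v = (\<Sum>g\<in>keys v. scale (lookup v g) (emb (lookup (f 0 g) 0)))"
      unfolding lin_ext_def using that f0 by (intro sum.cong refl) (auto simp: free_module_def)
    then show ?thesis by (simp add: aug_map_def F scale_single_vec single_sum)
  qed
  have aug0: "aug_map F v = 0 \<longleftrightarrow> lin_ext (f 0) v = 0" if "v \<in> free_module n (G 0)" for v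
    using augm[OF that] by (metis embed_inj single_zero)
  have augI: "aug_map F ` free_module n (G 0) = I"
  proof -
    have "emb ` aug_map F ` free_module n (G 0) = emb ` I"
      unfolding T0(3)[symmetric] image_image using augm by (intro image_cong) auto
    then show ?thesis by (rule inj_image_eq_iff[THEN iffD1, rotated]) (simp add: inj_def embed_inj)
  qed
  have "graded_free_resolution n I F"
    unfolding graded_free_resolution_def F
  proof (intro conjI allI ballI)
    show "aug_map F ` free_module n (G 0) = I" by (rule augI)
    show "{v \<in> free_module n (G 0). aug_map F v = 0} = lin_ext (f (Suc 0)) ` free_module n (G 1)"
      using TS(3)[of 0] aug0 by auto
    show "mdeg a = sh 0 g" if "g \<in> G 0" "a \<in> keys (lookup (f 0 g) 0)" for g a
      using hom[OF that(1)] that(2) by (auto simp: hpart_def T0)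
    show "f (Suc i) g \<in> free_module n (G i)" if "g \<in> G (Suc i)" for i g
      using hom[OF that] hpart_free_module unfolding TS by blast
    show "mdeg a + sh i h = sh (Suc i) g"
      if "g \<in> G (Suc i)" "a \<in> keys (lookup (f (Suc i) g) h)" for i g h a
      using hom[OF that(1)] that(2) unfolding TS hpart_def by blast
    show "{v \<in> free_module n (G (Suc i)). lin_ext (f (Suc i)) v = 0} =
        lin_ext (f (Suc (Suc i))) ` free_module n (G (Suc (Suc i)))" for i
      using TS(3)[of "Suc i"] by simp
  qed (rule fin)
  then show ?thesis ..
qed

section \<open>Betti numbers and generic flags\<close>

lemma good_Var:
  assumes "inj_on \<sigma> {..<p}" "\<And>q. q < p \<Longrightarrow> \<sigma> q \<in> {1..n}"
  shows "good n p (\<lambda>q. Var (\<sigma> q) :: 'k::field mpoly)"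
  unfolding good_def
proof (intro allI impI conjI notI)
  fix q assume q: "q < p"
  show "(Var (\<sigma> q) :: 'k mpoly) \<in> Sd n 1" by (rule Var_Sd[OF assms(2)[OF q]])
  assume "(Var (\<sigma> q) :: 'k mpoly) \<in> Yd n (\<lambda>q. Var (\<sigma> q)) q 1"
  then obtain f :: "nat \<Rightarrow> 'k mpoly" where
    f: "Var (\<sigma> q) = (\<Sum>r<q. Var (\<sigma> r) * f r)" "\<forall>r<q. f r \<in> Sd n 0"
    by (auto simp: Yd_Suc)
  let ?m = "Poly_Mapping.single (\<sigma> q) (1::nat)"
  have "lookup (Var (\<sigma> r) * f r) ?m = 0" if r: "r < q" for r
  proof -
    obtain c where c: "f r = Poly_Mapping.single 0 c" using f(2) r by (auto simp: Sd_const)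
    have "\<sigma> r \<noteq> \<sigma> q" using assms(1) r q by (auto simp: inj_on_def)
    then have "Poly_Mapping.single (\<sigma> r) (1::nat) \<noteq> ?m"
      by (metis lookup_single_eq lookup_single_not_eq zero_neq_one)
    then show ?thesis by (simp add: c Var_def mult_single lookup_single)
  qed
  then have "lookup (\<Sum>r<q. Var (\<sigma> r) * f r) ?m = 0" by (simp add: lookup_sum)
  moreover have "lookup (Var (\<sigma> q) :: 'k mpoly) ?m = 1" by (simp add: Var_def)
  ultimately show False using f(1) by simp
qed

lemma betti_tor_dim:
  assumes "graded_ideal n I"
  obtains F where "graded_free_resolution n I F" "\<And>i j. betti n I i j = tor_dim F i j"
proof -
  have "graded_free_resolution n I (SOME F. graded_free_resolution n I F)"
    by (rule someI_ex[OF graded_free_resolution_exists[OF assms]])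
  then show ?thesis using that by (simp add: betti_def tor_dim_def Let_def)
qed

lemma graded_ideal_carrier: "graded_ideal n I \<Longrightarrow> I \<subseteq> carrier (poly_ring n)"
  by (simp add: graded_ideal_def ideal_carrier)

lemma graded_ideal_resolution:
  "graded_ideal n I \<Longrightarrow> graded_free_resolution n I F \<Longrightarrow> good n n y \<Longrightarrow> flagged_resolution n I F y"
  by (simp add: flagged_resolution_def flagged_resolution_axioms_def resolution_def graded_ideal_carrier)

lemma Ipart_mult: "graded_ideal n I \<Longrightarrow> f \<in> Sd n i \<Longrightarrow> u \<in> Ipart n I j \<Longrightarrow> f * u \<in> Ipart n I (i + j)"
  using ideal_mult[of I n f u] Sd_carrier[of n i] Sd_mult[of f n i u j]
  by (auto simp: Ipart_def graded_ideal_def)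

lemma graded_Ipart_subspace:
  assumes "graded_ideal n I" shows "pv.subspace (Ipart n I j)"
  using graded_free_resolution_exists[OF assms] resolution.Ipart_subspace[of n I]
  by (auto simp: resolution_def graded_ideal_carrier[OF assms])

context flagged_resolution
begin

lemma low:
  assumes "\<forall>j<d. Ipart n I j = {0}" "j < d" "v \<in> M (Suc 0) j"
  shows "D 0 v = 0"
  using D_0_image[of j] assms by auto

lemma Y_full_0:
  assumes "0 < j \<or> Ipart n I j = {0}" "v \<in> M (Suc 0) j"
  shows "D 0 v \<in> gc.Y n 0 j"
proof -
  obtain p where p: "p \<in> Ipart n I j" "D 0 v = emb p" using D_0_image[of j] assms(2) by auto
  have "p \<in> Yd n y n j"
  proof (cases j)
    case 0
    then show ?thesis using assms p by auto
  next
    case (Suc l)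
    then show ?thesis using p good_full_all[OF y, of l] by (simp add: Ipart_def)
  qed
  then show ?thesis using p Y_base[of n j] by simp
qed

lemma tor_hdim:
  assumes "0 < d" "\<forall>j<d. Ipart n I j = {0}"
  shows "int (tor_dim F i j) = gc.hdim n i j"
proof (rule tor_dim_hdim)
  have "0 < j \<or> Ipart n I j = {0}" using assms by (cases j) auto
  then show "\<forall>v\<in>M (Suc 0) j. D 0 v \<in> gc.Y n 0 j" using Y_full_0[of j] by blast
qed

lemma tor_dim_strand:
  assumes d: "0 < d" "\<forall>j<d. Ipart n I j = {0}" and co: "\<And>p. p < n \<Longrightarrow> colon_at n y I p d"
  shows "int (tor_dim F i (i + d)) =
    (\<Sum>q<n. (restr_dim n y I q d - restr_dim n y I (Suc q) d) * int ((n - 1 - q) choose i))"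
proof -
  have "int (tor_dim F i (i + d)) = (\<Sum>q<n. (gc.mu q d - gc.mu (Suc q) d) * int ((n - 1 - q) choose i))"
    unfolding tor_hdim[OF d]
    by (rule gc.hdim_strand[OF d(1)]) (use co colon_base low[OF d(2)] in auto)
  then show ?thesis by (simp add: mu_base)
qed

lemma tor_dim_off_strand:
  assumes d: "0 < d" "\<forall>j<d. Ipart n I j = {0}"
    and co: "\<And>p l. p < n \<Longrightarrow> d \<le> l \<Longrightarrow> l < R \<Longrightarrow> colon_at n y I p l"
    and j: "j \<le> i + R" "j \<noteq> i + d"
  shows "tor_dim F i j = 0"
proof -
  have "gc.exactT n (Suc i) j"
    by (rule gc.exactT_off_strand'[where d = d and R = R]) (use co colon_base j low[OF d(2)] in auto)
  then show ?thesis using tor_hdim[OF d, of i j] gc.exactT_hdim[of n i j] by simp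
qed

text \<open>Through this the linear resolution enters the choice of the next form: regularity of the
  earlier forms in degrees below \<open>R\<close> excludes socle elements in degrees from
  \<open>d\<close> to \<open>R - 2\<close>.\<close>

lemma socle_IY:
  assumes d: "0 < d" "\<forall>j<d. Ipart n I j = {0}"
    and tor: "\<And>i j. i + d < j \<Longrightarrow> tor_dim F i j = 0"
    and p: "p < n" and co: "\<And>q l. q < p \<Longrightarrow> d \<le> l \<Longrightarrow> l < R \<Longrightarrow> colon_at n y I q l"
    and j: "d \<le> j" "j + 2 \<le> R" and z: "z \<in> Sd n j" "\<And>r. p \<le> r \<Longrightarrow> r < n \<Longrightarrow> y r * z \<in> IY n y I p (Suc j)"
  shows "z \<in> IY n y I p j"
proof -
  have emb_iff: "emb a \<in> emb ` A \<longleftrightarrow> a \<in> A" for a :: "'k mpoly" and A by (auto simp: embed_inj)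
  have "emb z \<in> gc.B p 0 (0 + j)"
  proof (rule gc.socle_vanishes[where d = d and R = R])
    show "gc.exactT n (Suc i) l" if "i + d < l" for i l
      using tor[OF that] tor_hdim[OF d, of i l] gc.exactT_hdim[of n i l] by simp
    show "gc.exactT p (Suc i') l" if "0 \<le> i'" "i' + d < l" "l \<le> i' + R" for i' l
      by (rule gc.exactT_off_strand'[where d = d and R = R]) (use p co colon_base that low[OF d(2)] in auto)
    show "emb z \<in> gc.Z p 0 (0 + j)" using z by (simp add: gc.Z_0 M_0)
    show "scale (y r) (emb z) \<in> gc.B p 0 (Suc (0 + j))" if "p \<le> r" "r < n" for r
      using z(2)[OF that] p by (simp add: scale_single_vec B_base)
  qed (use p j in auto)
  then show ?thesis using p by (simp add: B_base emb_iff)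
qed

text \<open>Graded Nakayama: if Tor_0 vanishes in degree \<open>j\<close>, every vector of that
  degree is a combination of the forms up to a boundary, and \<open>D 0\<close> kills the
  boundary.\<close>

lemma Ipart_generated:
  assumes "tor_dim F 0 j = 0" "f \<in> Ipart n I j"
  shows "f \<in> Ysum (\<lambda>q. (*) (y q)) (Ipart n I) n j"
proof -
  have BM: "gc.B n (Suc 0) j \<subseteq> M (Suc 0) j" using gc.B_subset_Z[of n "Suc 0" j] gc.Z_subset by blast
  have YB: "gc.Y n (Suc 0) j \<subseteq> gc.B n (Suc 0) j" using gc.YI_B by blast
  have cyc: "tor_cycles F 0 j = cterm ` M (Suc 0) j" by (simp add: tor_cycles_def cterm_M)
  have "kspace.dim (cterm ` M (Suc 0) j) \<le> kspace.dim (cterm ` gc.B n (Suc 0) j)"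
    using assms(1) by (simp add: tor_dim_def cyc tor_boundaries_cterm)
  then have "mv.dim (M (Suc 0) j) \<le> mv.dim (gc.B n (Suc 0) j)"
    using cterm_dim[OF hpart_subspace subset_trans[OF YB BM] subset_refl] cterm_dim[OF gc.B_subspace YB BM] by simp
  then have BM: "gc.B n (Suc 0) j = M (Suc 0) j"
    by (intro mv.dim_eq_imp_eq gc.M_fdim hpart_subspace gc.B_subspace BM)
  have "emb f \<in> D 0 ` M (Suc 0) j" unfolding D_0_image using assms(2) by (rule imageI)
  then obtain v where v: "v \<in> M (Suc 0) j" "D 0 v = emb f" by (metis imageE)
  have "v \<in> gc.B n (Suc 0) j" using v(1) BM by simp
  then obtain a w where aw: "v = a + D (Suc 0) w" "a \<in> gc.Y n (Suc 0) j" "w \<in> M (Suc (Suc 0)) j"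
    by (auto simp: gc.B_def)
  have Da: "D 0 a = emb f" using v aw D_D[of w 0 j] by (simp add: lin_ext_add)
  show ?thesis
  proof (cases j)
    case 0
    then have "emb f = 0" using aw Da by simp
    then show ?thesis using 0 by (simp add: embed_inj[of 0 f 0, simplified])
  next
    case (Suc l)
    then obtain h where h: "a = (\<Sum>q<n. scale (y q) (h q))" "\<forall>q<n. h q \<in> M (Suc 0) l"
      using aw by (auto simp: Ysum_Suc)
    have "\<exists>g. D 0 (h q) = emb g \<and> g \<in> Ipart n I l" if "q < n" for q
      using h(2) that D_0_image[of l] by blast
    then obtain g where g: "\<And>q. q < n \<Longrightarrow> D 0 (h q) = emb (g q) \<and> g q \<in> Ipart n I l" by metis
    have "emb f = (\<Sum>q<n. scale (y q) (D 0 (h q)))" by (simp add: Da[symmetric] h(1) lin_ext_sum lin_ext_scale)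
    also have "\<dots> = emb (\<Sum>q<n. y q * g q)" using g by (simp add: scale_single_vec single_sum)
    finally have "f = (\<Sum>q<n. y q * g q)" by (simp add: embed_inj)
    moreover have "\<forall>q<n. g q \<in> Ipart n I l" using g by blast
    ultimately show ?thesis unfolding Suc Ysum_Suc by blast
  qed
qed

end

lemma good_exists: obtains y :: "nat \<Rightarrow> 'k::field mpoly" where "good n n y"
  using good_extend[of n 0 "\<lambda>_. 0"] by auto

theorem betti_strand:
  assumes "graded_ideal n I" "good n n y" "0 < d" "\<forall>j<d. Ipart n I j = {0}"
    and "\<forall>p<n. colon_at n y I p d"
  shows "int (betti n I i (i + d)) =
    (\<Sum>q<n. (restr_dim n y I q d - restr_dim n y I (Suc q) d) * int ((n - 1 - q) choose i))"
proof -
  obtain F where F: "graded_free_resolution n I F" "\<And>i j. betti n I i j = tor_dim F i j"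
    using betti_tor_dim[OF assms(1)] by blast
  show ?thesis unfolding F(2)
    by (rule flagged_resolution.tor_dim_strand[OF graded_ideal_resolution[OF assms(1) F(1) assms(2)] assms(3,4)])
      (use assms(5) in blast)
qed

theorem betti_off_strand:
  assumes "graded_ideal n I" "good n n y" "0 < d" "\<forall>j<d. Ipart n I j = {0}"
    and "\<And>p j. p < n \<Longrightarrow> d \<le> j \<Longrightarrow> j < R \<Longrightarrow> colon_at n y I p j" and "j \<le> i + R" "j \<noteq> i + d"
  shows "betti n I i j = 0"
proof -
  obtain F where F: "graded_free_resolution n I F" "\<And>i j. betti n I i j = tor_dim F i j"
    using betti_tor_dim[OF assms(1)] by blast
  show ?thesis unfolding F(2)
    by (rule flagged_resolution.tor_dim_off_strand[OF graded_ideal_resolution[OF assms(1) F(1) assms(2)] assms(3-7)])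
qed

lemma linear_resolution_generated:
  assumes "graded_ideal n I" "has_linear_resolution n d I" "good n n y" "j \<noteq> d" "f \<in> Ipart n I j"
  shows "f \<in> Ysum (\<lambda>q. (*) (y q)) (Ipart n I) n j"
proof -
  obtain F where F: "graded_free_resolution n I F" "\<And>i j. betti n I i j = tor_dim F i j"
    using betti_tor_dim[OF assms(1)] by blast
  have "betti n I 0 (0 + j) = 0" using assms(2,4) unfolding has_linear_resolution_def by blast
  then have "tor_dim F 0 j = 0" using F(2)[of 0 j] by simp
  then show ?thesis
    by (rule flagged_resolution.Ipart_generated[OF graded_ideal_resolution[OF assms(1) F(1) assms(3)] _ assms(5)])
qed

lemma Ipart_zero: "graded_ideal n I \<Longrightarrow> 0 \<in> Ipart n I j"
  using graded_Ipart_subspace pv.subspace_0 by blast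

text \<open>A lowest nonzero component would need minimal generators in its own degree.\<close>

lemma linear_resolution_start:
  assumes "graded_ideal n I" "has_linear_resolution n d I" "j < d"
  shows "Ipart n I j = {0}"
proof -
  obtain y :: "nat \<Rightarrow> 'a mpoly" where y: "good n n y" by (rule good_exists)
  have "Ipart n I j \<subseteq> {0}" using assms(3)
  proof (induction j)
    case 0
    then show ?case using linear_resolution_generated[OF assms(1,2) y, of 0] by auto
  next
    case (Suc j)
    show ?case
    proof
      fix f assume "f \<in> Ipart n I (Suc j)"
      then have "f \<in> Ysum (\<lambda>q. (*) (y q)) (Ipart n I) n (Suc j)"
        using linear_resolution_generated[OF assms(1,2) y, of "Suc j" f] Suc.prems by simp
      then obtain g where g: "f = (\<Sum>q<n. y q * g q)" "\<forall>q<n. g q \<in> Ipart n I j" by (auto simp: Ysum_Suc)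
      have "g q = 0" if "q < n" for q using g(2) that Suc by auto
      then show "f \<in> {0}" unfolding g(1) by simp
    qed
  qed
  then show ?thesis using Ipart_zero[OF assms(1)] by blast
qed

lemma IY_cong: "(\<And>q. q < p \<Longrightarrow> y q = y' q) \<Longrightarrow> IY n y I p j = IY n y' I p j"
  unfolding IY_def using Yd_cong[of p y y' n j] by simp

lemma colon_at_cong: "(\<And>q. q \<le> p \<Longrightarrow> y q = y' q) \<Longrightarrow> colon_at n y I p j = colon_at n y' I p j"
  unfolding colon_at_def using IY_cong[of p y y' n I] by simp

lemma restr_dim_cong: "(\<And>q. q < p \<Longrightarrow> y q = y' q) \<Longrightarrow> restr_dim n y I p j = restr_dim n y' I p j"
  unfolding restr_dim_def using IY_cong[of p y y' n I j] Yd_cong[of p y y' n j] by simp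

lemma graded_IY_subspace: "graded_ideal n I \<Longrightarrow> pv.subspace (IY n y I p j)"
  unfolding IY_def by (intro pv.subspace_sums Yd_subspace graded_Ipart_subspace)

lemma Yd_subset_IY: "graded_ideal n I \<Longrightarrow> Yd n y p j \<subseteq> IY n y I p j"
  unfolding IY_def using Ipart_zero by (metis (mono_tags, lifting) CollectI add.right_neutral subsetI)

lemma IY_subset_Sd: "\<forall>q<p. y q \<in> Sd n 1 \<Longrightarrow> IY n y I p j \<subseteq> Sd n j"
  using Yd_subset[of p y n j] pv.subspace_add[OF Sd_subspace] by (fastforce simp: IY_def Ipart_def)

lemma IY_mult:
  assumes "graded_ideal n I" "f \<in> Sd n i" "u \<in> IY n y I p j"
  shows "f * u \<in> IY n y I p (i + j)"
proof -
  obtain a b where "u = a + b" "a \<in> Yd n y p j" "b \<in> Ipart n I j" using assms(3) by (auto simp: IY_def)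
  then have "f * u = f * a + f * b" "f * a \<in> Yd n y p (i + j)" "f * b \<in> Ipart n I (i + j)"
    using Yd_mult[OF _ assms(2)] Ipart_mult[OF assms(1,2)] by (simp_all only: distrib_left)
  then show ?thesis unfolding IY_def by blast
qed

lemma IY_step: "IY n y I (Suc p) (Suc e) = add_mult n (y p) (IY n y I p (Suc e)) (Suc e)"
proof
  show "IY n y I (Suc p) (Suc e) \<subseteq> add_mult n (y p) (IY n y I p (Suc e)) (Suc e)"
  proof
    fix x assume "x \<in> IY n y I (Suc p) (Suc e)"
    then obtain a u b where "x = (a + y p * u) + b" "a \<in> Yd n y p (Suc e)" "u \<in> Sd n e" "b \<in> Ipart n I (Suc e)"
      by (auto simp: IY_def Yd_step)
    moreover from this have "x = (a + b) + y p * u" by (simp add: ac_simps)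
    ultimately show "x \<in> add_mult n (y p) (IY n y I p (Suc e)) (Suc e)"
      unfolding add_mult_Suc IY_def by blast
  qed
  show "add_mult n (y p) (IY n y I p (Suc e)) (Suc e) \<subseteq> IY n y I (Suc p) (Suc e)"
  proof
    fix x assume "x \<in> add_mult n (y p) (IY n y I p (Suc e)) (Suc e)"
    then obtain a u b where "x = (a + b) + y p * u" "a \<in> Yd n y p (Suc e)" "u \<in> Sd n e" "b \<in> Ipart n I (Suc e)"
      by (auto simp: add_mult_Suc IY_def)
    moreover from this have "x = (a + y p * u) + b" by (simp add: ac_simps)
    ultimately show "x \<in> IY n y I (Suc p) (Suc e)"
      unfolding Yd_step IY_def by blast
  qed
qed

lemma restr_dim_nat:
  assumes "graded_ideal n I" "\<forall>q<p. y q \<in> Sd n 1"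
  shows "restr_dim n y I p d = int (pv.dim (IY n y I p d) - pv.dim (Yd n y p d))" "0 \<le> restr_dim n y I p d"
proof -
  have "pv.dim (Yd n y p d) \<le> pv.dim (IY n y I p d)"
    by (rule pv.dim_mono'[OF pv.fdim_subset[OF Sd_fdim IY_subset_Sd[OF assms(2)]]
        graded_IY_subspace[OF assms(1)] Yd_subset_IY[OF assms(1)]])
  then show "restr_dim n y I p d = int (pv.dim (IY n y I p d) - pv.dim (Yd n y p d))" "0 \<le> restr_dim n y I p d"
    by (simp_all add: restr_dim_def)
qed

text \<open>\<open>R\<close> varies in the induction. The forms before \<open>p\<close> are wanted
  in degrees below \<open>D + 2\<close>: up to \<open>D\<close>, \<open>generic_injective\<close>
  looks for socle elements when it treats the degrees below \<open>R\<close>, and 2 is the loss in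
  \<open>socle_IY\<close>.\<close>

theorem generic_flag:
  fixes I :: "'k::field mpoly set"
  assumes inf: "infinite (UNIV :: 'k set)" and I: "graded_ideal n I" and lin: "has_linear_resolution n d I"
    and d: "0 < d"
  shows "p \<le> n \<Longrightarrow> \<exists>y. good n p y \<and> (\<forall>q<p. \<forall>j. d \<le> j \<longrightarrow> j < R \<longrightarrow> colon_at n y I q j) \<and>
    (\<forall>q<p. int (lexr (n - q) d (nat (restr_dim n y I q d))) \<le> restr_dim n y I (Suc q) d)"
proof (induction p arbitrary: R)
  case 0
  then show ?case by simp
next
  case (Suc p)
  then have p: "p < n" by simp
  define D where "D = (\<Sum>j<R. generic_bound n j)"
  obtain y where y: "good n p y" "\<And>q j. q < p \<Longrightarrow> d \<le> j \<Longrightarrow> j < D + 2 \<Longrightarrow> colon_at n y I q j"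
      "\<And>q. q < p \<Longrightarrow> int (lexr (n - q) d (nat (restr_dim n y I q d))) \<le> restr_dim n y I (Suc q) d"
    using Suc.IH[of "D + 2"] Suc.prems by auto
  \<comment> \<open>The Tor computations refer to a full basis, so the flag is completed
    arbitrarily; the added forms serve only to test for socle elements.\<close>
  obtain z where z: "\<And>q. q < p \<Longrightarrow> z q = y q" "good n n z"
    using good_extend[OF y(1)] p by auto
  obtain F where F: "graded_free_resolution n I F" "\<And>i j. betti n I i j = tor_dim F i j"
    using betti_tor_dim[OF I] by blast
  have tor: "tor_dim F i j = 0" if "i + d < j" for i j
  proof -
    have "j - i \<noteq> d" using that by simp
    then have "betti n I i (i + (j - i)) = 0"
      using lin unfolding has_linear_resolution_def by blast
    then show ?thesis using F(2) that by simp
  qed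
  have start: "\<forall>j<d. Ipart n I j = {0}" using linear_resolution_start[OF I lin] by blast
  have IYz: "IY n z I q j = IY n y I q j" if "q \<le> p" for q j
    by (rule IY_cong) (use z(1) that in auto)
  have coz: "colon_at n z I q j" if "q < p" "d \<le> j" "j < D + 2" for q j
    using y(2)[OF that] colon_at_cong[of q z y n I j] z(1) that by simp
  have soc: "u \<in> IY n y I p j"
    if u: "d \<le> j" "j \<le> D" "u \<in> Sd n j" "\<And>i. i < n \<Longrightarrow> Var (Suc i) * u \<in> IY n y I p (Suc j)" for j u
  proof -
    have "u \<in> IY n z I p j"
    proof (rule flagged_resolution.socle_IY[OF graded_ideal_resolution[OF I F(1) z(2)] d start tor p coz u(1)])
      show "z r * u \<in> IY n z I p (Suc j)" if "p \<le> r" "r < n" for r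
        unfolding IYz[OF order_refl]
        by (rule linear_form_mult_in[OF graded_IY_subspace[OF I] u(4)]) (use goodD[OF z(2)] that in auto)
    qed (use u in auto)
    then show ?thesis by (simp add: IYz)
  qed
  have bad: "finite {t. \<exists>u\<in>Sd n j. u \<notin> IY n y I p j \<and> ell n t * u \<in> IY n y I p (Suc j)}"
    if "d \<le> j" "j < R" for j
  proof (rule generic_injective[where d = d and D = D])
    show "Var (Suc i) * u \<in> IY n y I p (Suc j)" if "i < n" "u \<in> IY n y I p j" for j i u
      using IY_mult[OF I Var_Sd[of "Suc i" n] that(2)] that(1) by simp
    show "generic_bound n j \<le> D" unfolding D_def by (rule member_le_sum) (use that in auto)
  qed (use soc that graded_IY_subspace[OF I] IY_subset_Sd[OF goodD[OF y(1)]] in auto)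
  let ?C = "\<Union>j\<in>{d..<R}. {t. \<exists>u\<in>Sd n j. u \<notin> IY n y I p j \<and> ell n t * u \<in> IY n y I p (Suc j)}"
  let ?G = "{t. \<not> (good n (Suc p) (y(p := ell n t)) \<and>
    lexr (n - p) d (pv.dim (IY n y I p d) - pv.dim (Yd n y p d)) + pv.dim (Yd n (y(p := ell n t)) (Suc p) d)
      \<le> pv.dim (add_mult n (ell n t) (IY n y I p d) d))}"
  have "finite ?C" using bad by simp
  moreover have "finite ?G"
    by (rule Green_restriction[OF inf y(1) p graded_IY_subspace[OF I] Yd_subset_IY[OF I] IY_subset_Sd[OF goodD[OF y(1)]]])
  ultimately have "finite (?C \<union> ?G)" by (rule finite_UnI)
  then obtain t where t: "t \<notin> ?C" "t \<notin> ?G" using ex_new_if_finite[OF inf] by blast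
  define y' where "y' = y(p := ell n t)"
  have y': "y' q = y q" if "q < p" for q using that by (simp add: y'_def)
  have y'p: "y' p = ell n t" by (simp add: y'_def)
  have "good n (Suc p) y'" using t(2) by (simp add: y'_def)
  moreover have "colon_at n y' I q j" if "q < Suc p" "d \<le> j" "j < R" for q j
  proof (cases "q = p")
    case True
    have "IY n y' I p l = IY n y I p l" for l by (rule IY_cong) (rule y')
    then show ?thesis using t(1) that unfolding colon_at_def True y'p by auto
  next
    case False
    have "R \<le> D + 1"
    proof (cases "R = 0")
      case False
      then have "generic_bound n (R - 1) \<le> D" unfolding D_def by (intro member_le_sum) auto
      then show ?thesis by (simp add: generic_bound_def)
    qed simp
    then show ?thesis using y(2)[of q j] colon_at_cong[of q y' y n I j] y' that False by simp
  qed
  moreover have "int (lexr (n - q) d (nat (restr_dim n y' I q d))) \<le> restr_dim n y' I (Suc q) d" if "q < Suc p" for q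
  proof (cases "q = p")
    case True
    obtain e where e: "d = Suc e" using d by (cases d) auto
    have "IY n y' I (Suc p) d = add_mult n (ell n t) (IY n y I p d) d"
      unfolding e IY_step y'p using IY_cong[of p y' y n I "Suc e"] y' by simp
    moreover have "nat (restr_dim n y' I p d) = pv.dim (IY n y I p d) - pv.dim (Yd n y p d)"
      using restr_dim_cong[of p y' y n I d] y' restr_dim_nat(1)[OF I goodD[OF y(1)], of d] by simp
    ultimately show ?thesis using t(2) True by (simp add: restr_dim_def y'_def[symmetric])
  next
    case False
    then show ?thesis
      using y(3)[of q] restr_dim_cong[of q y' y n I d] restr_dim_cong[of "Suc q" y' y n I d] y' that by simp
  qed
  ultimately show ?case by blast
qed

section \<open>Stable monomial ideals\<close>

definition mono_ideal :: "nat \<Rightarrow> (nat \<Rightarrow>\<^sub>0 nat) set \<Rightarrow> 'k::field mpoly set" where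
  "mono_ideal n L = Idl\<^bsub>poly_ring n\<^esub> ((\<lambda>a. Poly_Mapping.single a 1) ` L)"

definition divisible :: "(nat \<Rightarrow>\<^sub>0 nat) set \<Rightarrow> (nat \<Rightarrow>\<^sub>0 nat) \<Rightarrow> bool" where
  "divisible L a \<longleftrightarrow> (\<exists>u\<in>L. \<exists>w. a = u + w)"

lemma divisible_add: "divisible L a \<Longrightarrow> divisible L (b + a)"
  unfolding divisible_def by (metis add.left_commute)

lemma ideal_monomial_multiples:
  "ideal {p :: 'k::field mpoly. p \<in> carrier (poly_ring n) \<and> (\<forall>a\<in>keys p. divisible L a)} (poly_ring n)"
proof -
  let ?J = "{p :: 'k mpoly. p \<in> carrier (poly_ring n) \<and> (\<forall>a\<in>keys p. divisible L a)}"
  interpret R: cring "poly_ring n :: 'k mpoly ring" by (rule cring_poly_ring)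
  have mult: "x * a \<in> ?J" if "a \<in> ?J" "x \<in> carrier (poly_ring n)" for a x
  proof -
    have "divisible L c" if c: "c \<in> keys (x * a)" for c
    proof -
      obtain b e where "c = b + e" "e \<in> keys a" using keys_mult[of x a] c by blast
      then show ?thesis using \<open>a \<in> ?J\<close> divisible_add by auto
    qed
    then show ?thesis using that carrier_mult by blast
  qed
  have neg: "\<ominus>\<^bsub>poly_ring n\<^esub> p = - p" if "p \<in> carrier (poly_ring n)" for p :: "'k mpoly"
    by (rule R.minus_equality) (use that in \<open>auto simp: add_poly_ring zero_poly_ring carrier_poly_ring\<close>)
  have "subgroup ?J (add_monoid (poly_ring n))"
  proof (rule subgroup.intro)
    show "x \<otimes>\<^bsub>add_monoid (poly_ring n)\<^esub> z \<in> ?J" if "x \<in> ?J" "z \<in> ?J" for x z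
      using that Poly_Mapping.keys_add[of x z] carrier_add[of x n z] by (auto simp: add_poly_ring)
    show "inv\<^bsub>add_monoid (poly_ring n)\<^esub> x \<in> ?J" if "x \<in> ?J" for x
      using that neg[of x] unfolding a_inv_def[symmetric] by (auto simp: carrier_poly_ring)
  qed (auto simp: zero_poly_ring carrier_poly_ring)
  then show ?thesis
    by (rule idealI[OF R.ring_axioms]) (use mult in \<open>auto simp: mult_poly_ring mult.commute\<close>)
qed

lemma mono_ideal_eq:
  assumes "\<forall>u\<in>L. keys u \<subseteq> {1..n}"
  shows "(mono_ideal n L :: 'k::field mpoly set) = {p. p \<in> carrier (poly_ring n) \<and> (\<forall>a\<in>keys p. divisible L a)}"
proof -
  interpret R: cring "poly_ring n :: 'k mpoly ring" by (rule cring_poly_ring)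
  let ?G = "(\<lambda>a. Poly_Mapping.single a (1::'k)) ` L"
  have G: "?G \<subseteq> carrier (poly_ring n)" using assms by (simp add: image_subset_iff carrier_poly_ring)
  have id: "ideal (mono_ideal n L :: 'k mpoly set) (poly_ring n)"
    unfolding mono_ideal_def by (rule R.genideal_ideal[OF G])
  show ?thesis
  proof
    show "mono_ideal n L \<subseteq> {p :: 'k mpoly. p \<in> carrier (poly_ring n) \<and> (\<forall>a\<in>keys p. divisible L a)}"
      unfolding mono_ideal_def
    proof (rule R.genideal_minimal[OF ideal_monomial_multiples])
      have "divisible L a" if "a \<in> L" for a
        unfolding divisible_def using that by (metis add.right_neutral)
      then show "?G \<subseteq> {p. p \<in> carrier (poly_ring n) \<and> (\<forall>a\<in>keys p. divisible L a)}"
        using G by auto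
    qed
    show "{p :: 'k mpoly. p \<in> carrier (poly_ring n) \<and> (\<forall>a\<in>keys p. divisible L a)} \<subseteq> mono_ideal n L"
    proof safe
      fix p :: "'k mpoly" assume p: "p \<in> carrier (poly_ring n)" "\<forall>a\<in>keys p. divisible L a"
      have summand: "Poly_Mapping.single a (lookup p a) \<in> mono_ideal n L" if a: "a \<in> keys p" for a
      proof -
        obtain u w where u: "u \<in> L" "a = u + w" using p(2) a by (auto simp: divisible_def)
        have "keys a \<subseteq> {1..n}" using p(1) a unfolding carrier_poly_ring by blast
        then have "keys w \<subseteq> {1..n}" using u(2) by (simp add: keys_add_nat)
        then have "Poly_Mapping.single w (lookup p a) \<in> carrier (poly_ring n)"
          by (simp add: carrier_poly_ring)
        moreover have "Poly_Mapping.single u (1::'k) \<in> mono_ideal n L"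
          unfolding mono_ideal_def by (rule subsetD[OF R.genideal_self[OF G]]) (use u(1) in blast)
        ultimately have "Poly_Mapping.single w (lookup p a) * Poly_Mapping.single u 1 \<in> mono_ideal n L"
          by (rule ideal_mult[OF id])
        then show ?thesis using u(2) by (simp add: mult_single add.commute)
      qed
      have "finite K \<Longrightarrow> K \<subseteq> keys p \<Longrightarrow> (\<Sum>a\<in>K. Poly_Mapping.single a (lookup p a)) \<in> mono_ideal n L" for K
        by (induction K rule: finite_induct) (use summand in \<open>auto intro: ideal_zero[OF id] ideal_add[OF id]\<close>)
      from this[of "keys p"] show "p \<in> mono_ideal n L" by (simp add: poly_mapping_expand)
    qed
  qed
qed

lemma graded_mono_ideal:
  assumes "\<forall>u\<in>L. keys u \<subseteq> {1..n}"
  shows "graded_ideal n (mono_ideal n L :: 'k::field mpoly set)"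
proof -
  have "keys (hom_component j p) \<subseteq> keys p" for j and p :: "'k mpoly"
    by (auto simp: in_keys_iff lookup_hom_component split: if_splits)
  then show ?thesis
    unfolding graded_ideal_def mono_ideal_eq[OF assms]
    using ideal_monomial_multiples[of n L] unfolding carrier_poly_ring by blast
qed

lemma Ipart_mono_ideal:
  assumes "\<forall>u\<in>L. keys u \<subseteq> {1..n}"
  shows "Ipart n (mono_ideal n L :: 'k::field mpoly set) j = supported {a \<in> monomials n j. divisible L a}"
  unfolding Ipart_def mono_ideal_eq[OF assms]
  by (auto simp: supported_def Sd_def carrier_poly_ring monomials_def)

lemma supported_plus: "{p + q |p q. p \<in> supported A \<and> q \<in> supported B} = (supported (A \<union> B) :: ('b \<Rightarrow>\<^sub>0 'k::field) set)"
proof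
  show "{p + q |p q. p \<in> supported A \<and> q \<in> supported B} \<subseteq> (supported (A \<union> B) :: ('b \<Rightarrow>\<^sub>0 'k) set)"
  proof safe
    fix p q :: "'b \<Rightarrow>\<^sub>0 'k" assume "p \<in> supported A" "q \<in> supported B"
    then show "p + q \<in> supported (A \<union> B)"
      using Poly_Mapping.keys_add[of p q] unfolding supported_def by blast
  qed
  show "(supported (A \<union> B) :: ('b \<Rightarrow>\<^sub>0 'k) set) \<subseteq> {p + q |p q. p \<in> supported A \<and> q \<in> supported B}"
    unfolding supported_span image_Un pv.span_Un by blast
qed

lemma lookup_single_mult:
  fixes p :: "'k::field mpoly"
  shows "lookup (Poly_Mapping.single m 1 * p) (m + b) = lookup p b"
proof -
  have "Poly_Mapping.single m 1 * p = (\<Sum>a\<in>keys p. Poly_Mapping.single (m + a) (lookup p a))"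
    by (subst (1) poly_mapping_expand[of p, symmetric]) (simp add: sum_distrib_left mult_single)
  then have "lookup (Poly_Mapping.single m 1 * p) (m + b) = (\<Sum>a\<in>keys p. if a = b then lookup p a else 0)"
    by (simp add: lookup_sum lookup_single when_def)
  also have "\<dots> = lookup p b" by (simp add: in_keys_iff)
  finally show ?thesis .
qed

lemma Var_image:
  assumes "i \<in> {1..n}"
  shows "(*) (Var i) ` Sd n l = (supported {a \<in> monomials n (Suc l). i \<in> keys a} :: 'k::field mpoly set)"
proof
  let ?e = "Poly_Mapping.single i (1::nat)"
  show "(*) (Var i) ` Sd n l \<subseteq> (supported {a \<in> monomials n (Suc l). i \<in> keys a} :: 'k mpoly set)"
  proof safe
    fix p :: "'k mpoly" assume p: "p \<in> Sd n l"
    have "a \<in> monomials n (Suc l) \<and> i \<in> keys a" if a: "a \<in> keys (Var i * p)" for a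
    proof -
      obtain b where "a = ?e + b" "b \<in> keys p"
        using a keys_mult[of "Var i" p] by (auto simp: Var_def)
      then show ?thesis using p assms by (auto simp: Sd_iff monomials_def keys_add_nat mdeg_add)
    qed
    then show "Var i * p \<in> supported {a \<in> monomials n (Suc l). i \<in> keys a}" by (auto simp: supported_def)
  qed
  show "(supported {a \<in> monomials n (Suc l). i \<in> keys a} :: 'k mpoly set) \<subseteq> (*) (Var i) ` Sd n l"
    unfolding supported_span
  proof (rule pv.span_minimal)
    show "pv.subspace ((*) (Var i) ` (Sd n l :: 'k mpoly set))"
      by (rule pp.linear_subspace_image[OF linear_mult Sd_subspace])
    show "(\<lambda>a. Poly_Mapping.single a (1::'k)) ` {a \<in> monomials n (Suc l). i \<in> keys a} \<subseteq> (*) (Var i) ` Sd n l"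
    proof safe
      fix a assume a: "a \<in> monomials n (Suc l)" "i \<in> keys a"
      obtain b where b: "a = ?e + b" "mdeg a = Suc (mdeg b)" "keys b \<subseteq> keys a"
        using monomial_split[OF a(2)] .
      have "Poly_Mapping.single b (1::'k) \<in> Sd n l" using a b by (auto simp: Sd_iff monomials_def)
      moreover have "Poly_Mapping.single a (1::'k) = Var i * Poly_Mapping.single b 1"
        by (simp add: Var_def mult_single b(1))
      ultimately show "Poly_Mapping.single a (1::'k) \<in> (*) (Var i) ` Sd n l" by blast
    qed
  qed
qed

abbreviation last_vars :: "nat \<Rightarrow> nat \<Rightarrow> 'k::field mpoly" where
  "last_vars n q \<equiv> Var (n - q)"

lemma good_last_vars: "good n n (last_vars n)"
  by (rule good_Var) (auto simp: inj_on_def)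

text \<open>The monomial basis, in degree \<open>j\<close>, of the ideal generated by the last
  \<open>p\<close> variables.\<close>

definition meets :: "nat \<Rightarrow> nat \<Rightarrow> nat \<Rightarrow> (nat \<Rightarrow>\<^sub>0 nat) set" where
  "meets n p j = {a \<in> monomials n j. \<not> keys a \<subseteq> {1..n - p}}"

lemma Yd_last_vars: "p \<le> n \<Longrightarrow> Yd n (last_vars n) p j = (supported (meets n p j) :: 'k::field mpoly set)"
proof (induction p)
  case 0
  have "meets n 0 j = {}" by (auto simp: meets_def monomials_def)
  then show ?case by (simp add: supported_def)
next
  case (Suc p)
  show ?case
  proof (cases j)
    case 0
    have "meets n (Suc p) 0 = {}" by (auto simp: meets_def monomials_def)
    then show ?thesis using 0 by (simp add: supported_def)
  next
    case (Suc l)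
    have i: "n - p \<in> {1..n}" using \<open>Suc p \<le> n\<close> by auto
    have "Yd n (last_vars n) (Suc p) j =
        {a + b |a b. a \<in> supported (meets n p j) \<and> b \<in> (*) (Var (n - p)) ` (Sd n l :: 'k mpoly set)}"
      using Suc.IH Suc.prems unfolding Suc Yd_step by auto
    also have "\<dots> = supported (meets n p j \<union> {a \<in> monomials n j. n - p \<in> keys a})"
      unfolding Var_image[OF i] Suc by (rule supported_plus)
    also have "meets n p j \<union> {a \<in> monomials n j. n - p \<in> keys a} = meets n (Suc p) j"
    proof -
      have "keys a \<subseteq> {1..n - Suc p} \<longleftrightarrow> keys a \<subseteq> {1..n - p} \<and> n - p \<notin> keys a" for a :: "nat \<Rightarrow>\<^sub>0 nat"
      proof -
        have "{1..n - p} = insert (n - p) {1..n - Suc p}" "n - p \<notin> {1..n - Suc p}"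
          using \<open>Suc p \<le> n\<close> by auto
        then show ?thesis by auto
      qed
      then show ?thesis by (auto simp: meets_def)
    qed
    finally show ?thesis .
  qed
qed

lemma IY_last_vars:
  assumes "\<forall>u\<in>L. keys u \<subseteq> {1..n}" "p \<le> n"
  shows "IY n (last_vars n) (mono_ideal n L) p j =
    (supported (meets n p j \<union> {a \<in> monomials n j. divisible L a}) :: 'k::field mpoly set)"
  unfolding IY_def Yd_last_vars[OF assms(2)] Ipart_mono_ideal[OF assms(1)] by (rule supported_plus)

text \<open>As \<open>v\<close> involves only variables up to \<open>r\<close>, the factor exchanged
  is the largest variable of the monomial: stability in the sense of Eliahou and Kervaire.\<close>

definition stable :: "(nat \<Rightarrow>\<^sub>0 nat) set \<Rightarrow> bool" where
  "stable L \<longleftrightarrow> (\<forall>r i v. Poly_Mapping.single r 1 + v \<in> L \<longrightarrow> keys v \<subseteq> {1..r} \<longrightarrow> 1 \<le> i \<longrightarrow> i < r \<longrightarrow>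
    Poly_Mapping.single i 1 + v \<in> L)"

text \<open>Write x_r b = v w with \<open>v\<close> in \<open>L\<close>. If x_r divides
  \<open>w\<close>, it cancels; otherwise it is the largest variable of \<open>v\<close> and can be
  exchanged for a variable of \<open>w\<close>, which exists because \<open>b\<close> has degree at
  least \<open>d\<close>.\<close>

lemma stable_colon:
  assumes L: "L \<subseteq> monomials n d" "stable L" and b: "d \<le> mdeg b" "keys b \<subseteq> {1..r}"
    and div: "divisible L (Poly_Mapping.single r 1 + b)"
  shows "divisible L b"
proof -
  let ?e = "\<lambda>i. Poly_Mapping.single i (1::nat)"
  obtain v w where v: "v \<in> L" "?e r + b = v + w" using div by (auto simp: divisible_def)
  have sub: "keys v \<union> keys w \<subseteq> {1..r} \<union> {r}"
    using b(2) keys_add_nat[of "?e r" b] keys_add_nat[of v w] v(2) by auto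
  show ?thesis
  proof (cases "r \<in> keys w")
    case True
    then obtain w' where "w = ?e r + w'" using monomial_split by metis
    then have "b = v + w'" using v(2) by (simp add: add.left_commute[of v])
    then show ?thesis using v(1) by (auto simp: divisible_def)
  next
    case False
    have "r \<in> keys (v + w)" unfolding v(2)[symmetric] by (simp add: keys_add_nat)
    then have "r \<in> keys v" using False by (simp add: keys_add_nat)
    then obtain v' where v': "v = ?e r + v'" "keys v' \<subseteq> keys v" using monomial_split by metis
    then have bv: "b = v' + w" using v(2) by (simp add: add.assoc)
    have "mdeg v = d" using v(1) L(1) by (auto simp: monomials_def)
    then have "d = Suc (mdeg v')" by (simp add: v' mdeg_add)
    then have "w \<noteq> 0" using b(1) by (auto simp: bv mdeg_add)
    then obtain i where i: "i \<in> keys w" by (metis keys_eq_empty ex_in_conv)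
    then obtain w' where w': "w = ?e i + w'" using monomial_split by metis
    have "keys v \<subseteq> {1..n}" using v(1) L(1) unfolding monomials_def by blast
    then have "r \<noteq> 0" using \<open>r \<in> keys v\<close> by auto
    then have sub': "keys v \<union> keys w \<subseteq> {1..r}" using sub by auto
    then have "i \<in> {1..r}" using i by blast
    moreover have "i \<noteq> r" using i False by blast
    ultimately have "1 \<le> i" "i < r" by auto
    moreover have "keys v' \<subseteq> {1..r}" using v' sub' by blast
    ultimately have "?e i + v' \<in> L"
      using L(2) v(1) v'(1) unfolding stable_def by blast
    moreover have "b = (?e i + v') + w'" by (simp add: bv w' ac_simps)
    ultimately show ?thesis unfolding divisible_def by blast
  qed
qed

text \<open>All spaces are spanned by monomials, and a monomial outside the ideal of the last
  \<open>p\<close> variables has no variable beyond \<open>n - p\<close>, so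
  \<open>stable_colon\<close> applies with \<open>r = n - p\<close>.\<close>

lemma colon_at_stable:
  assumes L: "L \<subseteq> monomials n d" "stable L" and p: "p < n" and j: "d \<le> j"
  shows "colon_at n (last_vars n) (mono_ideal n L :: 'k::field mpoly set) p j"
  unfolding colon_at_def
proof (intro ballI impI)
  fix u :: "'k mpoly" assume u: "u \<in> Sd n j" and vu: "Var (n - p) * u \<in> IY n (last_vars n) (mono_ideal n L) p (Suc j)"
  have Lk: "\<forall>u\<in>L. keys u \<subseteq> {1..n}" using L(1) unfolding monomials_def by blast
  let ?e = "Poly_Mapping.single (n - p) (1::nat)"
  have "b \<in> meets n p j \<union> {a \<in> monomials n j. divisible L a}" if b: "b \<in> keys u" for b
  proof -
    have bm: "b \<in> monomials n j" using u b by (auto simp: Sd_iff monomials_def)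
    have "?e + b \<in> keys (Var (n - p) * u)"
      using b by (simp add: in_keys_iff Var_def lookup_single_mult)
    then have eb: "?e + b \<in> meets n p (Suc j) \<or> divisible L (?e + b)"
      using vu unfolding IY_last_vars[OF Lk less_imp_le[OF p]] by (auto simp: supported_def)
    show ?thesis
    proof (cases "keys b \<subseteq> {1..n - p}")
      case True
      then have "?e + b \<notin> meets n p (Suc j)" using p by (auto simp: meets_def keys_add_nat)
      then have "divisible L b"
        using stable_colon[OF L _ True] eb bm j by (auto simp: monomials_def)
      then show ?thesis using bm by blast
    qed (use bm in \<open>auto simp: meets_def\<close>)
  qed
  then show "u \<in> IY n (last_vars n) (mono_ideal n L) p j"
    unfolding IY_last_vars[OF Lk less_imp_le[OF p]] by (auto simp: supported_def)
qed

lemma divisible_same_degree: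
  assumes "L \<subseteq> monomials n d"
  shows "{a \<in> monomials n d. divisible L a} = L"
proof -
  have "a \<in> L" if a: "mdeg a = d" "divisible L a" for a
  proof -
    obtain u w where u: "u \<in> L" "a = u + w" using a by (auto simp: divisible_def)
    then have "mdeg w = 0" using a assms by (auto simp: monomials_def mdeg_add)
    then show ?thesis using u by simp
  qed
  moreover have "divisible L a" if "a \<in> L" for a
    unfolding divisible_def using that by (metis add.right_neutral)
  ultimately show ?thesis using assms by (auto simp: monomials_def)
qed

lemma mono_ideal_start:
  assumes "L \<subseteq> monomials n d"
  shows "\<forall>j<d. Ipart n (mono_ideal n L :: 'k::field mpoly set) j = {0}"
proof (intro allI impI)
  fix j assume j: "j < d"
  have none: "{a \<in> monomials n j. divisible L a} = {}"
    using assms j by (fastforce simp: divisible_def monomials_def mdeg_add)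
  have Lk: "\<forall>u\<in>L. keys u \<subseteq> {1..n}" using assms unfolding monomials_def by blast
  show "Ipart n (mono_ideal n L :: 'k mpoly set) j = {0}"
    unfolding Ipart_mono_ideal[OF Lk] none by (simp add: supported_def)
qed

lemma restr_dim_mono_ideal:
  assumes L: "L \<subseteq> monomials n d" and p: "p \<le> n"
  shows "restr_dim n (last_vars n) (mono_ideal n L :: 'k::field mpoly set) p d = int (card (L \<inter> monomials (n - p) d))"
proof -
  have Lk: "\<forall>u\<in>L. keys u \<subseteq> {1..n}" using L unfolding monomials_def by blast
  have fin: "finite (meets n p d)" "finite L"
    using finite_subset[OF L] by (auto simp: meets_def)
  have eq: "L \<inter> monomials (n - p) d = L - meets n p d" using L by (auto simp: meets_def monomials_def)
  have "card (meets n p d \<union> L) = card (meets n p d) + card (L - meets n p d)"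
    using fin card_Un_disjoint[of "meets n p d" "L - meets n p d"] by (simp add: Un_Diff_cancel)
  then show ?thesis
    unfolding restr_dim_def IY_last_vars[OF Lk p] Yd_last_vars[OF p] divisible_same_degree[OF L]
    using fin by (simp add: supported_dim eq)
qed

section \<open>Lexicographic and reverse lexicographic segments\<close>

locale strict_order =
  fixes gt :: "'a \<Rightarrow> 'a \<Rightarrow> bool" and S :: "'a set"
  assumes fin: "finite S" and irrefl: "\<not> gt a a"
    and trans: "a \<in> S \<Longrightarrow> b \<in> S \<Longrightarrow> c \<in> S \<Longrightarrow> gt a b \<Longrightarrow> gt b c \<Longrightarrow> gt a c"
    and total: "a \<in> S \<Longrightarrow> b \<in> S \<Longrightarrow> a \<noteq> b \<Longrightarrow> gt a b \<or> gt b a"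
begin

definition rank where "rank a = card {b \<in> S. gt b a}"

lemma rank_less: "a \<in> S \<Longrightarrow> b \<in> S \<Longrightarrow> gt a b \<Longrightarrow> rank a < rank b"
proof -
  assume ab: "a \<in> S" "b \<in> S" "gt a b"
  have "{c \<in> S. gt c a} \<subset> {c \<in> S. gt c b}" using ab irrefl[of a] trans[of _ a b] by blast
  then show ?thesis unfolding rank_def by (intro psubset_card_mono) (simp add: fin)
qed

text \<open>\<open>rank\<close> maps \<open>S\<close> bijectively onto the numbers below
  \<open>card S\<close>.\<close>

lemma card_top: "card {a \<in> S. rank a < k} = min k (card S)"
proof -
  have inj: "inj_on rank S"
    by (rule inj_onI) (metis rank_less total less_irrefl)
  have "rank a < card S" if "a \<in> S" for a
    unfolding rank_def by (rule psubset_card_mono[OF fin]) (use that irrefl in blast)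
  then have "rank ` S \<subseteq> {..<card S}" by auto
  moreover have "card (rank ` S) = card {..<card S}" using card_image[OF inj] by simp
  ultimately have img: "rank ` S = {..<card S}" by (intro card_subset_eq) auto
  have "rank ` {a \<in> S. rank a < k} = rank ` S \<inter> {..<k}" by auto
  also have "\<dots> = {..<min k (card S)}" using img by auto
  finally have "card (rank ` {a \<in> S. rank a < k}) = min k (card S)" by simp
  then show ?thesis using card_image[OF inj_on_subset[OF inj, of "{a \<in> S. rank a < k}"]] by simp
qed

lemma top_upward: "a \<in> S \<Longrightarrow> rank a < k \<Longrightarrow> b \<in> S \<Longrightarrow> gt b a \<Longrightarrow> rank b < k"
  using rank_less less_trans by blast

text \<open>Upward closed subsets of a totally ordered set are nested.\<close>

lemma upward_unique:
  assumes U: "U \<subseteq> S" "\<And>a b. a \<in> U \<Longrightarrow> b \<in> S \<Longrightarrow> gt b a \<Longrightarrow> b \<in> U"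
    and V: "V \<subseteq> S" "\<And>a b. a \<in> V \<Longrightarrow> b \<in> S \<Longrightarrow> gt b a \<Longrightarrow> b \<in> V" and card: "card U = card V"
  shows "U = V"
proof -
  have "U \<subseteq> V \<or> V \<subseteq> U" using U V total by blast
  then show ?thesis
    using card card_subset_eq[of V U] card_subset_eq[of U V] finite_subset[OF U(1) fin] finite_subset[OF V(1) fin] by auto
qed

end

lemma lex_strict_order: "strict_order lex_greater (monomials n d)"
proof
  show "lex_greater a c" if abc: "a \<in> monomials n d" "b \<in> monomials n d" "c \<in> monomials n d" "lex_greater a b" "lex_greater b c" for a b c
  proof -
    obtain r where r: "lookup b r < lookup a r" "\<forall>s<r. lookup a s = lookup b s"
      using abc by (auto simp: lex_greater_def monomials_def)
    obtain r' where r': "lookup c r' < lookup b r'" "\<forall>s<r'. lookup b s = lookup c s"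
      using abc by (auto simp: lex_greater_def monomials_def)
    have "lookup c (min r r') < lookup a (min r r') \<and> (\<forall>s<min r r'. lookup a s = lookup c s)"
      using r r' by (cases r r' rule: linorder_cases) (auto simp: min_def)
    then show ?thesis using abc by (auto simp: lex_greater_def monomials_def)
  qed
  show "lex_greater a b \<or> lex_greater b a" if ab: "a \<in> monomials n d" "b \<in> monomials n d" "a \<noteq> b" for a b
  proof -
    obtain r0 where r0: "lookup a r0 \<noteq> lookup b r0" using ab(3) poly_mapping_eqI[of a b] by blast
    define r where "r = (LEAST r. lookup a r \<noteq> lookup b r)"
    have r: "lookup a r \<noteq> lookup b r" unfolding r_def by (rule LeastI[of _ r0]) (rule r0)
    have below: "\<forall>s<r. lookup a s = lookup b s" using not_less_Least unfolding r_def by blast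
    have "mdeg a = mdeg b" using ab by (simp add: monomials_def)
    show ?thesis
    proof (cases "lookup a r < lookup b r")
      case True
      then have "lex_greater b a"
        unfolding lex_greater_def using below \<open>mdeg a = mdeg b\<close> by (intro disjI2 conjI exI[of _ r]) simp_all
      then show ?thesis ..
    next
      case False
      then have "lex_greater a b"
        unfolding lex_greater_def using r below \<open>mdeg a = mdeg b\<close> by (intro disjI2 conjI exI[of _ r]) simp_all
      then show ?thesis ..
    qed
  qed
qed (auto simp: lex_greater_def)

lemma rlex_strict_order: "strict_order rlex_greater (monomials n d)"
proof
  show "rlex_greater a c" if abc: "a \<in> monomials n d" "b \<in> monomials n d" "c \<in> monomials n d" "rlex_greater a b" "rlex_greater b c" for a b c
  proof -
    obtain r where r: "lookup a r < lookup b r" "\<forall>s>r. lookup a s = lookup b s"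
      using abc by (auto simp: rlex_greater_def monomials_def)
    obtain r' where r': "lookup b r' < lookup c r'" "\<forall>s>r'. lookup b s = lookup c s"
      using abc by (auto simp: rlex_greater_def monomials_def)
    have "lookup a (max r r') < lookup c (max r r') \<and> (\<forall>s>max r r'. lookup a s = lookup c s)"
      using r r' by (cases r r' rule: linorder_cases) (auto simp: max_def)
    then show ?thesis using abc by (auto simp: rlex_greater_def monomials_def)
  qed
  show "rlex_greater a b \<or> rlex_greater b a" if "a \<in> monomials n d" "b \<in> monomials n d" "a \<noteq> b" for a b
  proof -
    define E where "E = {r. lookup a r \<noteq> lookup b r}"
    have "E \<subseteq> keys a \<union> keys b" by (auto simp: E_def in_keys_iff)
    then have fin: "finite E" by (rule finite_subset) simp
    have "E \<noteq> {}"
    proof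
      assume "E = {}"
      then have "a = b" by (intro poly_mapping_eqI) (auto simp: E_def)
      then show False using that(3) by simp
    qed
    define r where "r = Max E"
    have "r \<in> E" unfolding r_def using fin \<open>E \<noteq> {}\<close> by simp
    then have r: "lookup a r \<noteq> lookup b r" by (simp add: E_def)
    have above: "\<forall>s>r. lookup a s = lookup b s"
      using Max_ge[OF fin] unfolding r_def by (auto simp: E_def not_le[symmetric])
    have "mdeg a = mdeg b" using that by (simp add: monomials_def)
    show ?thesis
    proof (cases "lookup a r < lookup b r")
      case True
      then have "rlex_greater a b"
        unfolding rlex_greater_def using above \<open>mdeg a = mdeg b\<close> by (intro disjI2 conjI exI[of _ r]) simp_all
      then show ?thesis ..
    next
      case False
      then have "rlex_greater b a"
        unfolding rlex_greater_def using r above \<open>mdeg a = mdeg b\<close> by (intro disjI2 conjI exI[of _ r]) simp_all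
      then show ?thesis ..
    qed
  qed
qed (auto simp: rlex_greater_def)

lemma lex_exchange:
  assumes "i < r" shows "lex_greater (Poly_Mapping.single i 1 + v) (Poly_Mapping.single r 1 + v)"
  unfolding lex_greater_def
  by (intro disjI2 conjI exI[of _ i] allI impI) (use assms in \<open>auto simp: mdeg_add lookup_add lookup_single\<close>)

lemma rlex_exchange:
  assumes "i < r" shows "rlex_greater (Poly_Mapping.single i 1 + v) (Poly_Mapping.single r 1 + v)"
  unfolding rlex_greater_def
  by (intro disjI2 conjI exI[of _ r] allI impI) (use assms in \<open>auto simp: mdeg_add lookup_add lookup_single\<close>)

lemma largest_subset: "largest_monomials gt n d k \<subseteq> monomials n d"
  by (auto simp: largest_monomials_def)

lemma largest_stable:
  assumes "strict_order gt (monomials n d)"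
    and ex: "\<And>i r v. i < r \<Longrightarrow> gt (Poly_Mapping.single i 1 + v) (Poly_Mapping.single r 1 + v)"
  shows "stable (largest_monomials gt n d k)"
  unfolding stable_def
proof (intro allI impI)
  interpret strict_order gt "monomials n d" by fact
  fix r i v assume v: "Poly_Mapping.single r 1 + v \<in> largest_monomials gt n d k" "1 \<le> i" "i < r"
  then have m: "Poly_Mapping.single r 1 + v \<in> monomials n d" and rk: "rank (Poly_Mapping.single r 1 + v) < k"
    by (auto simp: largest_monomials_def rank_def)
  have m': "Poly_Mapping.single i 1 + v \<in> monomials n d"
    using m v by (auto simp: monomials_def keys_add_nat mdeg_add)
  then show "Poly_Mapping.single i 1 + v \<in> largest_monomials gt n d k"
    using top_upward[OF m rk m' ex[OF v(3)]] by (simp add: largest_monomials_def rank_def)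
qed

lemma card_largest:
  assumes "strict_order gt (monomials n d)" "k \<le> card (monomials n d)"
  shows "card (largest_monomials gt n d k) = k"
proof -
  interpret strict_order gt "monomials n d" by fact
  show ?thesis using card_top[of k] assms(2) by (simp add: largest_monomials_def rank_def)
qed

text \<open>At the last index where they differ, a larger monomial has the smaller exponent, so it
  introduces no later variable: \<open>monomials m d\<close> is itself a segment, and of two
  segments one contains the other.\<close>

lemma card_rlex_restriction:
  assumes "m \<le> n"
  shows "card (largest_monomials rlex_greater n d k \<inter> monomials m d) = min k (card (monomials m d))"
proof -
  interpret strict_order rlex_greater "monomials m d" by (rule rlex_strict_order)
  have sub: "monomials m d \<subseteq> monomials n d" using assms by (auto simp: monomials_def)
  have up: "b \<in> monomials m d" if a: "a \<in> monomials m d" and b: "b \<in> monomials n d" "rlex_greater b a" for a b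
  proof -
    obtain r where r: "lookup b r < lookup a r" "\<forall>s>r. lookup b s = lookup a s"
      using a b by (auto simp: rlex_greater_def monomials_def)
    have "r \<in> keys a" using r(1) by (auto simp: in_keys_iff)
    then have "r \<le> m" using a by (auto simp: monomials_def)
    have "s \<le> m" if "s \<in> keys b" for s
    proof (rule ccontr)
      assume "\<not> s \<le> m"
      then have "s \<in> keys a" using r(2) \<open>r \<le> m\<close> that by (auto simp: in_keys_iff)
      then show False using a \<open>\<not> s \<le> m\<close> by (auto simp: monomials_def)
    qed
    then show ?thesis using b by (auto simp: monomials_def)
  qed
  have "largest_monomials rlex_greater n d k \<inter> monomials m d = {a \<in> monomials m d. rank a < k}"
  proof -
    have "{b \<in> monomials n d. rlex_greater b a} = {b \<in> monomials m d. rlex_greater b a}" if "a \<in> monomials m d" for a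
      using up[OF that] sub by blast
    then show ?thesis using sub by (auto simp: largest_monomials_def rank_def)
  qed
  then show ?thesis by (simp add: card_top)
qed

lemma sorted_take_upward:
  assumes "sorted_wrt gt xs" "\<And>a b. gt a b \<Longrightarrow> \<not> gt b a" "a \<in> set (take k xs)" "b \<in> set xs" "gt b a"
  shows "b \<in> set (take k xs)"
proof -
  have "xs = take k xs @ drop k xs" by simp
  then have "\<forall>x\<in>set (take k xs). \<forall>z\<in>set (drop k xs). gt x z"
    using assms(1) by (metis sorted_wrt_append)
  moreover have "b \<in> set (take k xs) \<or> b \<in> set (drop k xs)"
    using assms(4) by (metis Un_iff append_take_drop_id set_append)
  ultimately show ?thesis using assms by blast
qed

text \<open>The segment meets the monomials in \<open>Suc m\<close> variables in an initial part of
  their own list, and \<open>wd\<close> records which of those avoid the last variable.\<close>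

lemma card_lex_restriction:
  assumes "Suc m \<le> n"
  shows "card (largest_monomials lex_greater n d k \<inter> monomials m d) =
    lexr (Suc m) d (card (largest_monomials lex_greater n d k \<inter> monomials (Suc m) d))"
proof -
  interpret N: strict_order lex_greater "monomials n d" by (rule lex_strict_order)
  interpret strict_order lex_greater "monomials (Suc m) d" by (rule lex_strict_order)
  let ?L = "largest_monomials lex_greater n d k" and ?xs = "lexmons 1 (Suc m) d"
  define \<mu> where "\<mu> = card (?L \<inter> monomials (Suc m) d)"
  have sub: "monomials (Suc m) d \<subseteq> monomials n d" using assms by (auto simp: monomials_def)
  have xs: "set ?xs = monomials (Suc m) d" by (rule lexmons_monomials)
  have len: "length ?xs = card (monomials (Suc m) d)"
    using distinct_card[OF distinct_lexmons] xs by metis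
  have "\<mu> \<le> length ?xs" unfolding \<mu>_def len by (rule card_mono) auto
  then have card_take: "card (set (take \<mu> ?xs)) = \<mu>"
    using distinct_card[OF distinct_take[OF distinct_lexmons, of \<mu> 1 "Suc m" d]] by simp
  have asym: "\<not> lex_greater b a" if "lex_greater a b" for a b
    using that by (auto simp: lex_greater_def) (metis less_asym linorder_neqE_nat)
  have "?L \<inter> monomials (Suc m) d = set (take \<mu> ?xs)"
  proof (rule upward_unique)
    show "b \<in> ?L \<inter> monomials (Suc m) d"
      if "a \<in> ?L \<inter> monomials (Suc m) d" "b \<in> monomials (Suc m) d" "lex_greater b a" for a b
      using that sub N.top_upward[of a k b] by (auto simp: largest_monomials_def N.rank_def)
    show "b \<in> set (take \<mu> ?xs)" if "a \<in> set (take \<mu> ?xs)" "b \<in> monomials (Suc m) d" "lex_greater b a" for a b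
      using sorted_take_upward[OF sorted_lexmons asym that(1) _ that(3)] that(2) xs by blast
    show "set (take \<mu> ?xs) \<subseteq> monomials (Suc m) d" using set_take_subset xs by metis
    show "card (?L \<inter> monomials (Suc m) d) = card (set (take \<mu> ?xs))" using card_take by (simp add: \<mu>_def)
  qed auto
  moreover have "?L \<inter> monomials m d = {u \<in> ?L \<inter> monomials (Suc m) d. Suc m \<notin> keys u}"
  proof -
    have "monomials m d = {u \<in> monomials (Suc m) d. Suc m \<notin> keys u}"
      by (auto simp: monomials_def subset_iff) (metis le_SucE)
    then show ?thesis by auto
  qed
  ultimately have "?L \<inter> monomials m d = set (filter (\<lambda>u. Suc m \<notin> keys u) (take \<mu> ?xs))" by auto
  then have "card (?L \<inter> monomials m d) = length (filter (\<lambda>u. Suc m \<notin> keys u) (take \<mu> ?xs))"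
    using distinct_card[OF distinct_filter[OF distinct_take[OF distinct_lexmons]]] by metis
  also have "\<dots> = length (filter id (map (\<lambda>u. Suc m \<notin> keys u) (take \<mu> ?xs)))"
    by (simp add: filter_map comp_def)
  also have "\<dots> = lexr (Suc m) d \<mu>"
    using map_lexmons[of 1 m d] by (simp add: lexr_def trues_def take_map[symmetric])
  finally show ?thesis by (simp add: \<mu>_def)
qed

section \<open>Extremal Betti numbers\<close>

text \<open>Summation by parts: of two sequences with the same ends, the smaller one falls earlier,
  where the weights are larger. The partial sums carry a boundary term that vanishes at
  \<open>n\<close>.\<close>

lemma weighted_sum_mono:
  fixes f g :: "nat \<Rightarrow> int" and w :: "nat \<Rightarrow> int"
  assumes "f 0 = g 0" "f n = g n" "\<And>q. q \<le> n \<Longrightarrow> f q \<le> g q" "\<And>q. q < n \<Longrightarrow> w (Suc q) \<le> w q"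
  shows "(\<Sum>q<n. (g q - g (Suc q)) * w q) \<le> (\<Sum>q<n. (f q - f (Suc q)) * w q)"
proof -
  have "(\<Sum>q<m. (g q - g (Suc q)) * w q) + (g m - f m) * w m \<le> (\<Sum>q<m. (f q - f (Suc q)) * w q)" if "m \<le> n" for m
    using that
  proof (induction m)
    case (Suc m)
    have "(g (Suc m) - f (Suc m)) * w (Suc m) \<le> (g (Suc m) - f (Suc m)) * w m"
      using assms(3)[of "Suc m"] assms(4)[of m] Suc.prems by (intro mult_left_mono) auto
    then show ?case using Suc by (simp add: algebra_simps)
  qed (simp add: assms(1))
  from this[of n] show ?thesis using assms(2) by simp
qed

lemma restr_dim_0: "restr_dim n y I 0 d = int (pv.dim (Ipart n I d))"
proof -
  have "IY n y I 0 d = Ipart n I d" by (auto simp: IY_def)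
  then show ?thesis by (simp add: restr_dim_def)
qed

lemma restr_dim_full:
  assumes "graded_ideal n I" "good n n y" "0 < d"
  shows "restr_dim n y I n d = 0"
proof -
  obtain e where e: "d = Suc e" using assms(3) by (cases d) auto
  have "IY n y I n d = Yd n y n d"
    using Yd_subset_IY[OF assms(1), of y n d] IY_subset_Sd[OF goodD[OF assms(2)], of I d] good_full_all[OF assms(2), of e] e
    by blast
  then show ?thesis by (simp add: restr_dim_def)
qed

lemma restr_dim_upper:
  assumes I: "graded_ideal n I" and y: "good n p y" "p \<le> n"
  shows "restr_dim n y I p d \<le> restr_dim n y I 0 d" "restr_dim n y I p d \<le> int (card (monomials (n - p) d))"
proof -
  have fd: "pv.fdim (Ipart n I d)" by (rule pv.fdim_subset[OF Sd_fdim[of n d]]) (simp add: Ipart_def)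
  have "pv.dim (IY n y I p d) \<le> pv.dim (Yd n y p d) + pv.dim (Ipart n I d)"
    using pv.dim_sum_inter[OF fd graded_Ipart_subspace[OF I] good_Yd_fdim[OF y(1), of d] Yd_subspace]
    by (simp add: IY_def)
  then show "restr_dim n y I p d \<le> restr_dim n y I 0 d"
    unfolding restr_dim_0 by (simp add: restr_dim_def)
  have "pv.dim (IY n y I p d) \<le> length (wd n d)"
    using pv.dim_mono'[OF Sd_fdim Sd_subspace IY_subset_Sd[OF goodD[OF y(1)]], of I d] by (simp add: Sd_dim)
  then show "restr_dim n y I p d \<le> int (card (monomials (n - p) d))"
    using good_dim_all[OF y, of d] by (simp add: restr_dim_def card_monomials)
qed

lemma strand_weights_decreasing: "int ((n - 1 - Suc q) choose i) \<le> int ((n - 1 - q) choose i)"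
  using binomial_right_mono[of "n - 1 - Suc q" "n - 1 - q" i] by simp

text \<open>For \<open>i = 0\<close> all binomials are 1 and the strand formula telescopes.\<close>

lemma strand_rank:
  assumes "graded_ideal n I" "good n n y" "0 < d" "\<forall>j<d. Ipart n I j = {0}"
    and "\<forall>p<n. colon_at n y I p d"
  shows "int (betti n I 0 d) = restr_dim n y I 0 d"
proof -
  have "(\<Sum>q<m. restr_dim n y I q d - restr_dim n y I (Suc q) d) = restr_dim n y I 0 d - restr_dim n y I m d" for m
    by (induction m) auto
  then show ?thesis
    using betti_strand[OF assms, of 0] restr_dim_full[OF assms(1-3)] by simp
qed

lemma betti_compare:
  assumes I: "graded_ideal n I" "good n n y" "\<forall>j<d. Ipart n I j = {0}" "\<forall>p<n. colon_at n y I p d"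
    and J: "graded_ideal n J" "good n n z" "\<forall>j<d. Ipart n J j = {0}" "\<forall>p<n. colon_at n z J p d"
    and d: "0 < d" and eq: "betti n I 0 d = betti n J 0 d"
    and le: "\<And>p. p \<le> n \<Longrightarrow> restr_dim n y I p d \<le> restr_dim n z J p d"
    and off: "\<And>i j. j \<noteq> i + d \<Longrightarrow> betti n J i j = 0"
  shows "betti n J \<le> betti n I"
proof (rule le_funI, rule le_funI)
  fix i j
  show "betti n J i j \<le> betti n I i j"
  proof (cases "j = i + d")
    case True
    have "int (betti n J i (i + d)) \<le> int (betti n I i (i + d))"
      unfolding betti_strand[OF I(1,2) d I(3,4)] betti_strand[OF J(1,2) d J(3,4)]
    proof (rule weighted_sum_mono)
      show "restr_dim n y I 0 d = restr_dim n z J 0 d"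
        using strand_rank[OF I(1,2) d I(3,4)] strand_rank[OF J(1,2) d J(3,4)] eq by simp
      show "restr_dim n y I n d = restr_dim n z J n d"
        using restr_dim_full[OF I(1,2) d] restr_dim_full[OF J(1,2) d] by simp
    qed (use le strand_weights_decreasing in auto)
    then show ?thesis using True by simp
  qed (simp add: off)
qed

text \<open>\<open>has_linear_resolution\<close> speaks of degrees \<open>i + j\<close> only.
  Degrees below the strand, including those below \<open>i\<close>, are covered by the vanishing of
  the ideal below \<open>d\<close>, with an empty range of colon conditions.\<close>

lemma linear_betti_off:
  assumes "graded_ideal n I" "has_linear_resolution n d I" "0 < d" "j \<noteq> i + d"
  shows "betti n I i j = 0"
proof (cases "j < i + d")
  case True
  obtain y :: "nat \<Rightarrow> 'a mpoly" where y: "good n n y" by (rule good_exists)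
  show ?thesis
    by (rule betti_off_strand[OF assms(1) y assms(3), where R = d])
      (use linear_resolution_start[OF assms(1,2)] True in auto)
next
  case False
  then have "j - i \<noteq> d" "j = i + (j - i)" using assms(4) by auto
  then show ?thesis using assms(2) unfolding has_linear_resolution_def by metis
qed

lemma exchange_properties:
  shows "\<forall>i r v. i < r \<longrightarrow> rlex_greater (Poly_Mapping.single i 1 + v) (Poly_Mapping.single r 1 + v)"
    and "\<forall>i r v. i < r \<longrightarrow> lex_greater (Poly_Mapping.single i 1 + v) (Poly_Mapping.single r 1 + v)"
  using rlex_exchange lex_exchange by blast+

lemma segment_properties:
  fixes gt :: "(nat \<Rightarrow>\<^sub>0 nat) \<Rightarrow> (nat \<Rightarrow>\<^sub>0 nat) \<Rightarrow> bool"
  assumes order: "strict_order gt (monomials n d)"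
    and ex: "\<forall>i r v. i < r \<longrightarrow> gt (Poly_Mapping.single i 1 + v) (Poly_Mapping.single r 1 + v)"
    and d: "0 < d" and k: "k \<le> card (monomials n d)"
  defines "L \<equiv> largest_monomials gt n d k"
  shows segment_graded: "graded_ideal n (mono_ideal n L :: 'k::field mpoly set)"
    and segment_start: "\<forall>j<d. Ipart n (mono_ideal n L :: 'k mpoly set) j = {0}"
    and segment_colon: "\<forall>p<n. colon_at n (last_vars n) (mono_ideal n L :: 'k mpoly set) p d"
    and segment_off: "\<And>i j. j \<noteq> i + d \<Longrightarrow> betti n (mono_ideal n L :: 'k mpoly set) i j = 0"
    and segment_rank: "betti n (mono_ideal n L :: 'k mpoly set) 0 d = k"
    and segment_restr: "\<And>p. p \<le> n \<Longrightarrow>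
      restr_dim n (last_vars n) (mono_ideal n L :: 'k mpoly set) p d = int (card (L \<inter> monomials (n - p) d))"
proof -
  have Lm: "L \<subseteq> monomials n d" unfolding L_def by (rule largest_subset)
  then have Lk: "\<forall>u\<in>L. keys u \<subseteq> {1..n}" unfolding monomials_def by blast
  have st: "stable L" unfolding L_def by (rule largest_stable[OF order]) (use ex in blast)
  show g: "graded_ideal n (mono_ideal n L :: 'k mpoly set)" by (rule graded_mono_ideal[OF Lk])
  show s: "\<forall>j<d. Ipart n (mono_ideal n L :: 'k mpoly set) j = {0}" by (rule mono_ideal_start[OF Lm])
  have col: "colon_at n (last_vars n) (mono_ideal n L :: 'k mpoly set) p j" if "p < n" "d \<le> j" for p j
    by (rule colon_at_stable[OF Lm st that])
  then show c: "\<forall>p<n. colon_at n (last_vars n) (mono_ideal n L :: 'k mpoly set) p d" by simp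
  show "betti n (mono_ideal n L :: 'k mpoly set) i j = 0" if "j \<noteq> i + d" for i j
    by (rule betti_off_strand[OF g good_last_vars d s, where R = j]) (use col that in auto)
  show r: "restr_dim n (last_vars n) (mono_ideal n L :: 'k mpoly set) p d = int (card (L \<inter> monomials (n - p) d))"
    if "p \<le> n" for p by (rule restr_dim_mono_ideal[OF Lm that])
  have "int (betti n (mono_ideal n L :: 'k mpoly set) 0 d) = int (card (L \<inter> monomials n d))"
    using strand_rank[OF g good_last_vars d s c] r[of 0] by simp
  moreover have "L \<inter> monomials n d = L" using Lm by blast
  ultimately show "betti n (mono_ideal n L :: 'k mpoly set) 0 d = k"
    using card_largest[OF order k] by (simp add: L_def)
qed

lemma betti_bounds:
  fixes I :: "'k::field mpoly set"
  assumes inf: "infinite (UNIV :: 'k set)" and d: "0 < d" and k: "k \<le> card (monomials n d)"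
    and I: "graded_ideal n I" "has_linear_resolution n d I" "betti n I 0 d = k"
  shows "betti n (rlex_ideal n d k :: 'k mpoly set) \<le> betti n I" "betti n I \<le> betti n (lex_ideal n d k :: 'k mpoly set)"
proof -
  \<comment> \<open>The range \<open>Suc d\<close> suffices, as the strand formula uses the colon
    condition in degree \<open>d\<close> alone.\<close>
  obtain y where y: "good n n y" "\<forall>q<n. colon_at n y I q d"
      "\<And>q. q < n \<Longrightarrow> int (lexr (n - q) d (nat (restr_dim n y I q d))) \<le> restr_dim n y I (Suc q) d"
    using generic_flag[OF inf I(1,2) d, of n "Suc d"] by auto
  have start: "\<forall>j<d. Ipart n I j = {0}" using linear_resolution_start[OF I(1,2)] by blast
  have off: "betti n I i j = 0" if "j \<noteq> i + d" for i j by (rule linear_betti_off[OF I(1,2) d that])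
  have rank: "restr_dim n y I 0 d = int k" using strand_rank[OF I(1) y(1) d start y(2)] I(3) by simp
  note R = segment_properties[where 'k = 'k, OF rlex_strict_order exchange_properties(1) d k]
  note L = segment_properties[where 'k = 'k, OF lex_strict_order exchange_properties(2) d k]
  show "betti n (rlex_ideal n d k :: 'k mpoly set) \<le> betti n I"
    unfolding rlex_ideal_def mono_ideal_def[symmetric]
  proof (rule betti_compare[OF I(1) y(1) start y(2) R(1) good_last_vars R(2,3) d])
    fix p assume p: "p \<le> n"
    show "restr_dim n y I p d \<le> restr_dim n (last_vars n) (mono_ideal n (largest_monomials rlex_greater n d k) :: 'k mpoly set) p d"
      unfolding R(6)[OF p] card_rlex_restriction[OF diff_le_self]
      using restr_dim_upper[OF I(1) good_mono[OF y(1) p] p, of d] rank by simp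
  qed (use I(3) R(4,5) in simp_all)
  show "betti n I \<le> betti n (lex_ideal n d k :: 'k mpoly set)"
    unfolding lex_ideal_def mono_ideal_def[symmetric]
  proof (rule betti_compare[OF L(1) good_last_vars L(2,3) I(1) y(1) start y(2) d _ _ off])
    show "restr_dim n (last_vars n) (mono_ideal n (largest_monomials lex_greater n d k) :: 'k mpoly set) p d \<le> restr_dim n y I p d"
      if "p \<le> n" for p
      using that
    proof (induction p)
      case 0
      have "largest_monomials lex_greater n d k \<inter> monomials n d = largest_monomials lex_greater n d k"
        using largest_subset by blast
      then show ?case using L(6)[of 0] rank card_largest[OF lex_strict_order k] by simp
    next
      case (Suc p)
      let ?c = "\<lambda>m. card (largest_monomials lex_greater n d k \<inter> monomials m d)"
      have m: "n - p = Suc (n - Suc p)" using Suc.prems by simp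
      \<comment> \<open>The lexicographic segment meets Green's bound with equality, so monotonicity
        of \<open>lexr\<close> carries the comparison to one variable fewer.\<close>
      have "?c (n - Suc p) = lexr (n - p) d (?c (n - p))"
        unfolding m by (rule card_lex_restriction) (use Suc.prems in simp)
      also have "\<dots> \<le> lexr (n - p) d (nat (restr_dim n y I p d))"
        by (rule lexr_mono) (use Suc.IH Suc.prems L(6)[of p] in simp)
      finally show ?case using y(3)[of p] Suc.prems L(6)[of "Suc p"] by simp
    qed
  qed (use I(3) L(5) in simp_all)
qed

lemma segment_in_betti_sequences:
  assumes "0 < d" "k \<le> card (monomials n d)"
  shows "betti n (rlex_ideal n d k :: 'k::field mpoly set) \<in> betti_sequences TYPE('k) n d k"
    "betti n (lex_ideal n d k :: 'k mpoly set) \<in> betti_sequences TYPE('k) n d k"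
proof -
  note R = segment_properties[where 'k = 'k, OF rlex_strict_order exchange_properties(1) assms]
  note L = segment_properties[where 'k = 'k, OF lex_strict_order exchange_properties(2) assms]
  show "betti n (rlex_ideal n d k :: 'k mpoly set) \<in> betti_sequences TYPE('k) n d k"
    unfolding rlex_ideal_def mono_ideal_def[symmetric] betti_sequences_def has_linear_resolution_def
    using R(1,4,5) by auto
  show "betti n (lex_ideal n d k :: 'k mpoly set) \<in> betti_sequences TYPE('k) n d k"
    unfolding lex_ideal_def mono_ideal_def[symmetric] betti_sequences_def has_linear_resolution_def
    using L(1,4,5) by auto
qed

section \<open>The case d = 0\<close>

lemma mdim_zero: "mv.dim {0} = 0"
  using mv.dim_zero_iff[of "{0}"] mv.fdim_zero by simp

text \<open>S/I is 0, so all its Tor vanish; only in bidegree (0, 0) does Tor of \<open>I\<close>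
  differ from the shifted Tor of S/I, by the constants.\<close>

lemma (in flagged_resolution) tor_dim_unit:
  assumes I: "I = carrier (poly_ring n)"
  shows "tor_dim F i j = (if i = 0 \<and> j = 0 then 1 else 0)"
proof -
  have Ip: "Ipart n I l = Sd n l" for l using Sd_carrier[of n l] by (auto simp: Ipart_def I)
  have "colon_at n y I p l" if "p < n" for p l
    unfolding colon_at_def IY_def Ip using pv.subspace_0[OF Yd_subspace] by (metis (mono_tags, lifting) CollectI add_0)
  \<comment> \<open>With all colon conditions available, the excluded strand is moved out of the way
    by taking \<open>d = Suc j\<close>.\<close>
  then have "gc.exactT n (Suc i) j" for i j
    by (intro gc.exactT_off_strand[where p = n and R = j and d = "Suc j"]) (auto simp: colon_base)
  then have h0: "gc.hdim n i j = 0" for i j using gc.exactT_hdim[of n i j] by simp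
  show ?thesis
  proof (cases "i = 0 \<and> j = 0")
    case False
    then have "int (tor_dim F i j) = gc.hdim n i j"
      by (intro tor_dim_hdim) (use Y_full_0 in auto)
    then show ?thesis using h0 False by simp
  next
    case True
    have B: "gc.B n (Suc 0) 0 = {v \<in> M (Suc 0) 0. D 0 v = 0}"
    proof
      show "gc.B n (Suc 0) 0 \<subseteq> {v \<in> M (Suc 0) 0. D 0 v = 0}"
        using gc.B_subset_Z[of n "Suc 0" 0] by (auto simp: gc.Z_Suc)
      show "{v \<in> M (Suc 0) 0. D 0 v = 0} \<subseteq> gc.B n (Suc 0) 0" using gc.cycle_in_B by blast
    qed
    have dims: "kspace.dim (cterm ` A) = mv.dim A" if "mv.subspace A" "A \<subseteq> M (Suc 0) 0" for A
      using cterm_dim[OF that(1) _ that(2)] mv.subspace_0[OF that(1)] by (simp add: mdim_zero)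
    have "mv.dim (D 0 ` M (Suc 0) 0) + mv.dim {v \<in> M (Suc 0) 0. D 0 v = 0} = mv.dim (M (Suc 0) 0)"
      by (rule mm.rank_nullity[OF linear_lin_ext gc.M_fdim hpart_subspace])
    moreover have "mv.dim (D 0 ` M (Suc 0) 0) = 1"
      unfolding D_0_image Ip embed_dim[OF Sd_fdim Sd_subspace] by (simp add: Sd_dim)
    moreover have "kspace.dim (tor_boundaries F 0 0) = mv.dim (gc.B n (Suc 0) 0)"
      unfolding tor_boundaries_cterm by (rule dims[OF gc.B_subspace]) (use B in auto)
    moreover have "kspace.dim (tor_cycles F 0 0) = mv.dim (M (Suc 0) 0)"
      using dims[OF hpart_subspace subset_refl] by (simp add: tor_cycles_def cterm_M)
    ultimately show ?thesis using True B by (simp add: tor_dim_def)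
  qed
qed

lemma graded_unit: "graded_ideal n (carrier (poly_ring n) :: 'k::field mpoly set)"
  and unit_conv: "mono_ideal n {0} = (carrier (poly_ring n) :: 'k mpoly set)"
proof -
  show "mono_ideal n {0} = (carrier (poly_ring n) :: 'k mpoly set)"
    by (subst mono_ideal_eq) (auto simp: divisible_def)
  then show "graded_ideal n (carrier (poly_ring n) :: 'k mpoly set)"
    using graded_mono_ideal[of "{0}" n, where ?'k = 'k] by simp
qed

lemma betti_unit: "betti n (carrier (poly_ring n) :: 'k::field mpoly set) i j = (if i = 0 \<and> j = 0 then 1 else 0)"
proof -
  obtain F where F: "graded_free_resolution n (carrier (poly_ring n) :: 'k mpoly set) F"
      "\<And>i j. betti n (carrier (poly_ring n) :: 'k mpoly set) i j = tor_dim F i j"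
    using betti_tor_dim[OF graded_unit] by blast
  obtain y :: "nat \<Rightarrow> 'k mpoly" where y: "good n n y" by (rule good_exists)
  show ?thesis
    unfolding F(2) by (rule flagged_resolution.tor_dim_unit[OF graded_ideal_resolution[OF graded_unit F(1) y] refl])
qed

lemma zero_conv: "mono_ideal n {} = ({0} :: 'k::field mpoly set)"
proof -
  have "p = 0" if "\<forall>a\<in>keys p. divisible {} a" for p :: "'k mpoly"
    using that by (metis divisible_def empty_iff equals0I keys_eq_empty)
  then show ?thesis by (subst mono_ideal_eq) (auto simp: carrier_poly_ring)
qed

text \<open>The strand formula in the auxiliary degree 1, where all restriction dimensions are
  0.\<close>

lemma betti_zero: "betti n ({0} :: 'k::field mpoly set) i j = 0"
proof -
  have g: "graded_ideal n ({0} :: 'k mpoly set)"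
    using graded_mono_ideal[of "{}" n, where ?'k = 'k] by (simp add: zero_conv)
  obtain y :: "nat \<Rightarrow> 'k mpoly" where y: "good n n y" by (rule good_exists)
  have Ip: "Ipart n ({0} :: 'k mpoly set) l = {0}" for l by (auto simp: Ipart_def Sd_0)
  have IY: "IY n y {0} p l = Yd n y p l" for p l by (auto simp: IY_def Ip)
  have "colon_at n y {0} p l" if "p < n" for p l
    unfolding colon_at_def IY using good_regular[OF good_mono[OF y, of "Suc p"]] that by auto
  then have co: "\<And>p l. p < n \<Longrightarrow> colon_at n y {0} p l" by blast
  show ?thesis
  proof (cases "j = i + 1")
    case True
    have "int (betti n ({0} :: 'k mpoly set) i (i + 1)) = 0"
      using betti_strand[OF g y, of 1 i] co Ip by (simp add: restr_dim_def IY)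
    then show ?thesis using True by simp
  next
    case False
    show ?thesis
      by (rule betti_off_strand[OF g y, of 1 j]) (use co Ip False in auto)
  qed
qed

text \<open>Without constants in \<open>I\<close>, Nakayama empties one degree after the other; a
  nonzero constant generates the unit ideal.\<close>

lemma linear_degree_0:
  fixes I :: "'k::field mpoly set"
  assumes "graded_ideal n I" "has_linear_resolution n 0 I"
  shows "I = {0} \<or> I = carrier (poly_ring n)"
proof (cases "Ipart n I 0 = {0}")
  case True
  obtain y :: "nat \<Rightarrow> 'k mpoly" where y: "good n n y" by (rule good_exists)
  have Ip: "Ipart n I j = {0}" for j
  proof (induction j)
    case (Suc j)
    have "f = 0" if f: "f \<in> Ipart n I (Suc j)" for f
    proof -
      obtain g where g: "f = (\<Sum>q<n. y q * g q)" "\<forall>q<n. g q \<in> Ipart n I j"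
        using linear_resolution_generated[OF assms y, of "Suc j" f] f by (auto simp: Ysum_Suc)
      then show ?thesis using Suc by simp
    qed
    then show ?case using Ipart_zero[OF assms(1)] by blast
  qed (rule True)
  have "p = 0" if p: "p \<in> I" for p
  proof (rule poly_mapping_eqI)
    fix a
    have "hom_component (mdeg a) p \<in> I" using assms(1) p by (simp add: graded_ideal_def)
    moreover have "p \<in> carrier (poly_ring n)" using graded_ideal_carrier[OF assms(1)] p by blast
    then have "hom_component (mdeg a) p \<in> Sd n (mdeg a)"
      by (auto simp: Sd_iff in_keys_iff lookup_hom_component carrier_poly_ring split: if_splits)
    ultimately have "hom_component (mdeg a) p = 0" using Ip[of "mdeg a"] by (auto simp: Ipart_def)
    then have "lookup (hom_component (mdeg a) p) a = 0" by simp
    then show "lookup p a = lookup 0 a" by (simp add: lookup_hom_component)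
  qed
  moreover have "0 \<in> I" using Ipart_zero[OF assms(1), of 0] by (simp add: Ipart_def)
  ultimately show ?thesis by blast
next
  case False
  have id: "ideal I (poly_ring n)" using assms(1) by (simp add: graded_ideal_def)
  obtain f where f: "f \<in> I" "f \<in> Sd n 0" "f \<noteq> 0"
    using False Ipart_zero[OF assms(1), of 0] by (auto simp: Ipart_def)
  then obtain c where c: "f = Poly_Mapping.single 0 c" by (auto simp: Sd_const)
  then have "c \<noteq> 0" using f(3) by auto
  have "p \<in> I" if "p \<in> carrier (poly_ring n)" for p
  proof -
    have "p * Poly_Mapping.single 0 (inverse c) * f \<in> I"
      by (intro ideal_mult[OF id] carrier_mult carrier_const that f)
    then show ?thesis using c \<open>c \<noteq> 0\<close> by (simp add: mult.assoc mult_single)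
  qed
  then show ?thesis using graded_ideal_carrier[OF assms(1)] by blast
qed

theorem corollary4p5:
  fixes n d k :: nat
  assumes "infinite (UNIV :: 'k::field set)"
    and "k \<le> (n + d - 1) choose d"
  shows "(\<forall>b. minimal_in (betti_sequences TYPE('k) n d k) b \<longleftrightarrow>
                b = betti n (rlex_ideal n d k :: 'k mpoly set)) \<and>
         (\<forall>b. maximal_in (betti_sequences TYPE('k) n d k) b \<longleftrightarrow>
                b = betti n (lex_ideal n d k :: 'k mpoly set))"
proof -
  let ?B = "betti_sequences TYPE('k) n d k"
  let ?r = "betti n (rlex_ideal n d k :: 'k mpoly set)" and ?l = "betti n (lex_ideal n d k :: 'k mpoly set)"
  have k: "k \<le> card (monomials n d)" using assms(2) by (simp add: card_monomials length_wd)
  \<comment> \<open>A least and a greatest element are the only minimal and the only maximal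
    one.\<close>
  have "?r \<in> ?B \<and> ?l \<in> ?B \<and> (\<forall>c\<in>?B. ?r \<le> c \<and> c \<le> ?l)"
  proof (cases "d = 0")
    case False
    then show ?thesis
      using segment_in_betti_sequences[of d k n, where ?'k = 'k] betti_bounds[OF assms(1) _ k] k
      by (auto simp: betti_sequences_def)
  next
    case True
    \<comment> \<open>The monomial 1 is alone in degree 0, so both segment ideals are zero for
      \<open>k = 0\<close> and the unit ideal for \<open>k = 1\<close>, and \<open>?B\<close> has a
      single element.\<close>
    have m0: "monomials n 0 = {0}" by (auto simp: monomials_def)
    have cases: "k = 0 \<or> k = 1" using k True m0 by auto
    define I :: "'k mpoly set" where "I = (if k = 0 then {0} else carrier (poly_ring n))"
    have big: "largest_monomials gt n 0 k = (if k = 0 then {} else {0})"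
      if "\<And>a. \<not> gt a a" for gt :: "(nat \<Rightarrow>\<^sub>0 nat) \<Rightarrow> (nat \<Rightarrow>\<^sub>0 nat) \<Rightarrow> bool"
    proof -
      have none: "{b. b = 0 \<and> gt b 0} = {}" using that by blast
      show ?thesis by (auto simp: largest_monomials_def m0 none)
    qed
    have ideals: "rlex_ideal n d k = I" "lex_ideal n d k = I"
      unfolding rlex_ideal_def lex_ideal_def mono_ideal_def[symmetric] True I_def
      using big[of rlex_greater] big[of lex_greater] unit_conv[of n, where ?'k = 'k] zero_conv[of n, where ?'k = 'k]
      by (simp_all add: rlex_greater_def lex_greater_def)
    have "graded_ideal n I"
      using graded_unit[of n, where ?'k = 'k] graded_mono_ideal[of "{}" n, where ?'k = 'k] by (simp add: I_def zero_conv)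
    moreover have "has_linear_resolution n d I" "betti n I 0 d = k"
      using cases True by (auto simp: has_linear_resolution_def I_def betti_zero betti_unit)
    moreover have "J = I" if "graded_ideal n J" "has_linear_resolution n d J" "betti n J 0 d = k" for J :: "'k mpoly set"
      using linear_degree_0[of n J] that cases True by (auto simp: I_def betti_zero betti_unit)
    ultimately have "?B = {betti n I}" unfolding betti_sequences_def by blast
    then show ?thesis by (simp add: ideals)
  qed
  then show ?thesis
    unfolding minimal_in_def maximal_in_def by (metis order_antisym order_refl)
qed

end
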